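(* Let $r,s\in\mathbb{N}$ with $s\le r$, $1\le p<\infty$ and $f\in\Lambda^p$. Let $(G_W)_{W>0}$ be linear operators of the form $G_W(g)(x)=\sum_{k=-\infty}^{+\infty}g(x_{k,W})\varphi_{k,W}(x)$. Assume that there are constants $K_1=K_1(p)>0$, $K_2=K_2(p)>0$, $K_3=K_3(s,p)>0$ such that for all $W>0$ $$K_2\|g\|_{\ell_p(\Sigma_W)}\le\|G_W(g)\|_p\le K_1\|g\|_{\ell_p(\Sigma_W)}\quad(g\in\Lambda^p),\qquad\|g-G_W(g)\|_p\le K_3W^{-s}\|g^{(s)}\|_p\quad(g\in W^s_p(\mathbb{R})).$$ If $G_W(f)\in\mathcal{B}^p_W$ for all $W>0$ and there exists a constant $K>0$ such that $$\omega_s(f,h)_p\le K\,\omega_{s+1}(f,h)_p,\qquad h>0,$$ then $$\|f-G_W(f)\|_p\asymp\tilde\Omega_{r,s}\left(f,\tfrac1W,\Sigma_W\right)_p,$$ i.e. each side is bounded by a positive constant times the other, with constants independent of $W>0$.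
   Context: Conventions: $\mathbb{N}=\{1,2,\dots\}$; functions are defined pointwise (functions equal almost everywhere are not identified); $\|\cdot\|_p$ is the $L^p(\mathbb{R})$ norm. $W^s_p(\mathbb{R})$ is the usual Sobolev space, whose elements are taken as functions $g\in L^p(\mathbb{R})$ with $g,\dots,g^{(s-1)}$ locally absolutely continuous and $g^{(s)}\in L^p(\mathbb{R})$. In the definition of $G_W$, $x_{k,W}\in\mathbb{R}$ are nodes and $\varphi_{k,W}$ are functions on $\mathbb{R}$; the series is understood to converge, so that $G_W$ is a well-defined linear operator on $\Lambda^p$. $\mathcal{B}^p_\sigma$ is the set of (restrictions to $\mathbb{R}$ of) complex-valued entire functions of exponential type $\sigma$ (i.e. at most $\sigma$) whose restriction to $\mathbb{R}$ belongs to $L^p(\mathbb{R})$. $M(\mathbb{R})$ is the set of bounded measurable functions on $\mathbb{R}$. A sequence $\Sigma=(x_j)_{j\in\mathbb{Z}}\subset\mathbb{R}$ is admissible if $0<\inf_j(x_j-x_{j-1})\le\sup_j(x_j-x_{j-1})<\infty$; put $\|f\|_{\ell_p(\Sigma)}=\big(\sum_{j\in\mathbb{Z}}|f(x_j)|^p(x_j-x_{j-1})\big)^{1/p}$. $\Lambda^p=\{f\in M(\mathbb{R}):\|f\|_{\ell_p(\Sigma)}<\infty\text{ for every admissible }\Sigma\}$; one has $W^s_p(\mathbb{R})\subset\Lambda^p\subset L^p(\mathbb{R})$. $\Sigma_W=(j/W)_{j\in\mathbb{Z}}$, so $\|f\|_{\ell_p(\Sigma_W)}=\big(\frac1W\sum_{j\in\mathbb{Z}}|f(j/W)|^p\big)^{1/p}$.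 Modulus of smoothness: $\Delta_h^s f(x)=\sum_{k=0}^s\binom sk(-1)^{s-k}f(x+kh)$, $\omega_s(f,\delta)_p=\sup_{0<h\le\delta}\|\Delta_h^sf\|_p$. Steklov averages ($\delta>0$): $\tilde f_{\delta,r}(x)=(-\delta)^{-r}\int_0^\delta\cdots\int_0^\delta\sum_{m=1}^r(-1)^{r-m+1}\binom rm f\big(x+\frac mr(t_1+\dots+t_r)\big)\,dt_1\cdots dt_r$. Semi-discrete modulus: $\tilde\Omega_{r,s}(f,\frac1W,\Sigma_W)_p=\|\tilde f_{1/W,r}-f\|_{\ell_p(\Sigma_W)}+\omega_s(f,1/W)_p$. *)

theory Defs
  imports "HOL-Analysis.Analysis"
begin

text \<open>Functions on the line are complex-valued and are not identified when they agree almost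
  everywhere; measurable means Lebesgue measurable. Norms take values in \<^typ>\<open>ennreal\<close>, so that
  divergent integrals, series and suprema have the value \<open>\<infinity>\<close>.\<close>

definition ennreal_root :: "real \<Rightarrow> ennreal \<Rightarrow> ennreal" where
  "ennreal_root p a = (if a = \<infinity> then \<infinity> else ennreal (enn2real a powr (1 / p)))"

definition Lp_norm :: "real \<Rightarrow> (real \<Rightarrow> complex) \<Rightarrow> ennreal" where
  "Lp_norm p f = ennreal_root p (\<integral>\<^sup>+ x. ennreal (cmod (f x) powr p) \<partial>lebesgue)"

definition Lp_space :: "real \<Rightarrow> (real \<Rightarrow> complex) set" where
  "Lp_space p = {f. f \<in> borel_measurable lebesgue \<and> Lp_norm p f < \<infinity>}"


definition admissible :: "(int \<Rightarrow> real) \<Rightarrow> bool" where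
  "admissible \<Sigma> \<longleftrightarrow>
     0 < (INF j. ereal (\<Sigma> j - \<Sigma> (j - 1))) \<and> (SUP j. ereal (\<Sigma> j - \<Sigma> (j - 1))) < \<infinity>"

definition lp_norm :: "real \<Rightarrow> (int \<Rightarrow> real) \<Rightarrow> (real \<Rightarrow> complex) \<Rightarrow> ennreal" where
  "lp_norm p \<Sigma> f =
     ennreal_root p (\<Sum>\<^sub>\<infinity>j\<in>UNIV. ennreal (cmod (f (\<Sigma> j)) powr p * (\<Sigma> j - \<Sigma> (j - 1))))"

definition bounded_measurable :: "(real \<Rightarrow> complex) set" where
  "bounded_measurable = {f. f \<in> borel_measurable lebesgue \<and> bounded (range f)}"

definition Lambda_space :: "real \<Rightarrow> (real \<Rightarrow> complex) set" where
  "Lambda_space p = {f \<in> bounded_measurable. \<forall>\<Sigma>. admissible \<Sigma> \<longrightarrow> lp_norm p \<Sigma> f < \<infinity>}"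

definition uniform_nodes :: "real \<Rightarrow> int \<Rightarrow> real" where
  "uniform_nodes W = (\<lambda>j. of_int j / W)"


definition absolutely_continuous_on_interval ::
    "real \<Rightarrow> real \<Rightarrow> (real \<Rightarrow> complex) \<Rightarrow> bool" where
  "absolutely_continuous_on_interval a b g \<longleftrightarrow>
     (\<forall>\<epsilon>>0. \<exists>\<delta>>0. \<forall>(n::nat) u v.
        (\<forall>i<n. a \<le> u i \<and> u i \<le> v i \<and> v i \<le> b) \<and>
        disjoint_family_on (\<lambda>i. {u i<..<v i}) {..<n} \<and>
        (\<Sum>i<n. v i - u i) < \<delta> \<longrightarrow>
        (\<Sum>i<n. cmod (g (v i) - g (u i))) < \<epsilon>)"

definition locally_absolutely_continuous :: "(real \<Rightarrow> complex) \<Rightarrow> bool" where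
  "locally_absolutely_continuous g \<longleftrightarrow> (\<forall>a b. absolutely_continuous_on_interval a b g)"

definition nth_deriv :: "nat \<Rightarrow> (real \<Rightarrow> complex) \<Rightarrow> real \<Rightarrow> complex" where
  "nth_deriv n g = ((\<lambda>h x. vector_derivative h (at x)) ^^ n) g"

text \<open>The derivatives of order less than \<open>s\<close> exist everywhere. The derivative of order \<open>s\<close>
  exists almost everywhere, by local absolute continuity of the one of order \<open>s - 1\<close>; its
  arbitrary values on the exceptional null set affect neither measurability nor the norm.\<close>

definition Sobolev_space :: "nat \<Rightarrow> real \<Rightarrow> (real \<Rightarrow> complex) set" where
  "Sobolev_space s p =
     {g \<in> Lp_space p.
        (\<forall>k. Suc k < s \<longrightarrow> (\<forall>x. nth_deriv k g differentiable (at x))) \<and>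
        (\<forall>k<s. locally_absolutely_continuous (nth_deriv k g)) \<and>
        nth_deriv s g \<in> Lp_space p}"


definition exponential_type_le :: "real \<Rightarrow> (complex \<Rightarrow> complex) \<Rightarrow> bool" where
  "exponential_type_le \<sigma> F \<longleftrightarrow>
     (\<forall>\<epsilon>>0. \<exists>A. \<forall>z. cmod (F z) \<le> A * exp ((\<sigma> + \<epsilon>) * cmod z))"

definition Bernstein_space :: "real \<Rightarrow> real \<Rightarrow> (real \<Rightarrow> complex) set" where
  "Bernstein_space \<sigma> p =
     {g \<in> Lp_space p. \<exists>F. F holomorphic_on UNIV \<and> exponential_type_le \<sigma> F \<and>
        (\<forall>x. g x = F (complex_of_real x))}"


definition fwd_diff :: "nat \<Rightarrow> real \<Rightarrow> (real \<Rightarrow> complex) \<Rightarrow> real \<Rightarrow> complex" where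
  "fwd_diff s h f x = (\<Sum>k=0..s. of_nat (s choose k) * (-1) ^ (s - k) * f (x + real k * h))"

definition modulus_smoothness :: "nat \<Rightarrow> real \<Rightarrow> (real \<Rightarrow> complex) \<Rightarrow> real \<Rightarrow> ennreal" where
  "modulus_smoothness s p f \<delta> = (SUP h\<in>{0<..\<delta>}. Lp_norm p (fwd_diff s h f))"

text \<open>\<open>cube_integral n \<delta> F u\<close> is the \<open>n\<close>-fold iterated integral of
  \<open>F (u + t\<^sub>1 + \<dots> + t\<^sub>n)\<close> over \<open>t\<^sub>1, \<dots>, t\<^sub>n \<in> [0, \<delta>]\<close>.\<close>

primrec cube_integral :: "nat \<Rightarrow> real \<Rightarrow> (real \<Rightarrow> complex) \<Rightarrow> real \<Rightarrow> complex" where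
  "cube_integral 0 \<delta> F u = F u"
| "cube_integral (Suc n) \<delta> F u = (LINT t:{0..\<delta>}|lebesgue. cube_integral n \<delta> F (u + t))"

definition Steklov :: "real \<Rightarrow> nat \<Rightarrow> (real \<Rightarrow> complex) \<Rightarrow> real \<Rightarrow> complex" where
  "Steklov \<delta> r f x =
     of_real (inverse ((- \<delta>) ^ r)) *
     cube_integral r \<delta>
       (\<lambda>u. \<Sum>m=1..r. (-1) ^ (r - m + 1) * of_nat (r choose m) * f (x + real m / real r * u)) 0"

definition semidiscrete_modulus ::
    "nat \<Rightarrow> nat \<Rightarrow> real \<Rightarrow> (real \<Rightarrow> complex) \<Rightarrow> real \<Rightarrow> (int \<Rightarrow> real) \<Rightarrow> ennreal" where
  "semidiscrete_modulus r s p f \<delta> \<Sigma> =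
     lp_norm p \<Sigma> (\<lambda>x. Steklov \<delta> r f x - f x) + modulus_smoothness s p f \<delta>"


text \<open>Convergence of the two-sided series is convergence of the symmetric partial sums at every
  point. This is the least restrictive pointwise reading: unconditional convergence, or separate
  convergence of the two halves, implies it with the same sum. Linearity of \<open>T\<close> on
  \<open>Lambda_space p\<close> follows from this form.\<close>

definition sampling_operator ::
    "real \<Rightarrow> (int \<Rightarrow> real) \<Rightarrow> (int \<Rightarrow> real \<Rightarrow> complex) \<Rightarrow>
     ((real \<Rightarrow> complex) \<Rightarrow> real \<Rightarrow> complex) \<Rightarrow> bool" where
  "sampling_operator p \<xi> \<phi> T \<longleftrightarrow>
     (\<forall>g\<in>Lambda_space p. \<forall>x.
        (\<lambda>n. \<Sum>k=-int n..int n. g (\<xi> k) * \<phi> k x) \<longlonglongrightarrow> T g x)"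

end

theory Submission
  imports Defs "HOL-Complex_Analysis.Complex_Analysis" "HOL-Real_Asymp.Real_Asymp"
begin

text \<open>Write \<open>F\<close> for the Steklov average of \<open>f\<close> with \<open>\<delta> = 1/W\<close>, \<open>\<omega>\<close> for the modulus of smoothness of order
  \<open>s\<close> at \<open>1/W\<close> and \<open>q\<close> for the discrete norm of \<open>F - f\<close>. The average satisfies
  \<open>\<parallel>F - f\<parallel>\<^sub>p \<le> C \<omega>\<close> and \<open>\<parallel>F\<^sup>(\<^sup>s\<^sup>)\<parallel>\<^sub>p \<le> C W\<^sup>s \<omega>\<close>, and it belongs to both \<open>\<Lambda>\<^sup>p\<close> and the Sobolev space
  (\<open>Steklov_approximation\<close>). Since \<open>G\<^sub>W\<close> is linear on \<open>\<Lambda>\<^sup>p\<close>,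

    \<open>f - G\<^sub>W f = (f - F) + (F - G\<^sub>W F) + G\<^sub>W (F - f)\<close>.

  The first two terms are bounded by \<open>\<omega>\<close>, the last one is comparable with \<open>q\<close>. This proves the upper
  estimate, and read from right to left it bounds \<open>q\<close> by \<open>\<omega>\<close> and the error \<open>\<parallel>f - G\<^sub>W f\<parallel>\<^sub>p\<close>. What remains is
  to bound \<open>\<omega>\<close> by the error.

  Here the error is the distance from \<open>f\<close> to a function \<open>g = G\<^sub>W f\<close> of exponential type \<open>W\<close>. For such \<open>g\<close>
  differences of order \<open>s + 1\<close> with step at most \<open>1/(n W)\<close> are bounded by \<open>C n\<^sup>-\<^sup>s\<^sup>-\<^sup>1\<close> times a difference of order
  \<open>s\<close> with a step comparable to \<open>1/W\<close> (\<open>nikolskii_stechkin_Lp\<close>). Together with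
  \<open>\<omega>\<^sub>s(f, 1/W) \<le> n\<^sup>s \<omega>\<^sub>s(f, 1/(n W))\<close> and the hypothesis \<open>\<omega>\<^sub>s \<le> K \<omega>\<^sub>s\<^sub>+\<^sub>1\<close> this yields
  \<open>\<omega> \<le> C\<^sub>n \<parallel>f - g\<parallel>\<^sub>p + (C/n) \<omega>\<close>, and a large \<open>n\<close> finishes the proof
  (\<open>modulus_smoothness_inverse_estimate\<close>).

  The inequality for \<open>g\<close> is proved first in the supremum norm. A Phragmen-Lindeloef argument gives
  \<open>\<bar>H z\<bar> \<le> sup \<bar>H\<bar> exp (\<tau> \<bar>Im z\<bar>)\<close> for entire \<open>H\<close> of type \<open>\<tau>\<close> bounded on the line, and Cauchy's estimate
  then gives Bernstein's inequality up to a constant, from which comparisons of increments with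
  different steps follow. The passage to \<open>L\<^sup>p\<close> is by duality (\<open>Lp_norm_fwd_diff_transfer\<close>): averaging
  \<open>g\<close> against the extremal dual function produces a bounded function of the same type.

  For the Steklov average, the space \<open>\<Lambda>\<^sup>p\<close> is identified with the bounded measurable functions whose suprema
  over the intervals between consecutive integers are \<open>p\<close>-summable; this space is visibly contained in \<open>L\<^sup>p\<close> and stable under local
  averages. The derivatives of the average come from Lebesgue's differentiation theorem; if \<open>s = r\<close>,
  the one of order \<open>s\<close> exists only almost everywhere.\<close>

section \<open>Entire functions of exponential type that are bounded on the line\<close>

text \<open>A function of order one in a sector of angle \<open>\<pi>/2\<close> obeys the maximum principle. With \<open>z = exp w\<close>
  the sector outside the unit disc becomes a half-strip, and multiplication by
  \<open>exp (- \<delta> z\<^sup>3\<^sup>/\<^sup>2)\<close>, rotated so that the bisector of the sector becomes the positive axis, makes the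
  function small at the far end of a long rectangle; then \<open>\<delta>\<close> tends to \<open>0\<close>. The exponent \<open>3/2\<close>
  lies between the order \<open>1\<close> of the function and the critical order \<open>2\<close> of the sector.\<close>

lemma phragmen_lindelof_sector:
  fixes F :: "complex \<Rightarrow> complex"
  assumes hol: "F holomorphic_on UNIV"
    and growth: "\<And>z. cmod (F z) \<le> A * exp (c * cmod z)"
    and disc: "\<And>z. cmod z = 1 \<Longrightarrow> cmod (F z) \<le> B"
    and rays: "\<And>t. t \<ge> 1 \<Longrightarrow> cmod (F (rcis t \<alpha>)) \<le> B" "\<And>t. t \<ge> 1 \<Longrightarrow> cmod (F (rcis t (\<alpha> + pi/2))) \<le> B"
    and "t \<ge> 1" and th: "\<alpha> \<le> \<theta>" "\<theta> \<le> \<alpha> + pi/2" and "B > 0"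
  shows "cmod (F (rcis t \<theta>)) \<le> B"
proof -
  define c' where "c' = max c 1"
  define \<kappa> where "\<kappa> = cos (3 * pi / 8)"
  have c': "c' > 0" by (auto simp: c'_def)
  have A: "A \<ge> 0" using growth[of 0] norm_ge_zero[of "F 0"] by (simp del: norm_ge_zero)
  have growth': "cmod (F z) \<le> A * exp (c' * cmod z)" for z
    using A growth[of z] by (smt (verit) c'_def exp_le_cancel_iff mult_left_mono mult_right_mono norm_ge_zero)
  have \<kappa>: "\<kappa> > 0" unfolding \<kappa>_def by (rule cos_gt_zero_pi) auto
  have coslow: "cos (3/2 * (y - (\<alpha> + pi/4))) \<ge> \<kappa>" if "\<alpha> \<le> y" "y \<le> \<alpha> + pi/2" for y
  proof -
    have a: "\<bar>3/2 * (y - (\<alpha> + pi/4))\<bar> \<le> 3 * pi / 8"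
      using that by (auto simp: abs_le_iff field_simps)
    have "cos \<bar>3/2 * (y - (\<alpha> + pi/4))\<bar> \<ge> cos (3 * pi / 8)"
      by (intro cos_monotone_0_pi_le a) auto
    thus ?thesis by (simp only: cos_abs_real \<kappa>_def)
  qed
  define x where "x = ln t"
  have x: "x \<ge> 0" "exp x = t" using \<open>t \<ge> 1\<close> by (auto simp: x_def)
  have nE: "cmod (exp (- of_real \<delta> * exp (3/2 * (w - \<i> * of_real (\<alpha> + pi/4)))))
      = exp (- \<delta> * exp (3/2 * Re w) * cos (3/2 * (Im w - (\<alpha> + pi/4))))" for \<delta> w
    by (simp add: Re_exp mult.assoc)
  have main: "cmod (F (rcis t \<theta>)) * exp (- \<delta> * exp (3/2 * x)) \<le> B" if "\<delta> > 0" for \<delta>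
  proof -
    \<comment> \<open>the damped function, in the coordinate \<open>w = ln z\<close>\<close>
    define \<Phi> where "\<Phi> = (\<lambda>w. F (exp w) * exp (- of_real \<delta> * exp (3/2 * (w - \<i> * of_real (\<alpha> + pi/4)))))"
    have "((\<lambda>L. A * exp (c' * exp L - \<delta> * \<kappa> * exp (3/2 * L))) \<longlongrightarrow> 0) at_top"
    proof -
      have "((\<lambda>L. A * exp (b * exp L - d * exp (3/2 * L))) \<longlongrightarrow> 0) at_top" if "d > 0" "b > 0" for b d :: real
        using that by real_asymp
      thus ?thesis using that \<kappa> c' by simp
    qed
    hence "eventually (\<lambda>L. A * exp (c' * exp L - \<delta> * \<kappa> * exp (3/2 * L)) < B) at_top"
      using \<open>B > 0\<close> by (rule order_tendstoD)
    hence "eventually (\<lambda>L. A * exp (c' * exp L - \<delta> * \<kappa> * exp (3/2 * L)) < B \<and> L > x) at_top"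
      using eventually_gt_at_top by (rule eventually_conj)
    then obtain L where L: "A * exp (c' * exp L - \<delta> * \<kappa> * exp (3/2 * L)) < B" "L > x"
      by (auto dest: eventually_happens)
    define S where "S = cbox (Complex 0 \<alpha>) (Complex L (\<alpha> + pi/2))"
    have holF: "\<Phi> holomorphic_on X" for X
      unfolding \<Phi>_def by (intro holomorphic_intros holomorphic_on_compose_gen[OF _ hol, unfolded o_def]) auto
    have "cmod (\<Phi> (Complex x \<theta>)) \<le> B"
    proof (rule maximum_modulus_frontier[of \<Phi> S])
      show "\<Phi> holomorphic_on interior S" by (rule holF)
      show "continuous_on (closure S) \<Phi>" by (rule holomorphic_on_imp_continuous_on[OF holF])
      show "bounded S" by (simp add: S_def)
      show "Complex x \<theta> \<in> S" using x L th by (auto simp: S_def in_cbox_complex_iff)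
    next
      fix w assume "w \<in> frontier S"
      hence w: "0 \<le> Re w" "Re w \<le> L" "\<alpha> \<le> Im w" "Im w \<le> \<alpha> + pi/2"
         and w': "Re w = 0 \<or> Re w = L \<or> Im w = \<alpha> \<or> Im w = \<alpha> + pi/2"
        by (auto simp: S_def frontier_cbox in_cbox_complex_iff in_box_complex_iff)
      have rc: "exp w = rcis (exp (Re w)) (Im w)"
        by (simp add: exp_eq_polar rcis_def)
      have cs: "cos (3/2 * (Im w - (\<alpha> + pi/4))) \<ge> \<kappa>" by (rule coslow) fact+
      have n: "cmod (\<Phi> w) = cmod (F (exp w)) * exp (- \<delta> * exp (3/2 * Re w) * cos (3/2 * (Im w - (\<alpha> + pi/4))))"
        unfolding \<Phi>_def norm_mult nE ..
      have e1: "exp (- \<delta> * exp (3/2 * Re w) * cos (3/2 * (Im w - (\<alpha> + pi/4)))) \<le> 1"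
        using cs \<kappa> that by (simp add: mult_nonneg_nonneg)
      have e2: "exp (- \<delta> * exp (3/2 * Re w) * cos (3/2 * (Im w - (\<alpha> + pi/4)))) \<le> exp (- \<delta> * \<kappa> * exp (3/2 * Re w))"
        using cs that by (simp add: mult.commute mult.left_commute)
      show "cmod (\<Phi> w) \<le> B"
      proof (cases "Re w = L")
        case True
        have "cmod (\<Phi> w) \<le> (A * exp (c' * exp L)) * exp (- \<delta> * \<kappa> * exp (3/2 * L))"
          unfolding n using growth'[of "exp w"] e2 True A by (intro mult_mono) auto
        also have "\<dots> = A * exp (c' * exp L - \<delta> * \<kappa> * exp (3/2 * L))"
          by (simp add: exp_diff exp_minus field_simps)
        finally show ?thesis using L by simp
      next
        case False
        have "cmod (F (exp w)) \<le> B"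
          using False w' disc[of "exp w"] rays[of "exp (Re w)"] w(1) unfolding rc by auto
        hence "cmod (\<Phi> w) \<le> B * 1"
          unfolding n using e1 \<open>B > 0\<close> by (intro mult_mono) auto
        thus ?thesis by simp
      qed
    qed
    moreover have "cmod (\<Phi> (Complex x \<theta>)) = cmod (F (rcis t \<theta>)) * exp (- \<delta> * exp (3/2 * x) * cos (3/2 * (\<theta> - (\<alpha> + pi/4))))"
      unfolding \<Phi>_def norm_mult nE by (simp add: exp_eq_polar rcis_def x)
    moreover have "exp (- \<delta> * exp (3/2 * x)) \<le> exp (- \<delta> * exp (3/2 * x) * cos (3/2 * (\<theta> - (\<alpha> + pi/4))))"
      using that by (simp add: mult_left_le)
    ultimately show ?thesis
      by (smt (verit) mult_left_mono norm_ge_zero)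
  qed
  have "((\<lambda>\<delta>. cmod (F (rcis t \<theta>)) * exp (- \<delta> * exp (3/2 * x))) \<longlongrightarrow> cmod (F (rcis t \<theta>)) * exp (- 0 * exp (3/2 * x))) (at_right 0)"
    by (intro tendsto_intros)
  moreover have "eventually (\<lambda>\<delta>. cmod (F (rcis t \<theta>)) * exp (- \<delta> * exp (3/2 * x)) \<le> B) (at_right 0)"
    using main by (auto simp: eventually_at_filter)
  ultimately have "cmod (F (rcis t \<theta>)) * exp (- 0 * exp (3/2 * x)) \<le> B"
    by (intro tendsto_upperbound) auto
  thus ?thesis by simp
qed


text \<open>The two quadrants show that \<open>F\<close> is bounded by some \<open>B\<close> in the closed half-plane. To replace \<open>B\<close>
  by the bound \<open>M\<close> on the line, apply the maximum principle on large half-discs to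
  \<open>F\<^sup>n / (z + \<i>)\<close>, which tends to \<open>0\<close> at infinity; the factor \<open>z + \<i>\<close> disappears on taking
  \<open>n\<close>-th roots.\<close>

lemma phragmen_lindelof_half_plane:
  fixes F :: "complex \<Rightarrow> complex"
  assumes hol: "F holomorphic_on UNIV"
    and growth: "\<And>z. cmod (F z) \<le> A * exp (c * cmod z)"
    and real: "\<And>x. cmod (F (of_real x)) \<le> M"
    and imag: "\<And>y. y \<ge> 0 \<Longrightarrow> cmod (F (\<i> * of_real y)) \<le> A'"
    and "Im z \<ge> 0"
  shows "cmod (F z) \<le> M"
proof -
  have M: "M \<ge> 0" using real[of 0] norm_ge_zero order_trans by blast
  have "compact (F ` cball 0 1)"
    by (intro compact_continuous_image holomorphic_on_imp_continuous_on holomorphic_on_subset[OF hol]) auto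
  then obtain B0 where B0: "\<And>w. cmod w \<le> 1 \<Longrightarrow> cmod (F w) \<le> B0"
    using compact_imp_bounded[of "F ` cball 0 1"] unfolding bounded_iff by force
  define B where "B = Max {B0, M, A', 1}"
  have B: "B \<ge> B0" "B \<ge> M" "B \<ge> A'" "B > 0" by (auto simp: B_def intro: less_le_trans[OF _ Max_ge, of _ 1])
  have bounded: "cmod (F w) \<le> B" if "Im w \<ge> 0" for w
  proof (cases "cmod w \<le> 1")
    case True thus ?thesis using B0[of w] B by simp
  next
    case False
    have w: "w = rcis (cmod w) (Arg w)" by (simp add: rcis_cmod_Arg)
    have a: "0 \<le> Arg w" "Arg w \<le> pi"
      using that Arg_less_0[of w] Arg_le_pi[of w] by auto
    have r0: "cmod (F (rcis t 0)) \<le> B" for t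
      using real[of t] B by simp
    have r1: "cmod (F (rcis t (pi/2))) \<le> B" if "t \<ge> 0" for t
      using imag[of t] B that by (simp add: rcis_def mult.commute)
    have r2: "cmod (F (rcis t pi)) \<le> B" for t
      using real[of "-t"] B by (simp add: rcis_def)
    have d: "cmod (F v) \<le> B" if "cmod v = 1" for v
      using B0[of v] B that by simp
    show ?thesis
    proof (cases "Arg w \<le> pi/2")
      case True
      show ?thesis
        by (subst w, rule phragmen_lindelof_sector[OF hol growth d, where \<alpha>=0])
           (use True False a r0 r1 B in auto)
    next
      case False2: False
      show ?thesis
        by (subst w, rule phragmen_lindelof_sector[OF hol growth d, where \<alpha>="pi/2"])
           (use False2 False a r1 r2 B in auto)
    qed
  qed
  have strict: "cmod (F z) \<le> M'" if "M' > M" for M'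
  proof (rule ccontr)
    assume "\<not> cmod (F z) \<le> M'"
    have M': "M' > 0" using M that by simp
    hence "cmod (F z) / M' > 1" using \<open>\<not> cmod (F z) \<le> M'\<close> by simp
    \<comment> \<open>\<open>n\<close> so large that the factor \<open>\<bar>z + \<i>\<bar>\<close> cannot compensate the excess at \<open>z\<close>\<close>
    then obtain n where n: "cmod (z + \<i>) < (cmod (F z) / M') ^ n"
      using real_arch_pow by blast
    define \<rho> where "\<rho> = 1 + cmod z + (B / M') ^ n"
    have \<rho>: "cmod z \<le> \<rho>" "\<rho> > 1" "B ^ n / (\<rho> - 1) \<le> M' ^ n"
    proof -
      have q: "(B / M') ^ n > 0" using B M' by simp
      show "cmod z \<le> \<rho>" "\<rho> > 1" using q norm_ge_zero[of z] unfolding \<rho>_def by linarith+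
      have "(B / M') ^ n \<le> \<rho> - 1" using norm_ge_zero[of z] unfolding \<rho>_def by linarith
      hence "B ^ n \<le> M' ^ n * (\<rho> - 1)" using M' by (simp add: power_divide field_simps)
      thus "B ^ n / (\<rho> - 1) \<le> M' ^ n" using \<open>\<rho> > 1\<close> by (simp add: field_simps)
    qed
    define S where "S = {w. Im w \<ge> 0} \<inter> cball 0 \<rho>"
    define G where "G = (\<lambda>w. F w ^ n / (w + \<i>))"
    have nz: "w + \<i> \<noteq> 0" if "Im w \<ge> 0" for w
      using that by (auto simp: complex_eq_iff)
    have closedS: "closed S"
      unfolding S_def using closed_halfspace_Im_ge[of 0] by (intro closed_Int) auto
    have holG: "G holomorphic_on S"
      unfolding G_def by (intro holomorphic_intros holomorphic_on_subset[OF hol]) (auto simp: S_def nz)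
    have "cmod (G z) \<le> M' ^ n"
    proof (rule maximum_modulus_frontier[of G S])
      show "G holomorphic_on interior S" using holG interior_subset by (rule holomorphic_on_subset)
      show "continuous_on (closure S) G"
        using holG closedS by (simp add: holomorphic_on_imp_continuous_on)
      show "bounded S" by (auto simp: S_def)
      show "z \<in> S" using \<rho> assms by (auto simp: S_def)
    next
      fix w assume w: "w \<in> frontier S"
      have "{w. Im w > 0} \<inter> ball 0 \<rho> \<subseteq> interior S"
        by (intro interior_maximal open_Int open_halfspace_Im_gt open_ball) (auto simp: S_def)
      moreover have "w \<in> S" "w \<notin> interior S"
        using w closedS by (auto simp: frontier_def)
      ultimately have "w \<in> S" "Im w = 0 \<or> cmod w = \<rho>"
        by (force simp: S_def)+
      hence im: "Im w \<ge> 0" by (auto simp: S_def)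
      from \<open>Im w = 0 \<or> cmod w = \<rho>\<close> show "cmod (G w) \<le> M' ^ n"
      proof
        assume "Im w = 0"
        hence w: "w = of_real (Re w)" by (simp add: complex_eq_iff)
        have "cmod (F w) \<le> M'" using real[of "Re w"] that by (subst w) simp
        moreover have "cmod (w + \<i>) \<ge> 1"
          using abs_Im_le_cmod[of "w + \<i>"] \<open>Im w = 0\<close> by simp
        ultimately have "cmod (F w) ^ n / cmod (w + \<i>) \<le> M' ^ n / 1"
          using M' by (intro frac_le power_mono) auto
        thus ?thesis by (simp add: G_def norm_divide norm_power)
      next
        assume "cmod w = \<rho>"
        hence "cmod (w + \<i>) \<ge> \<rho> - 1" using norm_diff_ineq[of w \<i>] by simp
        hence "cmod (F w) ^ n / cmod (w + \<i>) \<le> B ^ n / (\<rho> - 1)"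
          using \<rho> bounded[OF im] B by (intro frac_le power_mono) auto
        thus ?thesis using \<rho> by (simp add: G_def norm_divide norm_power)
      qed
    qed
    hence "cmod (F z) ^ n \<le> M' ^ n * cmod (z + \<i>)"
      using nz[OF \<open>Im z \<ge> 0\<close>] by (simp add: G_def norm_divide norm_power field_simps)
    hence "(cmod (F z) / M') ^ n \<le> cmod (z + \<i>)"
      using M' by (simp add: power_divide field_simps)
    thus False using n by simp
  qed
  show ?thesis
    by (rule dense_ge) (rule strict)
qed

text \<open>Multiplication by \<open>exp (\<i> \<tau> z)\<close> turns the growth along the positive imaginary axis into
  boundedness and does not change the modulus on the line, so the half-plane theorem applies.\<close>

lemma entire_bounded_on_real_line_growth:
  fixes H :: "complex \<Rightarrow> complex"
  assumes hol: "H holomorphic_on UNIV" and "\<tau> \<ge> 0"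
    and growth: "\<And>z. cmod (H z) \<le> A * exp (\<tau> * cmod z)"
    and real: "\<And>x. cmod (H (of_real x)) \<le> M"
  shows "cmod (H z) \<le> M * exp (\<tau> * \<bar>Im z\<bar>)"
proof -
  have upper: "cmod (K z) \<le> M * exp (\<tau> * Im z)"
    if K: "K holomorphic_on UNIV" "\<And>z. cmod (K z) \<le> A * exp (\<tau> * cmod z)" "\<And>x. cmod (K (of_real x)) \<le> M"
      "Im z \<ge> 0" for K z
  proof -
    define F where "F = (\<lambda>w. K w * exp (\<i> * of_real \<tau> * w))"
    have A: "A \<ge> 0" using K(2)[of 0] norm_ge_zero[of "K 0"] by (simp del: norm_ge_zero)
    have n: "cmod (F w) = cmod (K w) * exp (- \<tau> * Im w)" for w
      by (simp add: F_def norm_mult)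
    have "cmod (F z) \<le> M"
    proof (rule phragmen_lindelof_half_plane[where F = F and z = z and c = "2 * \<tau>" and A = A and A' = A])
      show "F holomorphic_on UNIV" unfolding F_def by (intro holomorphic_intros K)
      show "cmod (F w) \<le> A * exp (2 * \<tau> * cmod w)" for w
      proof -
        have "- \<tau> * Im w \<le> \<tau> * cmod w"
          using abs_Im_le_cmod[of w] mult_left_mono[of "- Im w" "cmod w" \<tau>] \<open>\<tau> \<ge> 0\<close> by simp
        hence "cmod (F w) \<le> (A * exp (\<tau> * cmod w)) * exp (\<tau> * cmod w)"
          unfolding n using A by (intro mult_mono K) auto
        also have "\<dots> = A * exp (2 * \<tau> * cmod w)" by (simp add: mult.assoc flip: exp_add)
        finally show ?thesis .
      qed
      show "cmod (F (of_real x)) \<le> M" for x using K(3)[of x] by (simp add: n)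
      show "cmod (F (\<i> * of_real y)) \<le> A" if "y \<ge> 0" for y
        using K(2)[of "\<i> * of_real y"] that unfolding n
        by (simp add: norm_mult exp_minus field_simps)
    qed fact
    thus ?thesis unfolding n by (simp add: exp_minus field_simps)
  qed
  show ?thesis
  proof (cases "Im z \<ge> 0")
    case True thus ?thesis using upper[OF hol growth real True] by simp
  next
    case False
    have "cmod ((\<lambda>w. H (- w)) (- z)) \<le> M * exp (\<tau> * Im (- z))"
    proof (rule upper)
      show "(\<lambda>w. H (- w)) holomorphic_on UNIV"
        by (intro holomorphic_on_compose_gen[OF _ hol, unfolded o_def] holomorphic_intros) auto
      show "cmod (H (- of_real x)) \<le> M" for x using real[of "-x"] by simp
      show "cmod (H (- z)) \<le> A * exp (\<tau> * cmod z)" for z using growth[of "-z"] by simp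
    qed (use False in auto)
    thus ?thesis using False by simp
  qed
qed

section \<open>Bernstein and Nikolskii-Stechkin inequalities in the supremum norm\<close>

text \<open>Restrictions to the line of entire functions of exponential type at most \<open>\<tau>\<close>, in the sharp form
  without \<open>\<epsilon>\<close>. A function of exponential type \<open>W\<close> in the usual sense satisfies this with
  \<open>\<tau> = 2 W\<close>, and losing a factor \<open>2\<close> in the type only changes constants.\<close>

definition entire_growth :: "real \<Rightarrow> (real \<Rightarrow> complex) \<Rightarrow> bool" where
  "entire_growth \<tau> f \<longleftrightarrow> (\<exists>F A. F holomorphic_on UNIV \<and>
     (\<forall>z. cmod (F z) \<le> A * exp (\<tau> * cmod z)) \<and> (\<forall>x. f x = F (of_real x)))"

lemma entire_growth_diff:
  assumes "entire_growth \<tau> f" "entire_growth \<tau> g"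
  shows "entire_growth \<tau> (\<lambda>x. f x - g x)"
proof -
  obtain F A where F: "F holomorphic_on UNIV" "\<And>z. cmod (F z) \<le> A * exp (\<tau> * cmod z)" "\<And>x. f x = F (of_real x)"
    using assms by (auto simp: entire_growth_def)
  obtain G B where G: "G holomorphic_on UNIV" "\<And>z. cmod (G z) \<le> B * exp (\<tau> * cmod z)" "\<And>x. g x = G (of_real x)"
    using assms by (auto simp: entire_growth_def)
  show ?thesis unfolding entire_growth_def
  proof (intro exI[of _ "\<lambda>z. F z - G z"] exI[of _ "A + B"] conjI allI)
    show "cmod (F z - G z) \<le> (A + B) * exp (\<tau> * cmod z)" for z
      using norm_triangle_ineq4[of "F z" "G z"] F(2)[of z] G(2)[of z] by (simp add: distrib_right)
  qed (auto intro!: holomorphic_intros F G simp: F G)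
qed

lemma entire_growth_shift:
  assumes "entire_growth \<tau> f" "\<tau> \<ge> 0"
  shows "entire_growth \<tau> (\<lambda>x. f (x + h))"
proof -
  obtain F A where F: "F holomorphic_on UNIV" "\<And>z. cmod (F z) \<le> A * exp (\<tau> * cmod z)" "\<And>x. f x = F (of_real x)"
    using assms by (auto simp: entire_growth_def)
  have A: "A \<ge> 0" using F(2)[of 0] norm_ge_zero[of "F 0"] by (simp del: norm_ge_zero)
  show ?thesis unfolding entire_growth_def
  proof (intro exI[of _ "\<lambda>z. F (z + of_real h)"] exI[of _ "A * exp (\<tau> * \<bar>h\<bar>)"] conjI allI)
    show "(\<lambda>z. F (z + of_real h)) holomorphic_on UNIV"
      by (intro holomorphic_on_compose_gen[OF _ F(1), unfolded o_def] holomorphic_intros) auto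
    fix z
    have "cmod (F (z + of_real h)) \<le> A * exp (\<tau> * cmod (z + of_real h))" by (rule F)
    also have "\<dots> \<le> A * exp (\<tau> * (\<bar>h\<bar> + cmod z))"
      using A norm_triangle_ineq[of z "of_real h"] \<open>\<tau> \<ge> 0\<close>
      by (intro mult_left_mono) (auto intro!: mult_left_mono)
    finally show "cmod (F (z + of_real h)) \<le> A * exp (\<tau> * \<bar>h\<bar>) * exp (\<tau> * cmod z)"
      by (simp add: distrib_left exp_add mult.assoc)
  qed (simp add: F)
qed

text \<open>Bernstein's inequality with the factor \<open>e\<close> in place of the optimal constant \<open>1\<close>: Cauchy's estimate on a
  circle of radius \<open>1/\<tau>\<close>, on which \<open>exp (\<tau> \<bar>Im z\<bar>) \<le> e\<close>. The derivative belongs to the same class, so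
  the inequality can be iterated.\<close>

lemma bernstein_sup:
  assumes "entire_growth \<tau> f" "\<tau> > 0" and M: "\<And>x. cmod (f x) \<le> M"
  obtains f' where "entire_growth \<tau> f'" "\<And>x. (f has_vector_derivative f' x) (at x)"
    "\<And>x. cmod (f' x) \<le> exp 1 * \<tau> * M"
proof -
  obtain F A where F: "F holomorphic_on UNIV" "\<And>z. cmod (F z) \<le> A * exp (\<tau> * cmod z)" "\<And>x. f x = F (of_real x)"
    using assms by (auto simp: entire_growth_def)
  have A: "A \<ge> 0" using F(2)[of 0] norm_ge_zero[of "F 0"] by (simp del: norm_ge_zero)
  have M0: "M \<ge> 0" using M[of 0] norm_ge_zero order_trans by blast
  have bd: "cmod (F z) \<le> M * exp (\<tau> * \<bar>Im z\<bar>)" for z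
    by (rule entire_bounded_on_real_line_growth[OF F(1) _ F(2)]) (use assms F in auto)
  have cauchy: "cmod (deriv F z) \<le> C / r" if "r > 0" "\<And>w. cmod (z - w) = r \<Longrightarrow> cmod (F w) \<le> C" for z r C
    using Cauchy_inequality[of F z r C 1] F(1) that
    by (simp add: holomorphic_on_subset holomorphic_on_imp_continuous_on)
  show ?thesis
  proof (rule that[of "\<lambda>x. deriv F (of_real x)"])
    show "entire_growth \<tau> (\<lambda>x. deriv F (of_real x))"
      unfolding entire_growth_def
    proof (intro exI[of _ "deriv F"] exI[of _ "A * exp \<tau>"] conjI allI)
      show "deriv F holomorphic_on UNIV" by (rule holomorphic_deriv[OF F(1)]) simp
      fix z
      have "cmod (deriv F z) \<le> (A * exp (\<tau> * (cmod z + 1))) / 1"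
      proof (rule cauchy)
        fix w assume "cmod (z - w) = 1"
        hence "cmod w \<le> cmod z + 1" by (metis add.commute norm_minus_commute norm_triangle_sub)
        hence "A * exp (\<tau> * cmod w) \<le> A * exp (\<tau> * (cmod z + 1))"
          using A \<open>\<tau> > 0\<close> by (intro mult_left_mono) auto
        thus "cmod (F w) \<le> A * exp (\<tau> * (cmod z + 1))" using F(2)[of w] by simp
      qed simp
      thus "cmod (deriv F z) \<le> A * exp \<tau> * exp (\<tau> * cmod z)"
        by (simp add: distrib_left exp_add mult_ac)
    qed simp
    show "(f has_vector_derivative deriv F (of_real x)) (at x)" for x
    proof -
      have "(F has_field_derivative deriv F (of_real x)) (at (of_real x))"
        using F(1) by (meson UNIV_I holomorphic_derivI open_UNIV)
      hence "((\<lambda>x. F (of_real x)) has_vector_derivative deriv F (of_real x)) (at x)"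
        by (rule has_vector_derivative_real_field)
      moreover have "f = (\<lambda>x. F (of_real x))" using F(3) by auto
      ultimately show ?thesis by simp
    qed
    show "cmod (deriv F (of_real x)) \<le> exp 1 * \<tau> * M" for x
    proof -
      have "cmod (deriv F (of_real x)) \<le> (M * exp 1) / (1 / \<tau>)"
      proof (rule cauchy)
        fix w assume w: "cmod (of_real x - w) = 1 / \<tau>"
        have "\<bar>Im w\<bar> \<le> 1 / \<tau>" using abs_Im_le_cmod[of "of_real x - w"] w by simp
        hence "\<tau> * \<bar>Im w\<bar> \<le> 1" using \<open>\<tau> > 0\<close> by (simp add: field_simps)
        hence "M * exp (\<tau> * \<bar>Im w\<bar>) \<le> M * exp 1" using M0 by (intro mult_left_mono) auto
        thus "cmod (F w) \<le> M * exp 1" using bd[of w] by simp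
      qed (use \<open>\<tau> > 0\<close> in auto)
      thus ?thesis by (simp add: field_simps)
    qed
  qed
qed

lemma norm_increment_le:
  fixes f :: "real \<Rightarrow> complex"
  assumes "\<And>t. t \<in> {a..b} \<Longrightarrow> (f has_vector_derivative f' t) (at t within {a..b})"
    and "\<And>t. t \<in> {a..b} \<Longrightarrow> cmod (f' t) \<le> B" and "a \<le> b"
  shows "cmod (f b - f a) \<le> B * (b - a)"
proof -
  have "cmod (f b - f a) \<le> B * norm (b - a)"
  proof (rule differentiable_bound[of "{a..b}" f "\<lambda>t h. h *\<^sub>R f' t"])
    show "onorm (\<lambda>h. h *\<^sub>R f' t) \<le> B" if "t \<in> {a..b}" for t
    proof (rule onorm_le)
      fix h :: real
      show "norm (h *\<^sub>R f' t) \<le> B * norm h"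
        using mult_right_mono[OF assms(2)[OF that] norm_ge_zero[of h]] by (simp add: mult.commute)
    qed
  qed (use assms in \<open>auto simp: has_vector_derivative_def\<close>)
  thus ?thesis using \<open>a \<le> b\<close> by simp
qed

lemma increment_le_of_bounded:
  assumes "entire_growth \<tau> f" "\<tau> > 0" "\<And>x. cmod (f x) \<le> M" "h \<ge> 0"
  shows "cmod (f (x + h) - f x) \<le> h * (exp 1 * \<tau>) * M"
proof -
  obtain f' where f': "entire_growth \<tau> f'" "\<And>x. (f has_vector_derivative f' x) (at x)"
      "\<And>x. cmod (f' x) \<le> exp 1 * \<tau> * M"
    by (rule bernstein_sup[OF assms(1-3)]) (rule that)
  have "cmod (f (x + h) - f x) \<le> exp 1 * \<tau> * M * (x + h - x)"
  proof (rule norm_increment_le)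
    show "(f has_vector_derivative f' t) (at t within {x..x + h})" for t
      by (rule has_vector_derivative_at_within) (rule f'(2))
  qed (use f'(3) assms(4) in auto)
  thus ?thesis by (simp add: mult_ac)
qed

text \<open>An inverse to the trivial bound of a difference by a derivative. For small \<open>\<eta>\<close> the difference
  quotient with step \<open>\<eta>\<close> approximates \<open>f'\<close> up to \<open>\<eta> sup \<bar>f''\<bar>\<close>, which Bernstein's inequality bounds by
  half of \<open>sup \<bar>f'\<bar>\<close>; absorbing this half bounds \<open>f'\<close>, hence every increment, by the
  increments with the fixed step \<open>\<eta>\<close>.\<close>

lemma increment_le_of_increment:
  assumes "entire_growth \<tau> f" "\<tau> > 0" "bounded (range f)" "h \<ge> 0"
    and \<eta>: "\<eta> = 1 / (2 * exp 1 * \<tau>)"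
    and S: "\<And>x. cmod (f (x + \<eta>) - f x) \<le> S"
  shows "cmod (f (x + h) - f x) \<le> 2 * h / \<eta> * S"
proof -
  obtain M where M: "\<And>x. cmod (f x) \<le> M" using assms(3) unfolding bounded_iff by blast
  obtain f' where f': "entire_growth \<tau> f'" "\<And>x. (f has_vector_derivative f' x) (at x)" "\<And>x. cmod (f' x) \<le> exp 1 * \<tau> * M"
    by (rule bernstein_sup[OF assms(1-2) M]) (rule that)
  define M' where "M' = (SUP x. cmod (f' x))"
  have bdd: "bdd_above (range (\<lambda>x. cmod (f' x)))" by (rule bdd_aboveI2) (rule f'(3))
  have M': "cmod (f' x) \<le> M'" for x unfolding M'_def using bdd by (intro cSUP_upper) auto
  have M'0: "M' \<ge> 0" using M'[of 0] norm_ge_zero order_trans by blast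
  have \<eta>0: "\<eta> > 0" using \<open>\<tau> > 0\<close> by (simp add: \<eta>)
  \<comment> \<open>the step is chosen so that the second-order error is half the supremum of \<open>\<bar>f'\<bar>\<close>\<close>
  have \<eta>\<tau>: "\<eta> * (exp 1 * \<tau>) = 1/2" using \<open>\<tau> > 0\<close> by (simp add: \<eta>)
  have "cmod (f' x) \<le> S / \<eta> + M' / 2" for x
  proof -
    have "cmod ((f (x + \<eta>) - \<eta> *\<^sub>R f' x) - (f (x + 0) - 0 *\<^sub>R f' x)) \<le> (\<eta> * (exp 1 * \<tau>) * M') * (\<eta> - 0)"
    proof (rule norm_increment_le[where f = "\<lambda>t. f (x + t) - t *\<^sub>R f' x" and f' = "\<lambda>t. f' (x + t) - f' x"])
      fix t assume t: "t \<in> {0..\<eta>}"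
      have "((f \<circ> (\<lambda>t. x + t)) has_vector_derivative 1 *\<^sub>R f' (x + t)) (at t within {0..\<eta>})"
      proof (rule vector_diff_chain_within)
        show "((\<lambda>t. x + t) has_vector_derivative 1) (at t within {0..\<eta>})"
          by (auto intro!: derivative_eq_intros simp: has_vector_derivative_def)
        show "(f has_vector_derivative f' (x + t)) (at (x + t) within (\<lambda>t. x + t) ` {0..\<eta>})"
          by (rule has_vector_derivative_at_within) (rule f'(2))
      qed
      hence "((\<lambda>t. f (x + t)) has_vector_derivative f' (x + t)) (at t within {0..\<eta>})"
        by (simp add: o_def)
      moreover have "((\<lambda>t. t *\<^sub>R f' x) has_vector_derivative f' x) (at t within {0..\<eta>})"
        by (auto intro!: derivative_eq_intros simp: has_vector_derivative_def)
      ultimately show "((\<lambda>t. f (x + t) - t *\<^sub>R f' x) has_vector_derivative f' (x + t) - f' x) (at t within {0..\<eta>})"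
        by (rule has_vector_derivative_diff)
      have "cmod (f' (x + t) - f' x) \<le> t * (exp 1 * \<tau>) * M'"
        using increment_le_of_bounded[OF f'(1) \<open>\<tau> > 0\<close> M', of t x] t by simp
      also have "\<dots> \<le> \<eta> * (exp 1 * \<tau>) * M'"
        using t M'0 \<open>\<tau> > 0\<close> by (intro mult_right_mono) auto
      finally show "cmod (f' (x + t) - f' x) \<le> \<eta> * (exp 1 * \<tau>) * M'" .
    qed (use \<eta>0 in auto)
    also have "\<dots> = \<eta> * (M' / 2)" by (simp add: \<eta>\<tau>)
    finally have "cmod (f (x + \<eta>) - f x - \<eta> *\<^sub>R f' x) \<le> \<eta> * (M' / 2)"
      by (simp add: algebra_simps)
    hence "cmod (\<eta> *\<^sub>R f' x) \<le> S + \<eta> * (M' / 2)"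
      using S[of x] norm_triangle_sub[of "\<eta> *\<^sub>R f' x" "f (x + \<eta>) - f x"]
        norm_minus_commute[of "\<eta> *\<^sub>R f' x" "f (x + \<eta>) - f x"] by linarith
    hence "\<eta> * cmod (f' x) \<le> \<eta> * (S / \<eta> + M' / 2)" using \<eta>0 by (simp add: distrib_left)
    thus ?thesis using \<eta>0 by (simp only: mult_le_cancel_left_pos)
  qed
  hence "M' \<le> S / \<eta> + M' / 2" unfolding M'_def by (intro cSUP_least) auto
  hence f'_le: "cmod (f' x) \<le> 2 * (S / \<eta>)" for x using M'[of x] by linarith
  have "cmod (f (x + h) - f x) \<le> 2 * (S / \<eta>) * (x + h - x)"
  proof (rule norm_increment_le)
    show "(f has_vector_derivative f' t) (at t within {x..x + h})" for t
      by (rule has_vector_derivative_at_within) (rule f'(2))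
  qed (use f'_le \<open>h \<ge> 0\<close> in auto)
  also have "\<dots> = 2 * h / \<eta> * S" by simp
  finally show ?thesis .
qed


lemma fwd_diff_0 [simp]: "fwd_diff 0 h f = f"
  by (rule ext) (simp add: fwd_diff_def)

lemma fwd_diff_shift: "fwd_diff n h (\<lambda>y. f (y + k)) x = fwd_diff n h f (x + k)"
  by (simp add: fwd_diff_def algebra_simps)

lemma fwd_diff_diff: "fwd_diff n h (\<lambda>y. f y - g y) x = fwd_diff n h f x - fwd_diff n h g x"
  by (simp add: fwd_diff_def algebra_simps sum_subtractf)

text \<open>Pascal's rule.\<close>

lemma fwd_diff_Suc: "fwd_diff (Suc n) h f x = fwd_diff n h f (x + h) - fwd_diff n h f x"
proof -
  define c where "c = (\<lambda>n k. of_nat (n choose k) * (-1) ^ (n - k) :: complex)"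
  have rec: "c (Suc n) (Suc k) = c n k - c n (Suc k)" if "k \<le> n" for k
  proof (cases "k = n")
    case False
    hence "n - k = Suc (n - Suc k)" using that by simp
    thus ?thesis by (simp add: c_def algebra_simps)
  qed (simp add: c_def)
  have "fwd_diff (Suc n) h f x = (\<Sum>k\<le>Suc n. c (Suc n) k * f (x + real k * h))"
    by (simp add: fwd_diff_def c_def atLeast0AtMost)
  also have "\<dots> = c (Suc n) 0 * f x + (\<Sum>k\<le>n. c (Suc n) (Suc k) * f (x + real (Suc k) * h))"
    by (subst sum.atMost_Suc_shift) simp
  also have "(\<Sum>k\<le>n. c (Suc n) (Suc k) * f (x + real (Suc k) * h)) =
     (\<Sum>k\<le>n. c n k * f (x + real (Suc k) * h)) - (\<Sum>k\<le>n. c n (Suc k) * f (x + real (Suc k) * h))"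
    by (subst sum_subtractf[symmetric], rule sum.cong) (auto simp: rec left_diff_distrib)
  also have "(\<Sum>k\<le>n. c n (Suc k) * f (x + real (Suc k) * h)) = (\<Sum>k\<le>Suc n. c n k * f (x + real k * h)) - c n 0 * f x"
    by (subst sum.atMost_Suc_shift) simp
  also have "(\<Sum>k\<le>Suc n. c n k * f (x + real k * h)) = fwd_diff n h f x"
    by (simp add: fwd_diff_def c_def atLeast0AtMost)
  also have "(\<Sum>k\<le>n. c n k * f (x + real (Suc k) * h)) = fwd_diff n h f (x + h)"
    by (simp add: fwd_diff_def c_def atLeast0AtMost algebra_simps)
  also have "c (Suc n) 0 = - c n 0" by (simp add: c_def)
  finally show ?thesis by simp
qed

lemma fwd_diff_Suc': "fwd_diff (Suc n) h f = fwd_diff n h (\<lambda>x. f (x + h) - f x)"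
  by (rule ext) (simp add: fwd_diff_Suc fwd_diff_diff fwd_diff_shift)

lemma entire_growth_fwd_diff:
  assumes "entire_growth \<tau> f" "\<tau> \<ge> 0"
  shows "entire_growth \<tau> (fwd_diff n h f)"
proof (induction n)
  case (Suc n)
  have "fwd_diff (Suc n) h f = (\<lambda>x. fwd_diff n h f (x + h) - fwd_diff n h f x)"
    by (rule ext) (rule fwd_diff_Suc)
  thus ?case
    using entire_growth_diff[OF entire_growth_shift[OF Suc \<open>\<tau> \<ge> 0\<close>] Suc] by simp
qed (use assms in simp)

lemma bounded_range_diff_shift:
  fixes f :: "real \<Rightarrow> complex"
  assumes "bounded (range f)"
  shows "bounded (range (\<lambda>x. f (x + h) - f x))"
proof -
  obtain M where M: "\<And>x. cmod (f x) \<le> M" using assms unfolding bounded_iff by blast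
  have "cmod (f (x + h) - f x) \<le> M + M" for x
    using norm_triangle_ineq4[of "f (x + h)" "f x"] M[of x] M[of "x + h"] by linarith
  thus ?thesis unfolding bounded_iff by blast
qed

lemma bounded_range_fwd_diff:
  fixes f :: "real \<Rightarrow> complex"
  assumes "bounded (range f)"
  shows "bounded (range (fwd_diff n h f))"
  using assms by (induction n arbitrary: f) (auto simp: fwd_diff_Suc' intro: bounded_range_diff_shift)

text \<open>One factor of the difference operator is exchanged at a time: the differences with steps \<open>h\<close> and
  \<open>\<eta>\<close> commute and preserve the class of functions.\<close>

lemma fwd_diff_le_fwd_diff:
  assumes "entire_growth \<tau> f" "bounded (range f)" "\<tau> > 0" "h \<ge> 0"
    and \<eta>: "\<eta> = 1 / (2 * exp 1 * \<tau>)"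
    and "\<And>x. cmod (fwd_diff n \<eta> f x) \<le> S"
  shows "cmod (fwd_diff n h f x) \<le> (2 * h / \<eta>) ^ n * S"
  using assms(1,2,6)
proof (induction n arbitrary: f S x)
  case (Suc n)
  let ?g = "\<lambda>x. f (x + h) - f x"
  have "cmod (fwd_diff n \<eta> ?g x) \<le> 2 * h / \<eta> * S" for x
  proof -
    have "cmod (fwd_diff n \<eta> f (x + h) - fwd_diff n \<eta> f x) \<le> 2 * h / \<eta> * S"
    proof (rule increment_le_of_increment[OF _ \<open>\<tau> > 0\<close> _ \<open>h \<ge> 0\<close> \<eta>])
      show "entire_growth \<tau> (fwd_diff n \<eta> f)"
        using Suc.prems \<open>\<tau> > 0\<close> by (intro entire_growth_fwd_diff) auto
      show "bounded (range (fwd_diff n \<eta> f))"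
        using Suc.prems by (intro bounded_range_fwd_diff)
      show "cmod (fwd_diff n \<eta> f (x + \<eta>) - fwd_diff n \<eta> f x) \<le> S" for x
        using Suc.prems(3)[of x] by (simp add: fwd_diff_Suc)
    qed
    thus ?thesis by (simp add: fwd_diff_diff fwd_diff_shift)
  qed
  hence "cmod (fwd_diff n h ?g x) \<le> (2 * h / \<eta>) ^ n * (2 * h / \<eta> * S)"
    using Suc.prems \<open>\<tau> > 0\<close>
    by (intro Suc.IH entire_growth_diff entire_growth_shift bounded_range_diff_shift) auto
  thus ?case by (simp add: fwd_diff_Suc' mult_ac)
qed simp

text \<open>The combination of the Nikolskii-Stechkin and Bernstein inequalities: a
  difference of order \<open>n + 1\<close> with a small step gains one more power of the step than the difference
  of order \<open>n\<close> with a step comparable to \<open>1/\<tau>\<close>.\<close>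

lemma nikolskii_stechkin_sup:
  assumes "entire_growth \<tau> f" "bounded (range f)" "\<tau> > 0" "h \<ge> 0"
    and \<eta>: "\<eta> = 1 / (2 * exp 1 * \<tau>)"
    and S: "\<And>x. cmod (fwd_diff n \<eta> f x) \<le> S"
  shows "cmod (fwd_diff (Suc n) h f x) \<le> (2 * h / \<eta>) ^ Suc n * S"
proof -
  have S0: "S \<ge> 0" using S[of 0] norm_ge_zero order_trans by blast
  have \<eta>0: "\<eta> > 0" using \<open>\<tau> > 0\<close> by (simp add: \<eta>)
  have q: "h * (exp 1 * \<tau>) \<le> 2 * h / \<eta>" using \<open>\<tau> > 0\<close> \<open>h \<ge> 0\<close> by (simp add: \<eta>)
  have "cmod (fwd_diff n h f (x + h) - fwd_diff n h f x) \<le> h * (exp 1 * \<tau>) * ((2 * h / \<eta>) ^ n * S)"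
    using assms by (intro increment_le_of_bounded fwd_diff_le_fwd_diff entire_growth_fwd_diff) auto
  also have "\<dots> \<le> 2 * h / \<eta> * ((2 * h / \<eta>) ^ n * S)"
    using q S0 \<eta>0 \<open>h \<ge> 0\<close> by (intro mult_right_mono) auto
  finally show ?thesis by (simp add: fwd_diff_Suc mult_ac)
qed

section \<open>Minkowski inequalities for the \<open>L\<^sup>p\<close> norm\<close>

text \<open>Young's inequality in the form that absorbs: an estimate \<open>B \<le> \<integral> a b\<^sup>p\<^sup>-\<^sup>1\<close> with \<open>B = \<integral> b\<^sup>p\<close> yields
  \<open>B \<le> \<integral> a\<^sup>p\<close>. It takes the place of Hoelder's inequality in what follows.\<close>

lemma young_powr:
  fixes a b p :: real
  assumes "p \<ge> 1" "a \<ge> 0" "b \<ge> 0"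
  shows "a * b powr (p - 1) \<le> a powr p / p + (1 - 1/p) * b powr p"
proof (cases "p = 1")
  case True
  thus ?thesis using assms by simp
next
  case False
  define q where "q = p / (p - 1)"
  have p: "p > 1" using False assms by simp
  have "a * b powr (p - 1) \<le> a powr p / p + (b powr (p - 1)) powr q / q"
    by (rule Youngs_inequality) (use p assms in \<open>auto simp: q_def field_simps\<close>)
  also have "(b powr (p - 1)) powr q = b powr p" using p by (simp add: powr_powr q_def)
  also have "b powr p / q = (1 - 1/p) * b powr p" using p by (simp add: q_def field_simps)
  finally show ?thesis .
qed

lemma powr_convex_combination:
  fixes x y t p :: real
  assumes "p \<ge> 1" "x \<ge> 0" "y \<ge> 0" "0 \<le> t" "t \<le> 1"
  shows "((1 - t) * x + t * y) powr p \<le> (1 - t) * x powr p + t * y powr p"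
proof -
  define z where "z = (1 - t) * x + t * y"
  have z: "z \<ge> 0" using assms by (simp add: z_def)
  have "z powr p = z * z powr (p - 1)"
    using z by (simp add: powr_mult_base)
  also have "\<dots> = (1 - t) * (x * z powr (p - 1)) + t * (y * z powr (p - 1))"
    by (simp add: z_def algebra_simps)
  also have "\<dots> \<le> (1 - t) * (x powr p / p + (1 - 1/p) * z powr p) + t * (y powr p / p + (1 - 1/p) * z powr p)"
    using assms z by (intro add_mono mult_left_mono young_powr) auto
  also have "\<dots> = ((1 - t) * x powr p + t * y powr p) / p + (1 - 1/p) * z powr p"
    using \<open>p \<ge> 1\<close> by (simp add: field_simps)
  finally have "z powr p / p \<le> ((1 - t) * x powr p + t * y powr p) / p"
    by (simp add: algebra_simps)
  thus ?thesis using \<open>p \<ge> 1\<close> by (simp add: z_def divide_le_cancel)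
qed

lemma Lp_norm_lborel: "Lp_norm p f = ennreal_root p (\<integral>\<^sup>+ x. ennreal (cmod (f x) powr p) \<partial>lborel)"
  by (simp add: Lp_norm_def nn_integral_completion)

lemma ennreal_root_le_iff:
  assumes "p > 0" "M \<ge> 0"
  shows "ennreal_root p a \<le> ennreal M \<longleftrightarrow> a \<le> ennreal (M powr p)"
proof (cases a)
  case (real r)
  have "r powr (1/p) \<le> M \<longleftrightarrow> r \<le> M powr p"
  proof
    assume "r powr (1/p) \<le> M"
    hence "(r powr (1/p)) powr p \<le> M powr p" using assms by (intro powr_mono2) auto
    thus "r \<le> M powr p" using assms real by (simp add: powr_powr)
  next
    assume "r \<le> M powr p"
    hence "r powr (1/p) \<le> (M powr p) powr (1/p)" using assms real by (intro powr_mono2) auto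
    thus "r powr (1/p) \<le> M" using assms real by (simp add: powr_powr)
  qed
  thus ?thesis using real assms by (simp add: ennreal_root_def)
next
  case top
  thus ?thesis by (simp add: ennreal_root_def top_unique)
qed

lemma Lp_norm_le_iff:
  assumes "p > 0" "M \<ge> 0"
  shows "Lp_norm p f \<le> ennreal M \<longleftrightarrow> (\<integral>\<^sup>+ x. ennreal (cmod (f x) powr p) \<partial>lborel) \<le> ennreal (M powr p)"
  unfolding Lp_norm_lborel by (rule ennreal_root_le_iff) fact+

lemma Lp_norm_cong_AE:
  assumes "AE x in lebesgue. f x = g x"
  shows "Lp_norm p f = Lp_norm p g"
  unfolding Lp_norm_def by (rule arg_cong[where f = "ennreal_root p"], rule nn_integral_cong_AE)
    (use assms in eventually_elim, simp)

text \<open>For positive bounds \<open>a\<close> and \<open>b\<close> of the two norms, \<open>\<bar>f + g\<bar> / (a + b)\<close> is at most a convex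
  combination of \<open>\<bar>f\<bar> / a\<close> and \<open>\<bar>g\<bar> / b\<close>; convexity of the power and integration give the claim.
  Bounds rather than the norms themselves avoid a separate treatment of functions of norm \<open>0\<close>.\<close>

lemma Lp_norm_add_le:
  assumes "p \<ge> 1" and f: "f \<in> borel_measurable lebesgue" and g: "g \<in> borel_measurable lebesgue"
  shows "Lp_norm p (\<lambda>x. f x + g x) \<le> Lp_norm p f + Lp_norm p g"
proof -
  have bound: "Lp_norm p (\<lambda>x. f x + g x) \<le> ennreal (a + b)"
    if "a > 0" "b > 0" and fa: "Lp_norm p f \<le> ennreal a" and gb: "Lp_norm p g \<le> ennreal b" for a b
  proof -
    define s where "s = a + b"
    have s: "s > 0" using that by (simp add: s_def)
    have pt: "cmod (f x + g x) powr p \<le> s powr p * (a/s * a powr (-p)) * cmod (f x) powr p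
        + s powr p * (b/s * b powr (-p)) * cmod (g x) powr p" for x
    proof -
      have "cmod (f x + g x) powr p \<le> (s * ((1 - b/s) * (cmod (f x) / a) + b/s * (cmod (g x) / b))) powr p"
      proof (rule powr_mono2)
        have "1 - b/s = a/s" using s by (simp add: s_def field_simps)
        thus "cmod (f x + g x) \<le> s * ((1 - b/s) * (cmod (f x) / a) + b/s * (cmod (g x) / b))"
          using norm_triangle_ineq[of "f x" "g x"] s that by (simp add: distrib_left)
      qed (use \<open>p \<ge> 1\<close> in auto)
      also have "\<dots> = s powr p * ((1 - b/s) * (cmod (f x) / a) + b/s * (cmod (g x) / b)) powr p"
        using s that by (intro powr_mult)
      also have "\<dots> \<le> s powr p * ((1 - b/s) * (cmod (f x) / a) powr p + b/s * (cmod (g x) / b) powr p)"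
        using s that \<open>p \<ge> 1\<close> by (intro mult_left_mono powr_convex_combination) (auto simp: s_def)
      also have "1 - b/s = a/s" using s by (simp add: s_def field_simps)
      finally show ?thesis
        using that by (simp add: powr_divide powr_minus_divide distrib_left mult_ac)
    qed
    have [measurable]: "f \<in> borel_measurable lebesgue" "g \<in> borel_measurable lebesgue" by fact+
    have fa': "(\<integral>\<^sup>+ x. ennreal (cmod (f x) powr p) \<partial>lebesgue) \<le> ennreal (a powr p)"
      using Lp_norm_le_iff[of p a f] fa that \<open>p \<ge> 1\<close> by (simp add: nn_integral_completion)
    have gb': "(\<integral>\<^sup>+ x. ennreal (cmod (g x) powr p) \<partial>lebesgue) \<le> ennreal (b powr p)"
      using Lp_norm_le_iff[of p b g] gb that \<open>p \<ge> 1\<close> by (simp add: nn_integral_completion)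
    have "(\<integral>\<^sup>+ x. ennreal (cmod (f x + g x) powr p) \<partial>lebesgue) \<le>
       (\<integral>\<^sup>+ x. ennreal (s powr p * (a/s * a powr (-p))) * ennreal (cmod (f x) powr p)
        + ennreal (s powr p * (b/s * b powr (-p))) * ennreal (cmod (g x) powr p) \<partial>lebesgue)"
      using pt s that by (intro nn_integral_mono)
        (simp add: ennreal_mult'[symmetric] ennreal_plus[symmetric] del: ennreal_plus)
    also have "\<dots> = ennreal (s powr p * (a/s * a powr (-p))) * (\<integral>\<^sup>+ x. ennreal (cmod (f x) powr p) \<partial>lebesgue)
        + ennreal (s powr p * (b/s * b powr (-p))) * (\<integral>\<^sup>+ x. ennreal (cmod (g x) powr p) \<partial>lebesgue)"
      by (subst nn_integral_add) (auto simp: nn_integral_cmult)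
    also have "\<dots> \<le> ennreal (s powr p * (a/s * a powr (-p))) * ennreal (a powr p)
        + ennreal (s powr p * (b/s * b powr (-p))) * ennreal (b powr p)"
      by (intro add_mono mult_left_mono fa' gb') auto
    also have "\<dots> = ennreal (s powr p * (a/s * a powr (-p)) * a powr p + s powr p * (b/s * b powr (-p)) * b powr p)"
      using s that by (simp add: ennreal_mult'[symmetric] ennreal_plus[symmetric] del: ennreal_plus)
    also have "s powr p * (a/s * a powr (-p)) * a powr p + s powr p * (b/s * b powr (-p)) * b powr p
      = s powr p * ((a + b) / s)"
      using that by (simp add: powr_minus add_divide_distrib distrib_left field_simps)
    also have "\<dots> = s powr p" using s by (simp add: s_def)
    finally show ?thesis
      using that \<open>p \<ge> 1\<close> Lp_norm_le_iff[of p s "\<lambda>x. f x + g x"] by (simp add: s_def nn_integral_completion)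
  qed
  show ?thesis
  proof (cases "Lp_norm p f = top \<or> Lp_norm p g = top")
    case False
    then obtain a b where ab: "Lp_norm p f = ennreal a" "a \<ge> 0" "Lp_norm p g = ennreal b" "b \<ge> 0"
      by (cases "Lp_norm p f"; cases "Lp_norm p g") auto
    show ?thesis
    proof (rule ennreal_le_epsilon)
      fix e :: real assume "e > 0"
      hence "Lp_norm p (\<lambda>x. f x + g x) \<le> ennreal ((a + e/2) + (b + e/2))"
        using ab by (intro bound) (auto intro: ennreal_leI)
      also have "\<dots> = Lp_norm p f + Lp_norm p g + ennreal e"
        using ab \<open>e > 0\<close> by (simp add: ennreal_plus[symmetric] algebra_simps del: ennreal_plus)
      finally show "Lp_norm p (\<lambda>x. f x + g x) \<le> Lp_norm p f + Lp_norm p g + ennreal e" .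
    qed
  qed auto
qed

lemma Lp_norm_cmult_le:
  assumes "p > 0" "f \<in> borel_measurable lebesgue"
  shows "Lp_norm p (\<lambda>x. c * f x) \<le> ennreal (cmod c) * Lp_norm p f"
proof (cases "Lp_norm p f = top")
  case True
  show ?thesis
  proof (cases "c = 0")
    case True
    hence "Lp_norm p (\<lambda>x. c * f x) \<le> ennreal 0"
      using assms by (subst Lp_norm_le_iff) auto
    thus ?thesis by simp
  qed (use True in \<open>simp add: ennreal_mult_top\<close>)
next
  case False
  then obtain a where a: "Lp_norm p f = ennreal a" "a \<ge> 0" by (cases "Lp_norm p f") auto
  have [measurable]: "f \<in> borel_measurable lebesgue" by fact
  have fa: "(\<integral>\<^sup>+ x. ennreal (cmod (f x) powr p) \<partial>lebesgue) \<le> ennreal (a powr p)"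
    using Lp_norm_le_iff[of p a f] a assms by (simp add: nn_integral_completion)
  have "(\<integral>\<^sup>+ x. ennreal (cmod (c * f x) powr p) \<partial>lebesgue) =
      (\<integral>\<^sup>+ x. ennreal (cmod c powr p) * ennreal (cmod (f x) powr p) \<partial>lebesgue)"
    by (simp add: norm_mult powr_mult ennreal_mult)
  also have "\<dots> = ennreal (cmod c powr p) * (\<integral>\<^sup>+ x. ennreal (cmod (f x) powr p) \<partial>lebesgue)"
    by (rule nn_integral_cmult) measurable
  also have "\<dots> \<le> ennreal (cmod c powr p) * ennreal (a powr p)"
    by (intro mult_left_mono fa) auto
  also have "\<dots> = ennreal ((cmod c * a) powr p)"
    using a by (simp add: powr_mult ennreal_mult)
  finally have "Lp_norm p (\<lambda>x. c * f x) \<le> ennreal (cmod c * a)"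
    using a assms by (subst Lp_norm_le_iff) (auto simp: nn_integral_completion)
  thus ?thesis using a by (simp add: ennreal_mult)
qed

lemma Lp_norm_minus: "Lp_norm p (\<lambda>x. - f x) = Lp_norm p f"
  by (simp add: Lp_norm_def)

lemma Lp_norm_diff_commute: "Lp_norm p (\<lambda>x. f x - g x) = Lp_norm p (\<lambda>x. g x - f x)"
  by (simp add: Lp_norm_def norm_minus_commute)

lemma Lp_norm_diff_le:
  assumes "p \<ge> 1" "f \<in> borel_measurable lebesgue" "g \<in> borel_measurable lebesgue"
  shows "Lp_norm p (\<lambda>x. f x - g x) \<le> Lp_norm p f + Lp_norm p g"
  using Lp_norm_add_le[OF assms(1,2), of "\<lambda>x. - g x"] assms(3) by (simp add: Lp_norm_minus)

lemma borel_measurable_lebesgue_affine: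
  fixes f :: "real \<Rightarrow> complex"
  assumes "f \<in> borel_measurable lebesgue" "c \<noteq> 0"
  shows "(\<lambda>x. f (t + c * x)) \<in> borel_measurable lebesgue"
proof -
  have "(\<lambda>x. t + c * x) \<in> lebesgue \<rightarrow>\<^sub>M lebesgue"
    using lebesgue_affine_measurable[where c= "\<lambda>x::real. c"] \<open>c \<noteq> 0\<close> by simp
  from measurable_compose[OF this assms(1)] show ?thesis .
qed

lemma borel_measurable_lebesgue_shift:
  fixes f :: "real \<Rightarrow> complex"
  assumes "f \<in> borel_measurable lebesgue"
  shows "(\<lambda>x. f (x + h)) \<in> borel_measurable lebesgue"
  using borel_measurable_lebesgue_affine[OF assms, of 1 h] by (simp add: add.commute)

lemma Lp_norm_shift:
  assumes "f \<in> borel_measurable lebesgue"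
  shows "Lp_norm p (\<lambda>x. f (x + h)) = Lp_norm p f"
proof -
  have [measurable]: "f \<in> borel_measurable lebesgue" by fact
  have "(\<integral>\<^sup>+ x. ennreal (cmod (f x) powr p) \<partial>lebesgue) = (\<integral>\<^sup>+ x. ennreal (cmod (f (x + h)) powr p) \<partial>lebesgue)"
    by (subst nn_integral_real_affine_lebesgue[where c = 1 and t = h]) (auto simp: add.commute)
  thus ?thesis by (simp add: Lp_norm_def)
qed

lemma borel_measurable_lebesgue_fwd_diff:
  assumes "f \<in> borel_measurable lebesgue"
  shows "fwd_diff n h f \<in> borel_measurable lebesgue"
  unfolding fwd_diff_def
  by (intro borel_measurable_sum borel_measurable_times borel_measurable_const borel_measurable_lebesgue_shift assms)

text \<open>Each additional difference at most doubles the norm, since the norm is invariant under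
  translation.\<close>

lemma Lp_norm_fwd_diff_add_le:
  assumes "p \<ge> 1" "f \<in> borel_measurable lebesgue"
  shows "Lp_norm p (fwd_diff (m + n) h f) \<le> 2 ^ m * Lp_norm p (fwd_diff n h f)"
proof (induction m)
  case (Suc m)
  have m: "fwd_diff (m + n) h f \<in> borel_measurable lebesgue"
    by (rule borel_measurable_lebesgue_fwd_diff) fact
  have "fwd_diff (Suc m + n) h f = (\<lambda>x. fwd_diff (m + n) h f (x + h) - fwd_diff (m + n) h f x)"
    by (rule ext) (simp add: fwd_diff_Suc)
  hence "Lp_norm p (fwd_diff (Suc m + n) h f) \<le> Lp_norm p (fwd_diff (m + n) h f) + Lp_norm p (fwd_diff (m + n) h f)"
    using Lp_norm_diff_le[OF \<open>p \<ge> 1\<close> borel_measurable_lebesgue_shift[OF m, of h] m] Lp_norm_shift[OF m, of p h]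
    by simp
  also have "\<dots> = 2 * Lp_norm p (fwd_diff (m + n) h f)" by (simp add: mult_2)
  also have "\<dots> \<le> 2 * (2 ^ m * Lp_norm p (fwd_diff n h f))" by (intro mult_left_mono Suc) auto
  finally show ?case by (simp add: mult_ac)
qed simp

lemma Lp_norm_fwd_diff_le:
  assumes "p \<ge> 1" "f \<in> borel_measurable lebesgue"
  shows "Lp_norm p (fwd_diff n h f) \<le> 2 ^ n * Lp_norm p f"
  using Lp_norm_fwd_diff_add_le[OF assms, of n 0 h] by simp

lemma Lp_norm_sum_le:
  assumes "p \<ge> 1" "finite I" "\<And>i. i \<in> I \<Longrightarrow> f i \<in> borel_measurable lebesgue"
  shows "Lp_norm p (\<lambda>x. \<Sum>i\<in>I. f i x) \<le> (\<Sum>i\<in>I. Lp_norm p (f i))"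
  using assms(2,3)
proof (induction I rule: finite_induct)
  case empty
  have "Lp_norm p (\<lambda>x. 0) \<le> ennreal 0" using \<open>p \<ge> 1\<close> by (subst Lp_norm_le_iff) auto
  thus ?case by simp
next
  case (insert i I)
  have "Lp_norm p (\<lambda>x. f i x + (\<Sum>i\<in>I. f i x)) \<le> Lp_norm p (f i) + Lp_norm p (\<lambda>x. \<Sum>i\<in>I. f i x)"
    using insert.prems by (intro Lp_norm_add_le \<open>p \<ge> 1\<close> borel_measurable_sum) auto
  also have "\<dots> \<le> Lp_norm p (f i) + (\<Sum>i\<in>I. Lp_norm p (f i))"
    using insert.prems by (intro add_left_mono insert.IH) auto
  finally show ?case using insert.hyps by simp
qed

lemma set_integrable_bounded_Icc:
  fixes g :: "real \<Rightarrow> 'b :: {banach, second_countable_topology}"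
  assumes "g \<in> borel_measurable borel" "\<And>t. t \<in> {a..b} \<Longrightarrow> norm (g t) \<le> B"
  shows "set_integrable lborel {a..b} g"
  unfolding set_integrable_def
  by (rule integrableI_bounded_set_indicator[where B = B]) (use assms in \<open>auto simp: emeasure_lborel_Icc_eq\<close>)

text \<open>Jensen's inequality for the mean \<open>\<beta>\<close> of \<open>\<bar>\<phi>\<bar>\<close> over \<open>[0, d]\<close>: integrate Young's inequality for
  \<open>\<bar>\<phi> t\<bar> \<beta>\<^sup>p\<^sup>-\<^sup>1\<close> and absorb \<open>\<beta>\<^sup>p\<close>.\<close>

lemma powr_norm_set_integral_le:
  fixes \<phi> :: "real \<Rightarrow> complex"
  assumes "p \<ge> 1" "d > 0" and [measurable]: "\<phi> \<in> borel_measurable borel" and B: "\<And>t. cmod (\<phi> t) \<le> B"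
  shows "cmod (LINT t:{0..d}|lborel. \<phi> t) powr p \<le> d powr (p - 1) * (LINT t:{0..d}|lborel. cmod (\<phi> t) powr p)"
proof -
  define I where "I = (LINT t:{0..d}|lborel. cmod (\<phi> t))"
  define J where "J = (LINT t:{0..d}|lborel. cmod (\<phi> t) powr p)"
  define \<beta> where "\<beta> = I / d"
  have i0: "set_integrable lborel {0..d} \<phi>"
    by (rule set_integrable_bounded_Icc[where B = B]) (use B in auto)
  have i1: "set_integrable lborel {0..d} (\<lambda>t. cmod (\<phi> t))"
    by (rule set_integrable_bounded_Icc[where B = B]) (use B in auto)
  have i2: "set_integrable lborel {0..d} (\<lambda>t. cmod (\<phi> t) powr p)"
    by (rule set_integrable_bounded_Icc[where B = "B powr p"]) (use B \<open>p \<ge> 1\<close> in \<open>auto intro: powr_mono2\<close>)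
  have I0: "I \<ge> 0" unfolding I_def set_lebesgue_integral_def by (intro integral_nonneg_AE) auto
  hence \<beta>0: "\<beta> \<ge> 0" using \<open>d > 0\<close> by (simp add: \<beta>_def)
  have const: "(LINT t:{0..d}|lborel. c) = c * d" for c :: real
    using \<open>d > 0\<close> by (simp add: set_lebesgue_integral_def)
  have iconst: "set_integrable lborel {0..d} (\<lambda>t. c)" for c :: real
    by (rule set_integrable_bounded_Icc[where B = "\<bar>c\<bar>"]) auto
  have "d * \<beta> powr p = d * (\<beta> * \<beta> powr (p - 1))"
    using \<beta>0 by (simp add: powr_mult_base)
  also have "\<dots> = I * \<beta> powr (p - 1)" using \<open>d > 0\<close> by (simp add: \<beta>_def)
  also have "\<dots> = (LINT t:{0..d}|lborel. cmod (\<phi> t) * \<beta> powr (p - 1))"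
    by (simp add: I_def)
  also have "\<dots> \<le> (LINT t:{0..d}|lborel. cmod (\<phi> t) powr p / p + (1 - 1/p) * \<beta> powr p)"
    using i1 i2 \<beta>0 \<open>p \<ge> 1\<close> iconst by (intro set_integral_mono young_powr set_integral_add) auto
  also have "\<dots> = J / p + (1 - 1/p) * (d * \<beta> powr p)"
    using i2 iconst[of "(1 - 1/p) * \<beta> powr p"] const[of "(1 - 1/p) * \<beta> powr p"]
    by (subst set_integral_add) (auto simp: J_def mult_ac)
  finally have "d * \<beta> powr p \<le> J"
    using \<open>p \<ge> 1\<close> by (simp add: field_simps)
  hence "d powr (p - 1) * (d * \<beta> powr p) \<le> d powr (p - 1) * J" by (intro mult_left_mono) auto
  moreover have "d powr (p - 1) * (d * \<beta> powr p) = (d * \<beta>) powr p"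
    using \<open>d > 0\<close> \<beta>0 by (simp add: powr_mult powr_diff)
  moreover have "cmod (LINT t:{0..d}|lborel. \<phi> t) powr p \<le> I powr p"
    unfolding I_def using set_integral_norm_bound[OF i0] \<open>p \<ge> 1\<close> by (intro powr_mono2) auto
  moreover have "d * \<beta> = I" using \<open>d > 0\<close> by (simp add: \<beta>_def)
  ultimately show ?thesis unfolding J_def by (simp only:)
qed

text \<open>The integral form of Minkowski's inequality, from Jensen's inequality and Tonelli's theorem.\<close>

lemma Lp_norm_set_integral_le:
  fixes \<Theta> :: "real \<Rightarrow> real \<Rightarrow> complex"
  assumes "p \<ge> 1" "d > 0" "M \<ge> 0" and \<Theta>[measurable]: "(\<lambda>(x,t). \<Theta> x t) \<in> borel_measurable (borel \<Otimes>\<^sub>M borel)"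
    and B: "\<And>x t. cmod (\<Theta> x t) \<le> B"
    and M: "\<And>t. t \<in> {0..d} \<Longrightarrow> Lp_norm p (\<lambda>x. \<Theta> x t) \<le> ennreal M"
  shows "Lp_norm p (\<lambda>x. LINT t:{0..d}|lborel. \<Theta> x t) \<le> ennreal (d * M)"
proof -
  have pt: "ennreal (cmod (LINT t:{0..d}|lborel. \<Theta> x t) powr p) \<le>
      ennreal (d powr (p - 1)) * (\<integral>\<^sup>+t. indicator {0..d} t * ennreal (cmod (\<Theta> x t) powr p) \<partial>lborel)" for x
  proof -
    have i2: "set_integrable lborel {0..d} (\<lambda>t. cmod (\<Theta> x t) powr p)"
      by (rule set_integrable_bounded_Icc[where B = "B powr p"]) (use B \<open>p \<ge> 1\<close> in \<open>auto intro: powr_mono2\<close>)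
    have "ennreal (LINT t:{0..d}|lborel. cmod (\<Theta> x t) powr p) =
        (\<integral>\<^sup>+t. ennreal (indicator {0..d} t *\<^sub>R (cmod (\<Theta> x t) powr p)) \<partial>lborel)"
      unfolding set_lebesgue_integral_def using i2[unfolded set_integrable_def]
      by (subst nn_integral_eq_integral) auto
    also have "\<dots> = (\<integral>\<^sup>+t. indicator {0..d} t * ennreal (cmod (\<Theta> x t) powr p) \<partial>lborel)"
      by (intro nn_integral_cong) (auto simp: indicator_def)
    finally have e: "ennreal (LINT t:{0..d}|lborel. cmod (\<Theta> x t) powr p) =
      (\<integral>\<^sup>+t. indicator {0..d} t * ennreal (cmod (\<Theta> x t) powr p) \<partial>lborel)" .
    have "ennreal (cmod (LINT t:{0..d}|lborel. \<Theta> x t) powr p) \<le>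
        ennreal (d powr (p - 1) * (LINT t:{0..d}|lborel. cmod (\<Theta> x t) powr p))"
      by (intro ennreal_leI powr_norm_set_integral_le[where B = B]) (use assms in auto)
    thus ?thesis by (simp add: ennreal_mult' e)
  qed
  have "(\<integral>\<^sup>+x. ennreal (cmod (LINT t:{0..d}|lborel. \<Theta> x t) powr p) \<partial>lborel) \<le>
     (\<integral>\<^sup>+x. ennreal (d powr (p - 1)) * (\<integral>\<^sup>+t. indicator {0..d} t * ennreal (cmod (\<Theta> x t) powr p) \<partial>lborel) \<partial>lborel)"
    by (intro nn_integral_mono pt)
  also have "\<dots> = ennreal (d powr (p - 1)) * (\<integral>\<^sup>+x. (\<integral>\<^sup>+t. indicator {0..d} t * ennreal (cmod (\<Theta> x t) powr p) \<partial>lborel) \<partial>lborel)"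
    by (rule nn_integral_cmult) measurable
  also have "(\<integral>\<^sup>+x. (\<integral>\<^sup>+t. indicator {0..d} t * ennreal (cmod (\<Theta> x t) powr p) \<partial>lborel) \<partial>lborel) =
     (\<integral>\<^sup>+t. (\<integral>\<^sup>+x. indicator {0..d} t * ennreal (cmod (\<Theta> x t) powr p) \<partial>lborel) \<partial>lborel)"
    by (rule lborel_pair.Fubini') measurable
  also have "\<dots> \<le> (\<integral>\<^sup>+t. ennreal (M powr p) * indicator {0..d} t \<partial>lborel)"
  proof (rule nn_integral_mono)
    fix t
    show "(\<integral>\<^sup>+x. indicator {0..d} t * ennreal (cmod (\<Theta> x t) powr p) \<partial>lborel) \<le> ennreal (M powr p) * indicator {0..d} t"
      using M[of t] \<open>p \<ge> 1\<close> \<open>M \<ge> 0\<close> by (auto simp: Lp_norm_le_iff indicator_def)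
  qed
  also have "\<dots> = ennreal (M powr p) * ennreal d"
    using \<open>d > 0\<close> by (subst nn_integral_cmult_indicator) auto
  finally have "(\<integral>\<^sup>+x. ennreal (cmod (LINT t:{0..d}|lborel. \<Theta> x t) powr p) \<partial>lborel) \<le>
      ennreal (d powr (p - 1)) * (ennreal (M powr p) * ennreal d)"
    by (simp add: mult_left_mono)
  also have "\<dots> = ennreal ((d * M) powr p)"
    using \<open>d > 0\<close> \<open>M \<ge> 0\<close> by (simp add: ennreal_mult'[symmetric] powr_mult powr_diff)
  finally show ?thesis using assms by (subst Lp_norm_le_iff) auto
qed

section \<open>Transfer of difference inequalities from the supremum norm to \<open>L\<^sup>p\<close>\<close>

lemma set_integral_norm_le_const:
  fixes g :: "real \<Rightarrow> complex"
  assumes "g \<in> borel_measurable borel" "\<And>t. t \<in> {a..b} \<Longrightarrow> cmod (g t) \<le> B" "a \<le> b"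
  shows "cmod (LINT t:{a..b}|lborel. g t) \<le> B * (b - a)"
proof -
  have i: "set_integrable lborel {a..b} g"
    by (rule set_integrable_bounded_Icc[where B = B]) (use assms in auto)
  have B0: "B \<ge> 0" using order_trans[OF norm_ge_zero assms(2)[of a]] \<open>a \<le> b\<close> by simp
  have "cmod (LINT t:{a..b}|lborel. g t) \<le> (LINT t:{a..b}|lborel. cmod (g t))"
    by (rule set_integral_norm_bound[OF i])
  also have "\<dots> \<le> (LINT t:{a..b}|lborel. B)"
    using assms B0 i by (intro set_integral_mono set_integrable_norm set_integrable_bounded_Icc[where B = B]) auto
  also have "\<dots> = B * (b - a)" using \<open>a \<le> b\<close> by (simp add: set_lebesgue_integral_def)
  finally show ?thesis .
qed

lemma continuous_on_bounded_Icc: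
  fixes F :: "real \<Rightarrow> complex"
  assumes "continuous_on UNIV F"
  obtains B where "\<And>t. t \<in> {a..b} \<Longrightarrow> cmod (F t) \<le> B"
proof -
  have "compact (F ` {a..b})"
    by (intro compact_continuous_image continuous_on_subset[OF assms]) auto
  from compact_imp_bounded[OF this] obtain B where "\<forall>x\<in>F ` {a..b}. cmod x \<le> B"
    unfolding bounded_iff by blast
  thus ?thesis using that by blast
qed

lemma set_integrable_continuous_times_bounded:
  fixes F :: "real \<Rightarrow> complex"
  assumes "continuous_on UNIV F" "\<phi> \<in> borel_measurable borel" "\<And>t. cmod (\<phi> t) \<le> C"
  shows "set_integrable lborel {a..b} (\<lambda>t. F t * \<phi> t)"
proof -
  obtain B where B: "\<And>t. t \<in> {a..b} \<Longrightarrow> cmod (F t) \<le> B"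
    by (rule continuous_on_bounded_Icc[OF assms(1)]) (rule that)
  show ?thesis
  proof (rule set_integrable_bounded_Icc[where B = "B * C"])
    show "(\<lambda>t. F t * \<phi> t) \<in> borel_measurable borel"
      using borel_measurable_continuous_onI[OF assms(1)] assms(2) by measurable
    show "cmod (F t * \<phi> t) \<le> B * C" if "t \<in> {a..b}" for t
      using mult_mono[OF B[OF that] assms(3)[of t]] B[OF that] norm_ge_zero[of "F t"]
      unfolding norm_mult by simp
  qed
qed

lemma entire_growth_continuous:
  assumes "entire_growth \<tau> f"
  shows "continuous_on UNIV f"
proof -
  obtain F where F: "F holomorphic_on UNIV" "\<And>x. f x = F (of_real x)"
    using assms by (auto simp: entire_growth_def)
  have "continuous_on UNIV (F \<circ> of_real)"
    by (intro continuous_on_compose continuous_intros holomorphic_on_imp_continuous_on holomorphic_on_subset[OF F(1)]) auto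
  moreover have "f = F \<circ> of_real" using F(2) by auto
  ultimately show ?thesis by simp
qed

text \<open>Taylor's formula, uniformly on a disc; it allows differentiation under the integral sign against a
  weight that is merely measurable.\<close>

lemma holomorphic_second_order_bound:
  fixes G :: "complex \<Rightarrow> complex"
  assumes "G holomorphic_on UNIV"
  obtains C where "\<And>x w. cmod x \<le> r \<Longrightarrow> cmod w \<le> 1 \<Longrightarrow> cmod (G (x + w) - G x - w * deriv G x) \<le> C * cmod w ^ 2"
proof -
  have hol: "(deriv ^^ i) G holomorphic_on UNIV" for i
    by (rule holomorphic_higher_deriv[OF assms]) simp
  have "compact ((deriv ^^ 2) G ` cball 0 (r + 1))"
    by (intro compact_continuous_image holomorphic_on_imp_continuous_on holomorphic_on_subset[OF hol]) auto
  from compact_imp_bounded[OF this] obtain C where C: "\<forall>y \<in> (deriv ^^ 2) G ` cball 0 (r + 1). cmod y \<le> C"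
    unfolding bounded_iff by blast
  have der: "((deriv ^^ i) G has_field_derivative (deriv ^^ Suc i) G x) (at x within S)" for i x S
    using has_field_derivative_at_within[OF holomorphic_derivI[OF hol[of i] open_UNIV UNIV_I]] by simp
  show ?thesis
  proof (rule that)
    fix x w :: complex assume x: "cmod x \<le> r" and w: "cmod w \<le> 1"
    have "cmod (x + w) \<le> r + 1" using norm_triangle_ineq[of x w] x w by linarith
    hence "cmod ((deriv ^^ 0) G (x + w) - (\<Sum>i\<le>1. (deriv ^^ i) G x * (x + w - x) ^ i / fact i))
        \<le> C * cmod (x + w - x) ^ Suc 1 / fact 1"
      using C x by (intro complex_Taylor[where S = "cball 0 (r + 1)"] der) (auto simp: numeral_2_eq_2)
    thus "cmod (G (x + w) - G x - w * deriv G x) \<le> C * cmod w ^ 2"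
      by (simp add: numeral_2_eq_2 algebra_simps)
  qed
qed

text \<open>The integral against a bounded weight on a compact interval is differentiated under the integral
  sign, and the growth bound is integrated.\<close>

lemma entire_growth_convolution:
  assumes g: "entire_growth \<tau> g" and "\<tau> \<ge> 0" "R \<ge> 0" and [measurable]: "\<phi> \<in> borel_measurable borel"
    and \<phi>: "\<And>t. cmod (\<phi> t) \<le> C"
  shows "entire_growth \<tau> (\<lambda>x. LINT t:{-R..R}|lborel. g (x + t) * \<phi> t)"
proof -
  obtain G A where G: "G holomorphic_on UNIV" "\<And>z. cmod (G z) \<le> A * exp (\<tau> * cmod z)" "\<And>x. g x = G (of_real x)"
    using g by (auto simp: entire_growth_def)
  have A: "A \<ge> 0" using G(2)[of 0] norm_ge_zero[of "G 0"] by (simp del: norm_ge_zero)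
  define H where "H = (\<lambda>z. LINT t:{-R..R}|lborel. G (z + of_real t) * \<phi> t)"
  have cont: "continuous_on UNIV (\<lambda>t. F (z + of_real t))" if "F holomorphic_on UNIV" for F :: "complex \<Rightarrow> complex" and z
    by (rule continuous_on_compose2[OF holomorphic_on_imp_continuous_on[OF that]]) (auto intro!: continuous_intros)
  have int: "set_integrable lborel {-R..R} (\<lambda>t. F (z + of_real t) * \<phi> t)" if "F holomorphic_on UNIV" for F z
    by (rule set_integrable_continuous_times_bounded[OF cont[OF that] _ \<phi>]) measurable
  have meas: "(\<lambda>t. F (z + of_real t)) \<in> borel_measurable borel" if "F holomorphic_on UNIV" for F :: "complex \<Rightarrow> complex" and z
    using borel_measurable_continuous_onI[OF cont[OF that]] .
  have dG: "deriv G holomorphic_on UNIV" by (rule holomorphic_deriv[OF G(1)]) simp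
  have "H holomorphic_on UNIV"
    unfolding holomorphic_on_def
  proof
    fix z
    define L where "L = (LINT t:{-R..R}|lborel. deriv G (z + of_real t) * \<phi> t)"
    obtain K where K: "\<And>x w. cmod x \<le> cmod z + R \<Longrightarrow> cmod w \<le> 1 \<Longrightarrow>
        cmod (G (x + w) - G x - w * deriv G x) \<le> K * cmod w ^ 2"
      by (rule holomorphic_second_order_bound[OF G(1)]) (rule that)
    have est: "cmod (H (z + w) - H z - w * L) \<le> (K * cmod w ^ 2 * C) * (2 * R)" if w: "cmod w \<le> 1" for w
    proof -
      have i1: "set_integrable lborel {-R..R} (\<lambda>t. G (z + w + of_real t) * \<phi> t)"
        and i2: "set_integrable lborel {-R..R} (\<lambda>t. G (z + of_real t) * \<phi> t)"
        by (rule int[OF G(1)])+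
      have i3: "set_integrable lborel {-R..R} (\<lambda>t. w * (deriv G (z + of_real t) * \<phi> t))"
        by (intro set_integrable_mult_right int[OF dG])
      have "H (z + w) - H z - w * L = (LINT t:{-R..R}|lborel.
           G (z + w + of_real t) * \<phi> t - G (z + of_real t) * \<phi> t - w * (deriv G (z + of_real t) * \<phi> t))"
        unfolding H_def L_def set_integral_mult_right[symmetric]
        by (simp only: set_integral_diff(2)[OF set_integral_diff(1)[OF i1 i2] i3] set_integral_diff(2)[OF i1 i2])
      also have "\<dots> = (LINT t:{-R..R}|lborel.
           (G (z + w + of_real t) - G (z + of_real t) - w * deriv G (z + of_real t)) * \<phi> t)"
        by (simp add: algebra_simps)
      also have "cmod \<dots> \<le> (K * cmod w ^ 2 * C) * (R - (- R))"
      proof (rule set_integral_norm_le_const)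
        fix t assume t: "t \<in> {-R..R}"
        have "cmod (z + of_real t) \<le> cmod z + R"
          using norm_triangle_ineq[of z "of_real t"] t by auto
        from K[OF this w] have k: "cmod (G (z + of_real t + w) - G (z + of_real t) - w * deriv G (z + of_real t)) \<le> K * cmod w ^ 2" .
        have "cmod (G (z + w + of_real t) - G (z + of_real t) - w * deriv G (z + of_real t)) * cmod (\<phi> t) \<le> (K * cmod w ^ 2) * C"
        proof (rule mult_mono)
          show "0 \<le> K * (cmod w)\<^sup>2" by (rule order_trans[OF norm_ge_zero k])
        qed (use k \<phi> in \<open>auto simp: add_ac\<close>)
        thus "cmod ((G (z + w + of_real t) - G (z + of_real t) - w * deriv G (z + of_real t)) * \<phi> t) \<le> K * cmod w ^ 2 * C"
          by (simp add: norm_mult)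
      next
        show "(\<lambda>t. (G (z + w + of_real t) - G (z + of_real t) - w * deriv G (z + of_real t)) * \<phi> t) \<in> borel_measurable borel"
          using meas[OF G(1), of "z + w"] meas[OF G(1), of z] meas[OF dG, of z] by measurable
      qed (use \<open>R \<ge> 0\<close> in auto)
      finally show ?thesis by simp
    qed
    have "((\<lambda>w. (H (z + w) - H z) / w - L) \<longlongrightarrow> 0) (at 0)"
    proof (rule Lim_null_comparison)
      show "eventually (\<lambda>w. norm ((H (z + w) - H z) / w - L) \<le> K * C * (2 * R) * cmod w) (at 0)"
        unfolding eventually_at
      proof (intro exI[of _ 1] conjI ballI impI)
        fix w :: complex assume "w \<noteq> 0 \<and> dist w 0 < 1"
        hence w: "w \<noteq> 0" "cmod w \<le> 1" by auto
        have "(H (z + w) - H z) / w - L = (H (z + w) - H z - w * L) / w" using w by (simp add: field_simps)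
        hence "norm ((H (z + w) - H z) / w - L) = cmod (H (z + w) - H z - w * L) / cmod w"
          by (simp add: norm_divide)
        also have "\<dots> \<le> ((K * cmod w ^ 2 * C) * (2 * R)) / cmod w"
          by (intro divide_right_mono est w) auto
        also have "\<dots> = K * C * (2 * R) * cmod w" using w by (simp add: power2_eq_square)
        finally show "norm ((H (z + w) - H z) / w - L) \<le> K * C * (2 * R) * cmod w" .
      qed simp
      show "((\<lambda>w. K * C * (2 * R) * cmod w) \<longlongrightarrow> 0) (at 0)"
        by (intro tendsto_mult_right_zero tendsto_norm_zero tendsto_ident_at)
    qed
    hence "((\<lambda>w. (H (z + w) - H z) / w) \<longlongrightarrow> L) (at 0)" by (simp add: LIM_zero_iff)
    hence "(H has_field_derivative L) (at z)" by (simp add: DERIV_def)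
    thus "H field_differentiable at z within UNIV" by (auto simp: field_differentiable_def)
  qed
  moreover have "cmod (H z) \<le> (A * exp (\<tau> * R) * C * (2 * R)) * exp (\<tau> * cmod z)" for z
  proof -
    have "cmod (H z) \<le> (A * exp (\<tau> * (cmod z + R)) * C) * (R - (-R))"
      unfolding H_def
    proof (rule set_integral_norm_le_const)
      fix t assume t: "t \<in> {-R..R}"
      have "cmod (z + of_real t) \<le> cmod z + R"
        using norm_triangle_ineq[of z "of_real t"] t by auto
      hence "A * exp (\<tau> * cmod (z + of_real t)) \<le> A * exp (\<tau> * (cmod z + R))"
        using A \<open>\<tau> \<ge> 0\<close> by (intro mult_left_mono) (auto intro: mult_left_mono)
      hence "cmod (G (z + of_real t)) \<le> A * exp (\<tau> * (cmod z + R))"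
        using G(2)[of "z + of_real t"] by linarith
      thus "cmod (G (z + of_real t) * \<phi> t) \<le> A * exp (\<tau> * (cmod z + R)) * C"
        using \<phi>[of t] A unfolding norm_mult by (intro mult_mono) auto
    next
      show "(\<lambda>t. G (z + of_real t) * \<phi> t) \<in> borel_measurable borel"
        using meas[OF G(1), of z] by measurable
    qed (use \<open>R \<ge> 0\<close> in auto)
    thus ?thesis by (simp add: distrib_left exp_add mult_ac)
  qed
  moreover have "(LINT t:{-R..R}|lborel. g (x + t) * \<phi> t) = H (of_real x)" for x
    by (simp add: H_def G(3))
  ultimately show ?thesis unfolding entire_growth_def by blast
qed

lemma integrable_powr_of_Lp_norm_finite:
  assumes "f \<in> borel_measurable borel" "Lp_norm p f < \<infinity>"
  shows "integrable lborel (\<lambda>x. cmod (f x) powr p)"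
proof (rule integrableI_bounded)
  show "(\<lambda>x. cmod (f x) powr p) \<in> borel_measurable lborel" using assms(1) by measurable
  show "(\<integral>\<^sup>+ x. ennreal (norm (cmod (f x) powr p)) \<partial>lborel) < \<infinity>"
    using assms(2) by (auto simp: Lp_norm_lborel ennreal_root_def less_top split: if_splits)
qed

lemma set_integral_powr_shift_le:
  fixes f :: "real \<Rightarrow> complex"
  assumes "integrable lborel (\<lambda>x. cmod (f x) powr p)"
  shows "(LINT t:{a..b}|lborel. cmod (f (x + t)) powr p) \<le> (LINT t|lborel. cmod (f t) powr p)"
proof -
  have i: "integrable lborel (\<lambda>t. cmod (f (x + 1 * t)) powr p)"
    by (rule lborel_integrable_real_affine[OF assms]) simp
  have "(LINT t:{a..b}|lborel. cmod (f (x + t)) powr p) \<le> (LINT t|lborel. cmod (f (x + t)) powr p)"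
    unfolding set_lebesgue_integral_def
    by (rule integral_mono') (use i in \<open>auto simp: indicator_def\<close>)
  also have "\<dots> = (LINT t|lborel. cmod (f t) powr p)"
    using lborel_integral_real_affine[of 1 "\<lambda>t. cmod (f t) powr p" x] by simp
  finally show ?thesis .
qed


lemma fwd_diff_convolution:
  fixes g :: "real \<Rightarrow> complex"
  assumes "continuous_on UNIV g" "\<phi> \<in> borel_measurable borel" "\<And>t. cmod (\<phi> t) \<le> C"
  shows "fwd_diff k \<eta> (\<lambda>x. LINT t:{a..b}|lborel. g (x + t) * \<phi> t) x
    = (LINT t:{a..b}|lborel. fwd_diff k \<eta> g (x + t) * \<phi> t)"
proof (induction k arbitrary: x)
  case (Suc k)
  have c: "continuous_on UNIV (\<lambda>t. fwd_diff k \<eta> g (y + t))" for y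
    unfolding fwd_diff_def by (intro continuous_intros continuous_on_compose2[OF assms(1)]) auto
  have i: "set_integrable lborel {a..b} (\<lambda>t. fwd_diff k \<eta> g (y + t) * \<phi> t)" for y
    by (rule set_integrable_continuous_times_bounded[OF c assms(2,3)])
  show ?case
    unfolding fwd_diff_Suc Suc set_integral_diff(2)[OF i i, symmetric]
    by (simp add: algebra_simps)
qed simp

lemma Lp_norm_integral:
  assumes "p > 0" "integrable lborel (\<lambda>x. cmod (f x) powr p)"
  shows "Lp_norm p f = ennreal ((LINT x|lborel. cmod (f x) powr p) powr (1/p))"
  unfolding Lp_norm_lborel
  by (subst nn_integral_eq_integral[OF assms(2)]) (auto simp: ennreal_root_def)

text \<open>An inequality between differences that holds for bounded functions of the class in the supremum
  norm holds with the same constant in \<open>L\<^sup>p\<close>. With \<open>u\<close> and \<open>v\<close> the two differences of \<open>g\<close>, integrate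
  \<open>g (x + t)\<close> against the weight \<open>\<phi> t = conj (u t) \<bar>u t\<bar>\<^sup>p\<^sup>-\<^sup>2\<close>, cut off at \<open>\<bar>t\<bar> = R\<close>. The resulting
  function \<open>H\<close> is entire of the same type and bounded on the line. The difference of \<open>H\<close> that
  corresponds to \<open>u\<close> takes the value \<open>B = \<integral> \<bar>u\<bar>\<^sup>p\<close>, integrated over \<open>[-R, R]\<close>, at \<open>0\<close>; the one that
  corresponds to \<open>v\<close> is bounded by \<open>\<integral> \<bar>v (x + t)\<bar> \<bar>u t\<bar>\<^sup>p\<^sup>-\<^sup>1\<close>.
  Young's inequality, scaled by \<open>C\<close>, bounds the latter in terms of \<open>\<integral> \<bar>v\<bar>\<^sup>p\<close> and of \<open>B\<close> with a factor
  less than one, and this part is absorbed. Finally \<open>R\<close> tends to infinity.\<close>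

lemma Lp_norm_fwd_diff_transfer:
  assumes g: "entire_growth \<tau> g" "\<tau> \<ge> 0" and "p \<ge> 1" "C > 0" and fin: "Lp_norm p g < \<infinity>"
    and sup: "\<And>H S. entire_growth \<tau> H \<Longrightarrow> bounded (range H) \<Longrightarrow>
       (\<And>x. cmod (fwd_diff m \<eta> H x) \<le> S) \<Longrightarrow> cmod (fwd_diff n h H 0) \<le> C * S"
  shows "Lp_norm p (fwd_diff n h g) \<le> ennreal C * Lp_norm p (fwd_diff m \<eta> g)"
proof -
  define u where "u = fwd_diff n h g"
  define v where "v = fwd_diff m \<eta> g"
  have cg: "continuous_on UNIV g" by (rule entire_growth_continuous) fact
  have cu: "continuous_on UNIV u" unfolding u_def using g by (intro entire_growth_continuous entire_growth_fwd_diff)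
  have cv: "continuous_on UNIV v" unfolding v_def using g by (intro entire_growth_continuous entire_growth_fwd_diff)
  have [measurable]: "g \<in> borel_measurable borel" and um[measurable]: "u \<in> borel_measurable borel"
    and vm[measurable]: "v \<in> borel_measurable borel"
    by (intro borel_measurable_continuous_onI cg cu cv)+
  have gm: "g \<in> borel_measurable lebesgue" by (rule measurable_completion) measurable
  have fd: "Lp_norm p (fwd_diff k d g) < \<infinity>" for k d
  proof -
    have "Lp_norm p (fwd_diff k d g) \<le> 2 ^ k * Lp_norm p g"
      by (rule Lp_norm_fwd_diff_le[OF \<open>p \<ge> 1\<close> gm])
    also have "\<dots> < \<infinity>" using fin by (simp add: ennreal_mult_less_top power_less_top_ennreal)
    finally show ?thesis .
  qed
  have ig: "integrable lborel (\<lambda>x. cmod (g x) powr p)"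
    by (rule integrable_powr_of_Lp_norm_finite) (use fin in auto)
  have iu: "integrable lborel (\<lambda>x. cmod (u x) powr p)"
    by (rule integrable_powr_of_Lp_norm_finite[OF um]) (unfold u_def, rule fd)
  have iv: "integrable lborel (\<lambda>x. cmod (v x) powr p)"
    by (rule integrable_powr_of_Lp_norm_finite[OF vm]) (unfold v_def, rule fd)
  define V where "V = (LINT x|lborel. cmod (v x) powr p)"
  have V0: "V \<ge> 0" by (simp add: V_def)
  define B where "B = (\<lambda>R. LINT t:{-R..R}|lborel. cmod (u t) powr p)"
  have main: "B R \<le> C powr p * V" if "R \<ge> 0" for R
  proof -
    \<comment> \<open>as \<open>0 powr a = 0\<close> for every \<open>a\<close>, the weight vanishes at zeros of \<open>u\<close>, and \<open>\<bar>\<phi>\<bar> = \<bar>u\<bar> powr (p - 1)\<close> also there\<close>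
    define \<phi> where "\<phi> = (\<lambda>t. if t \<in> {-R..R} then cnj (u t) * of_real (cmod (u t) powr (p - 2)) else 0)"
    have [measurable]: "(\<lambda>t. cnj (u t)) \<in> borel_measurable borel"
      by (intro borel_measurable_continuous_onI continuous_on_cnj cu)
    have [measurable]: "\<phi> \<in> borel_measurable borel"
      unfolding \<phi>_def by measurable
    have n\<phi>: "cmod (\<phi> t) = cmod (u t) powr (p - 1)" if "t \<in> {-R..R}" for t
    proof -
      have "cmod (\<phi> t) = cmod (u t) * cmod (u t) powr (p - 2)" using that by (simp add: \<phi>_def norm_mult)
      also have "\<dots> = cmod (u t) powr (p - 1)" by (simp add: powr_mult_base)
      finally show ?thesis .
    qed
    have u\<phi>: "u t * \<phi> t = of_real (cmod (u t) powr p)" if "t \<in> {-R..R}" for t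
    proof -
      have "u t * \<phi> t = of_real (cmod (u t) * (cmod (u t) * cmod (u t) powr (p - 2)))"
        using that by (simp add: \<phi>_def complex_norm_square[symmetric] power2_eq_square flip: mult.assoc)
      also have "cmod (u t) * (cmod (u t) * cmod (u t) powr (p - 2)) = cmod (u t) powr p"
        by (simp add: powr_mult_base)
      finally show ?thesis .
    qed
    obtain U where U: "\<And>t. t \<in> {-R..R} \<Longrightarrow> cmod (u t) \<le> U"
      by (rule continuous_on_bounded_Icc[OF cu]) (rule that)
    have \<phi>U: "cmod (\<phi> t) \<le> U powr (p - 1)" for t
    proof (cases "t \<in> {-R..R}")
      case True
      show ?thesis unfolding n\<phi>[OF True] using U[OF True] \<open>p \<ge> 1\<close> by (intro powr_mono2) auto
    qed (auto simp: \<phi>_def)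
    define H where "H = (\<lambda>x. LINT t:{-R..R}|lborel. g (x + t) * \<phi> t)"
    have eH: "entire_growth \<tau> H" unfolding H_def
      by (rule entire_growth_convolution[OF g \<open>R \<ge> 0\<close> _ \<phi>U]) measurable
    have cs: "continuous_on UNIV (\<lambda>t. F (x + t))" if "continuous_on UNIV F" for F :: "real \<Rightarrow> complex" and x
      by (rule continuous_on_compose2[OF that]) (auto intro!: continuous_intros)
    have i\<phi>: "set_integrable lborel {-R..R} (\<lambda>t. F (x + t) * \<phi> t)" if "continuous_on UNIV F" for F x
      by (rule set_integrable_continuous_times_bounded[OF cs[OF that] _ \<phi>U]) measurable
    have ip: "set_integrable lborel {-R..R} (\<lambda>t. cmod (F (x + t)) powr p)" if F: "continuous_on UNIV F" for F :: "real \<Rightarrow> complex" and x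
    proof -
      obtain D where D: "\<And>t. t \<in> {-R..R} \<Longrightarrow> cmod (F (x + t)) \<le> D"
        by (rule continuous_on_bounded_Icc[OF cs[OF F, of x]]) (rule that)
      have [measurable]: "F \<in> borel_measurable borel" by (rule borel_measurable_continuous_onI) fact
      show ?thesis
        by (rule set_integrable_bounded_Icc[where B = "D powr p"])
           (use D \<open>p \<ge> 1\<close> in \<open>auto intro!: powr_mono2\<close>)
    qed
    have ic: "set_integrable lborel {-R..R} (\<lambda>t. c)" for c :: real
      by (rule set_integrable_bounded_Icc[where B = "\<bar>c\<bar>"]) auto
    have "cmod (H x) \<le> U powr (p - 1) * ((LINT t|lborel. cmod (g t) powr p) + 2 * R)" for x
    proof -
      have "cmod (H x) \<le> (LINT t:{-R..R}|lborel. cmod (g (x + t) * \<phi> t))"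
        unfolding H_def by (rule set_integral_norm_bound[OF i\<phi>[OF cg]])
      also have "\<dots> \<le> (LINT t:{-R..R}|lborel. U powr (p - 1) * (cmod (g (x + t)) powr p + 1))"
      proof (intro set_integral_mono set_integrable_norm i\<phi> cg set_integrable_mult_right set_integral_add ip ic)
        fix t
        have "cmod (g (x + t)) * 1 powr (p - 1) \<le> cmod (g (x + t)) powr p / p + (1 - 1/p) * 1 powr p"
          using \<open>p \<ge> 1\<close> by (intro young_powr) auto
        also have "\<dots> \<le> cmod (g (x + t)) powr p / 1 + 1"
          using \<open>p \<ge> 1\<close> by (intro add_mono divide_left_mono) auto
        finally have "cmod (g (x + t)) * cmod (\<phi> t) \<le> (cmod (g (x + t)) powr p + 1) * U powr (p - 1)"
          using \<phi>U[of t] by (intro mult_mono) auto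
        thus "cmod (g (x + t) * \<phi> t) \<le> U powr (p - 1) * (cmod (g (x + t)) powr p + 1)"
          by (simp add: norm_mult mult.commute)
      qed
      also have "\<dots> = U powr (p - 1) * ((LINT t:{-R..R}|lborel. cmod (g (x + t)) powr p) + (LINT t:{-R..R}|lborel. 1))"
        unfolding set_integral_mult_right by (subst set_integral_add(2)[OF ip[OF cg] ic]) simp
      also have "\<dots> \<le> U powr (p - 1) * ((LINT t|lborel. cmod (g t) powr p) + 2 * R)"
        using set_integral_powr_shift_le[OF ig, of "-R" R x] \<open>R \<ge> 0\<close>
        by (intro mult_left_mono add_mono) (auto simp: set_lebesgue_integral_def)
      finally show ?thesis .
    qed
    hence bH: "bounded (range H)" unfolding bounded_iff by blast
    \<comment> \<open>the bound that Young's inequality, scaled by \<open>C\<close>, gives for the difference that corresponds to \<open>v\<close>\<close>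
    define S where "S = C powr (p - 1) * (V / p + (1 - 1/p) * (B R / C powr p))"
    have "cmod (fwd_diff m \<eta> H x) \<le> S" for x
    proof -
      have "fwd_diff m \<eta> H x = (LINT t:{-R..R}|lborel. v (x + t) * \<phi> t)"
        unfolding H_def v_def by (rule fwd_diff_convolution[OF cg _ \<phi>U]) measurable
      also have "cmod \<dots> \<le> (LINT t:{-R..R}|lborel. cmod (v (x + t) * \<phi> t))"
        by (rule set_integral_norm_bound[OF i\<phi>[OF cv]])
      also have "\<dots> \<le> (LINT t:{-R..R}|lborel. C powr (p - 1) *
          (cmod (v (x + t)) powr p / p + (1 - 1/p) / C powr p * cmod (u (0 + t)) powr p))"
      proof (intro set_integral_mono set_integrable_norm i\<phi> cv cu set_integrable_mult_right set_integral_add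
          set_integrable_divide ip)
        fix t assume t: "t \<in> {-R..R}"
        have "cmod (v (x + t)) * (cmod (u t) / C) powr (p - 1) \<le>
            cmod (v (x + t)) powr p / p + (1 - 1/p) * (cmod (u t) / C) powr p"
          using \<open>p \<ge> 1\<close> \<open>C > 0\<close> by (intro young_powr) auto
        hence "C powr (p - 1) * (cmod (v (x + t)) * (cmod (u t) / C) powr (p - 1)) \<le>
            C powr (p - 1) * (cmod (v (x + t)) powr p / p + (1 - 1/p) * (cmod (u t) / C) powr p)"
          by (rule mult_left_mono) simp
        moreover have "C powr (p - 1) * (cmod (v (x + t)) * (cmod (u t) / C) powr (p - 1)) = cmod (v (x + t) * \<phi> t)"
          using \<open>C > 0\<close> by (simp add: norm_mult n\<phi>[OF t] powr_divide)
        moreover have "(1 - 1/p) * (cmod (u t) / C) powr p = (1 - 1/p) / C powr p * cmod (u t) powr p"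
          using \<open>C > 0\<close> by (simp add: powr_divide)
        ultimately show "cmod (v (x + t) * \<phi> t) \<le> C powr (p - 1) *
          (cmod (v (x + t)) powr p / p + (1 - 1/p) / C powr p * cmod (u (0 + t)) powr p)" by simp
      qed
      also have "\<dots> = C powr (p - 1) * ((LINT t:{-R..R}|lborel. cmod (v (x + t)) powr p) / p
          + (1 - 1/p) / C powr p * (LINT t:{-R..R}|lborel. cmod (u (0 + t)) powr p))"
        unfolding set_integral_mult_right
        by (subst set_integral_add(2), intro set_integrable_divide ip cv, intro set_integrable_mult_right ip cu)
          simp
      also have "\<dots> \<le> C powr (p - 1) * (V / p + (1 - 1/p) / C powr p * B R)"
        using set_integral_powr_shift_le[OF iv, of "-R" R x] \<open>p \<ge> 1\<close>
        by (intro mult_left_mono add_mono divide_right_mono) (auto simp: V_def B_def)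
      finally show ?thesis by (simp add: S_def)
    qed
    hence "cmod (fwd_diff n h H 0) \<le> C * S" by (rule sup[OF eH bH])
    moreover have "fwd_diff n h H 0 = of_real (B R)"
    proof -
      have "fwd_diff n h H 0 = (LINT t:{-R..R}|lborel. u (0 + t) * \<phi> t)"
        unfolding H_def u_def by (rule fwd_diff_convolution[OF cg _ \<phi>U]) measurable
      also have "\<dots> = (LINT t:{-R..R}|lborel. of_real (cmod (u t) powr p))"
        by (rule set_lebesgue_integral_cong) (use u\<phi> in auto)
      finally show ?thesis by (simp add: B_def set_integral_complex_of_real)
    qed
    ultimately have "B R \<le> C * S" by simp
    also have "C * S = (C * C powr (p - 1)) * (V / p) + (C * C powr (p - 1)) / C powr p * ((1 - 1/p) * B R)"
      by (simp add: S_def algebra_simps)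
    also have "C * C powr (p - 1) = C powr p" using \<open>C > 0\<close> by (simp add: powr_mult_base)
    also have "C powr p / C powr p = 1" using \<open>C > 0\<close> by simp
    finally have "B R / p \<le> C powr p * V / p" by (simp add: algebra_simps)
    thus ?thesis using \<open>p \<ge> 1\<close> by (simp add: divide_le_cancel)
  qed
  have "(\<lambda>k. B (real k)) \<longlonglongrightarrow> (LINT t|lborel. cmod (u t) powr p)"
    unfolding B_def set_lebesgue_integral_def
  proof (rule integral_dominated_convergence[where w = "\<lambda>t. cmod (u t) powr p"])
    show "AE t in lborel. (\<lambda>k. indicator {- real k..real k} t *\<^sub>R (cmod (u t) powr p)) \<longlonglongrightarrow> cmod (u t) powr p"
    proof (rule AE_I2)
      fix t :: real
      obtain N where N: "\<bar>t\<bar> \<le> real N" using real_arch_simple by blast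
      have "eventually (\<lambda>k. indicator {- real k..real k} t *\<^sub>R (cmod (u t) powr p) = cmod (u t) powr p) sequentially"
        unfolding eventually_sequentially
        by (rule exI[of _ N]) (use N in \<open>auto simp: indicator_def abs_le_iff\<close>)
      thus "(\<lambda>k. indicator {- real k..real k} t *\<^sub>R (cmod (u t) powr p)) \<longlonglongrightarrow> cmod (u t) powr p"
        by (rule tendsto_eventually)
    qed
  qed (use iu in \<open>auto simp: indicator_def\<close>)
  hence le: "(LINT t|lborel. cmod (u t) powr p) \<le> C powr p * V"
    by (rule LIMSEQ_le_const2) (use main in auto)
  have "(LINT t|lborel. cmod (u t) powr p) powr (1/p) \<le> (C powr p * V) powr (1/p)"
    using le \<open>p \<ge> 1\<close> by (intro powr_mono2) auto
  also have "\<dots> = C * V powr (1/p)"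
    using \<open>C > 0\<close> V0 \<open>p \<ge> 1\<close> by (simp add: powr_mult powr_powr)
  finally have "ennreal ((LINT t|lborel. cmod (u t) powr p) powr (1/p)) \<le> ennreal C * ennreal (V powr (1/p))"
    using \<open>C > 0\<close> by (simp add: ennreal_mult'[symmetric] ennreal_leI)
  thus ?thesis
    using Lp_norm_integral[OF _ iu] Lp_norm_integral[OF _ iv] \<open>p \<ge> 1\<close> by (simp add: u_def v_def V_def)
qed

text \<open>The supremum version for \<open>\<tau> = 2 W\<close>, for which \<open>1 / (2 e \<tau>) = 1 / (4 e W)\<close>.\<close>

lemma nikolskii_stechkin_Lp:
  assumes g: "g \<in> Bernstein_space W p" and "W > 0" "p \<ge> 1" "h > 0"
  shows "Lp_norm p (fwd_diff (Suc n) h g) \<le>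
    ennreal ((8 * exp 1 * (h * W)) ^ Suc n) * Lp_norm p (fwd_diff n (1 / (4 * exp 1 * W)) g)"
proof -
  obtain F where F: "F holomorphic_on UNIV" "exponential_type_le W F" "\<And>x. g x = F (of_real x)"
    and fin: "Lp_norm p g < \<infinity>"
    using g by (auto simp: Bernstein_space_def Lp_space_def)
  obtain A where "\<And>z. cmod (F z) \<le> A * exp ((W + W) * cmod z)"
    using F(2) \<open>W > 0\<close> unfolding exponential_type_le_def by blast
  hence eg: "entire_growth (2 * W) g"
    unfolding entire_growth_def using F(1,3) by (auto intro!: exI[of _ F] exI[of _ A])
  define \<eta> where "\<eta> = 1 / (4 * exp 1 * W)"
  have q: "2 * h / \<eta> = 8 * exp 1 * (h * W)" by (simp add: \<eta>_def)
  have "Lp_norm p (fwd_diff (Suc n) h g) \<le> ennreal ((2 * h / \<eta>) ^ Suc n) * Lp_norm p (fwd_diff n \<eta> g)"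
  proof (rule Lp_norm_fwd_diff_transfer[OF eg _ \<open>p \<ge> 1\<close> _ fin])
    show "cmod (fwd_diff (Suc n) h H 0) \<le> (2 * h / \<eta>) ^ Suc n * S"
      if "entire_growth (2 * W) H" "bounded (range H)" "\<And>x. cmod (fwd_diff n \<eta> H x) \<le> S" for H S
      by (rule nikolskii_stechkin_sup[OF that(1,2) _ _ _ that(3)])
         (use \<open>W > 0\<close> \<open>h > 0\<close> in \<open>auto simp: \<eta>_def\<close>)
  qed (use \<open>W > 0\<close> \<open>h > 0\<close> in \<open>auto simp: \<eta>_def\<close>)
  thus ?thesis unfolding q unfolding \<eta>_def .
qed

section \<open>Iterated integrals over a cube\<close>

text \<open>Functions in \<open>\<Lambda>\<^sup>p\<close> are Lebesgue measurable, but Tonelli's theorem asks for joint measurability of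
  \<open>w (x + t)\<close>, which Borel measurability provides. A function is therefore replaced by a Borel function
  equal to it almost everywhere; integral averages are the same at every point.\<close>

definition bounded_borel :: "(real \<Rightarrow> complex) \<Rightarrow> bool" where
  "bounded_borel w \<longleftrightarrow> w \<in> borel_measurable borel \<and> bounded (range w)"

lemma bounded_borelE:
  assumes "bounded_borel w"
  obtains B where "B \<ge> 0" "\<And>x. cmod (w x) \<le> B"
proof -
  obtain B where B: "\<And>x. cmod (w x) \<le> B"
    using assms unfolding bounded_borel_def bounded_iff by blast
  moreover have "B \<ge> 0" by (rule order_trans[OF norm_ge_zero B[of 0]])
  ultimately show ?thesis using that by blast
qed

lemma bounded_borelI:
  assumes "w \<in> borel_measurable borel" "\<And>x. cmod (w x) \<le> B"
  shows "bounded_borel w"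
  using assms unfolding bounded_borel_def bounded_iff by blast

lemma bounded_borel_measurable: "bounded_borel w \<Longrightarrow> w \<in> borel_measurable borel"
  by (simp add: bounded_borel_def)

lemma bounded_borel_affine:
  assumes "bounded_borel w"
  shows "bounded_borel (\<lambda>x. w (y + c * x))"
proof -
  obtain B where B: "B \<ge> 0" "\<And>x. cmod (w x) \<le> B" by (rule bounded_borelE[OF assms]) (rule that)
  have [measurable]: "w \<in> borel_measurable borel" using assms by (rule bounded_borel_measurable)
  show ?thesis by (rule bounded_borelI[OF _ B(2)]) measurable
qed

lemma bounded_borel_shift: "bounded_borel w \<Longrightarrow> bounded_borel (\<lambda>x. w (x + h))"
  using bounded_borel_affine[of w h 1] by (simp add: add.commute)

lemma bounded_borel_const: "bounded_borel (\<lambda>x. c)"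
  by (rule bounded_borelI[where B = "cmod c"]) auto

lemma bounded_borel_cmult:
  assumes "bounded_borel w"
  shows "bounded_borel (\<lambda>x. c * w x)"
proof -
  obtain B where B: "B \<ge> 0" "\<And>x. cmod (w x) \<le> B" by (rule bounded_borelE[OF assms]) (rule that)
  have [measurable]: "w \<in> borel_measurable borel" using assms by (rule bounded_borel_measurable)
  show ?thesis
    by (rule bounded_borelI[where B = "cmod c * B"]) (use B in \<open>auto simp: norm_mult mult_left_mono\<close>)
qed

lemma bounded_borel_add:
  assumes "bounded_borel v" "bounded_borel w"
  shows "bounded_borel (\<lambda>x. v x + w x)"
proof -
  obtain A where A: "A \<ge> 0" "\<And>x. cmod (v x) \<le> A" by (rule bounded_borelE[OF assms(1)]) (rule that)
  obtain B where B: "B \<ge> 0" "\<And>x. cmod (w x) \<le> B" by (rule bounded_borelE[OF assms(2)]) (rule that)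
  have [measurable]: "v \<in> borel_measurable borel" "w \<in> borel_measurable borel"
    using assms by (auto intro: bounded_borel_measurable)
  show ?thesis
  proof (rule bounded_borelI[where B = "A + B"])
    show "cmod (v x + w x) \<le> A + B" for x
      using norm_triangle_ineq[of "v x" "w x"] A(2)[of x] B(2)[of x] by linarith
  qed measurable
qed

lemma bounded_borel_sum:
  assumes "\<And>i. i \<in> I \<Longrightarrow> bounded_borel (w i)"
  shows "bounded_borel (\<lambda>x. \<Sum>i\<in>I. w i x)"
  using assms by (induction I rule: infinite_finite_induct) (auto intro: bounded_borel_const bounded_borel_add)

lemma bounded_borel_fwd_diff: "bounded_borel w \<Longrightarrow> bounded_borel (fwd_diff n h w)"
  unfolding fwd_diff_def by (intro bounded_borel_sum bounded_borel_cmult bounded_borel_shift)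

lemma bounded_borel_set_integrable:
  assumes "bounded_borel w"
  shows "set_integrable lborel {a..b} w"
proof -
  obtain B where B: "B \<ge> 0" "\<And>x. cmod (w x) \<le> B" by (rule bounded_borelE[OF assms]) (rule that)
  show ?thesis
    by (rule set_integrable_bounded_Icc[where B = B]) (use B assms in \<open>auto intro: bounded_borel_measurable\<close>)
qed

lemma bounded_borel_set_integral_shift:
  assumes "bounded_borel w"
  shows "bounded_borel (\<lambda>x. LINT t:{0..a}|lborel. w (x + t))"
proof -
  obtain B where B: "B \<ge> 0" "\<And>x. cmod (w x) \<le> B" by (rule bounded_borelE[OF assms]) (rule that)
  have [measurable]: "w \<in> borel_measurable borel" using assms by (rule bounded_borel_measurable)
  show ?thesis
  proof (rule bounded_borelI[where B = "B * \<bar>a\<bar>"])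
    show "(\<lambda>x. LINT t:{0..a}|lborel. w (x + t)) \<in> borel_measurable borel"
      unfolding set_lebesgue_integral_def by measurable
    show "cmod (LINT t:{0..a}|lborel. w (x + t)) \<le> B * \<bar>a\<bar>" for x
    proof (cases "a \<ge> 0")
      case True
      have "cmod (LINT t:{0..a}|lborel. w (x + t)) \<le> B * (a - 0)"
        by (rule set_integral_norm_le_const) (use True B in auto)
      thus ?thesis using True by simp
    next
      case False
      thus ?thesis using B(1) by (simp add: set_lebesgue_integral_def mult_nonneg_nonpos)
    qed
  qed
qed

lemma set_integral_lebesgue_eq_lborel:
  fixes g :: "real \<Rightarrow> complex"
  assumes "g \<in> borel_measurable borel"
  shows "(LINT t:{a..b}|lebesgue. g t) = (LINT t:{a..b}|lborel. g t)"
  unfolding set_lebesgue_integral_def by (rule integral_completion) (use assms in measurable)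

lemma cube_integral_bounded_borel:
  assumes "bounded_borel w"
  shows "bounded_borel (cube_integral n a w)"
    "cube_integral (Suc n) a w u = (LINT t:{0..a}|lborel. cube_integral n a w (u + t))"
proof -
  have step: "cube_integral (Suc n) a w u = (LINT t:{0..a}|lborel. cube_integral n a w (u + t))"
    if "bounded_borel (cube_integral n a w)" for n u
    using bounded_borel_measurable[OF that] by (simp add: set_integral_lebesgue_eq_lborel)
  show bb: "bounded_borel (cube_integral n a w)"
  proof (induction n)
    case (Suc n)
    have "cube_integral (Suc n) a w = (\<lambda>u. LINT t:{0..a}|lborel. cube_integral n a w (u + t))"
      by (rule ext) (rule step[OF Suc])
    thus ?case using bounded_borel_set_integral_shift[OF Suc] by simp
  next
    case 0
    have "cube_integral 0 a w = w" by (rule ext) simp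
    thus ?case using assms by simp
  qed
  show "cube_integral (Suc n) a w u = (LINT t:{0..a}|lborel. cube_integral n a w (u + t))"
    by (rule step[OF bb])
qed

lemma cube_integral_shift: "cube_integral n a (\<lambda>x. w (x + h)) u = cube_integral n a w (u + h)"
  by (induction n arbitrary: u) (simp_all add: add_ac)

lemma cube_integral_cmult: "cube_integral n a (\<lambda>x. c * w x) u = c * cube_integral n a w u"
  by (induction n arbitrary: u) simp_all

lemma cube_integral_add:
  assumes "bounded_borel v" "bounded_borel w"
  shows "cube_integral n a (\<lambda>x. v x + w x) u = cube_integral n a v u + cube_integral n a w u"
proof (induction n arbitrary: u)
  case (Suc n)
  have i: "set_integrable lborel {0..a} (\<lambda>t. cube_integral n a y (u + t))" if "bounded_borel y" for y
    using bounded_borel_set_integrable[OF bounded_borel_shift[OF cube_integral_bounded_borel(1)[OF that]], of 0 a n a u]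
    by (simp add: add.commute)
  show ?case
    unfolding cube_integral_bounded_borel(2)[OF assms(1)] cube_integral_bounded_borel(2)[OF assms(2)]
      cube_integral_bounded_borel(2)[OF bounded_borel_add[OF assms]] Suc
    by (rule set_integral_add(2)[OF i[OF assms(1)] i[OF assms(2)]])
qed simp

lemma cube_integral_diff:
  assumes "bounded_borel v" "bounded_borel w"
  shows "cube_integral n a (\<lambda>x. v x - w x) u = cube_integral n a v u - cube_integral n a w u"
  using cube_integral_add[OF assms(1) bounded_borel_cmult[OF assms(2), of "-1"]]
  by (simp add: cube_integral_cmult[of n a "-1" w, simplified])

lemma cube_integral_0_fun: "cube_integral n a (\<lambda>x. 0) u = 0"
  using cube_integral_cmult[of n a 0 "\<lambda>x. 0" u] by simp

lemma cube_integral_sum: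
  assumes "\<And>i. i \<in> I \<Longrightarrow> bounded_borel (w i)"
  shows "cube_integral n a (\<lambda>x. \<Sum>i\<in>I. w i x) u = (\<Sum>i\<in>I. cube_integral n a (w i) u)"
  using assms
  by (induction I rule: infinite_finite_induct)
     (simp_all add: cube_integral_0_fun cube_integral_add bounded_borel_sum)

lemma cube_integral_const:
  assumes "a \<ge> 0"
  shows "cube_integral n a (\<lambda>x. c) u = of_real (a ^ n) * c"
proof (induction n arbitrary: u)
  case (Suc n)
  show ?case unfolding cube_integral_bounded_borel(2)[OF bounded_borel_const] Suc
    using assms by (simp add: set_lebesgue_integral_def scaleR_conv_of_real mult_ac)
qed simp

text \<open>Dilating the argument rescales the cube; this turns the Steklov average, whose terms have step
  \<open>m/r\<close>, into a combination of cube integrals of the function itself.\<close>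

lemma cube_integral_scale:
  assumes "bounded_borel w" "c > 0"
  shows "cube_integral n d (\<lambda>u. w (y + c * u)) v = of_real ((1/c) ^ n) * cube_integral n (c * d) w (y + c * v)"
proof (induction n arbitrary: v)
  case (Suc n)
  have "cube_integral (Suc n) d (\<lambda>u. w (y + c * u)) v =
      (LINT t:{0..d}|lborel. of_real ((1/c) ^ n) * cube_integral n (c * d) w (y + c * (v + t)))"
    unfolding cube_integral_bounded_borel(2)[OF bounded_borel_affine[OF assms(1)]] Suc ..
  also have "\<dots> = of_real ((1/c) ^ n) * (LINT t:{0..d}|lborel. cube_integral n (c * d) w (y + c * v + c * t))"
    by (simp add: distrib_left add.assoc)
  also have "(LINT t:{0..d}|lborel. cube_integral n (c * d) w (y + c * v + c * t)) =
      (LINT t|lborel. indicator {0..c * d} (0 + c * t) *\<^sub>R cube_integral n (c * d) w (y + c * v + (0 + c * t)))"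
    unfolding set_lebesgue_integral_def using \<open>c > 0\<close>
    by (intro Bochner_Integration.integral_cong) (auto simp: indicator_def zero_le_mult_iff)
  also have "\<dots> = (1/c) *\<^sub>R (LINT t:{0..c * d}|lborel. cube_integral n (c * d) w (y + c * v + t))"
    unfolding set_lebesgue_integral_def using \<open>c > 0\<close>
      lborel_integral_real_affine[of c "\<lambda>t. indicator {0..c * d} t *\<^sub>R cube_integral n (c * d) w (y + c * v + t)" 0]
    by simp
  also have "\<dots> = of_real (1/c) * cube_integral (Suc n) (c * d) w (y + c * v)"
    unfolding cube_integral_bounded_borel(2)[OF assms(1)] by (simp add: scaleR_conv_of_real)
  finally show ?case by (simp add: mult_ac)
qed simp

lemma cube_integral_fwd_diff:
  assumes "bounded_borel w"
  shows "cube_integral n a (fwd_diff k h w) u = fwd_diff k h (cube_integral n a w) u"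
proof -
  have "cube_integral n a (\<lambda>x. \<Sum>i = 0..k. of_nat (k choose i) * (- 1) ^ (k - i) * w (x + real i * h)) u =
    (\<Sum>i = 0..k. cube_integral n a (\<lambda>x. of_nat (k choose i) * (- 1) ^ (k - i) * w (x + real i * h)) u)"
    by (rule cube_integral_sum) (intro bounded_borel_cmult bounded_borel_shift assms)
  thus ?thesis unfolding fwd_diff_def by (simp only: cube_integral_cmult cube_integral_shift)
qed

lemma norm_cube_integral_le:
  assumes "bounded_borel w" "a \<ge> 0" and "\<And>t. 0 \<le> t \<Longrightarrow> t \<le> real n * a \<Longrightarrow> cmod (w (u + t)) \<le> B"
  shows "cmod (cube_integral n a w u) \<le> B * a ^ n"
  using assms(3)
proof (induction n arbitrary: u)
  case (Suc n)
  have "cmod (LINT t:{0..a}|lborel. cube_integral n a w (u + t)) \<le> B * a ^ n * (a - 0)"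
  proof (rule set_integral_norm_le_const)
    fix t assume t: "t \<in> {0..a}"
    show "cmod (cube_integral n a w (u + t)) \<le> B * a ^ n"
    proof (rule Suc.IH)
      fix t' assume "0 \<le> t'" "t' \<le> real n * a"
      thus "cmod (w (u + t + t')) \<le> B"
        using Suc.prems[of "t + t'"] t by (simp add: add.assoc distrib_right)
    qed
  next
    have [measurable]: "cube_integral n a w \<in> borel_measurable borel"
      by (rule bounded_borel_measurable[OF cube_integral_bounded_borel(1)[OF assms(1)]])
    show "(\<lambda>t. cube_integral n a w (u + t)) \<in> borel_measurable borel" by measurable
  qed (use \<open>a \<ge> 0\<close> in auto)
  thus ?case unfolding cube_integral_bounded_borel(2)[OF assms(1)] by (simp add: mult_ac)
qed (use assms in force)

text \<open>Iteration of the integral Minkowski inequality. The parameter \<open>N\<close> fixes the range of \<open>u\<close> on which the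
  norms are controlled, while the induction runs over the number \<open>n\<close> of integrations that remain.\<close>

lemma Lp_norm_cube_integral_family_le:
  fixes \<Psi> :: "real \<Rightarrow> real \<Rightarrow> complex"
  assumes "p \<ge> 1" "d > 0" "M \<ge> 0" and \<Psi>: "(\<lambda>(x,u). \<Psi> x u) \<in> borel_measurable (borel \<Otimes>\<^sub>M borel)"
    and B: "\<And>x u. cmod (\<Psi> x u) \<le> B"
    and M: "\<And>u. 0 \<le> u \<Longrightarrow> u \<le> real N * d \<Longrightarrow> Lp_norm p (\<lambda>x. \<Psi> x u) \<le> ennreal M"
    and "0 \<le> v" "v + real n * d \<le> real N * d"
  shows "Lp_norm p (\<lambda>x. cube_integral n d (\<Psi> x) v) \<le> ennreal (d ^ n * M)"
proof -
  have bb: "bounded_borel (\<Psi> x)" for x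
    by (rule bounded_borelI[OF _ B]) (use measurable_compose[OF _ \<Psi>, of "\<lambda>u. (x,u)"] in simp)
  have meas: "(\<lambda>(x,u). cube_integral n d (\<Psi> x) u) \<in> borel_measurable (borel \<Otimes>\<^sub>M borel)" for n
  proof (induction n)
    case (Suc n)
    have [measurable]: "(\<lambda>(x,u). cube_integral n d (\<Psi> x) u) \<in> borel_measurable (borel \<Otimes>\<^sub>M borel)" by (rule Suc)
    have "(\<lambda>(x,u). LINT t:{0..d}|lborel. cube_integral n d (\<Psi> x) (u + t)) \<in> borel_measurable (borel \<Otimes>\<^sub>M borel)"
      unfolding set_lebesgue_integral_def by measurable
    thus ?case unfolding cube_integral_bounded_borel(2)[OF bb] .
  qed (use \<Psi> in simp)
  show ?thesis using assms(7,8)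
  proof (induction n arbitrary: v)
    case (Suc n)
    have "Lp_norm p (\<lambda>x. LINT t:{0..d}|lborel. cube_integral n d (\<Psi> x) (v + t)) \<le> ennreal (d * (d ^ n * M))"
    proof (rule Lp_norm_set_integral_le[OF \<open>p \<ge> 1\<close> \<open>d > 0\<close>, where B = "B * d ^ n"])
      have [measurable]: "(\<lambda>(x,u). cube_integral n d (\<Psi> x) u) \<in> borel_measurable (borel \<Otimes>\<^sub>M borel)" by (rule meas)
      show "(\<lambda>(x, t). cube_integral n d (\<Psi> x) (v + t)) \<in> borel_measurable (borel \<Otimes>\<^sub>M borel)" by measurable
      show "cmod (cube_integral n d (\<Psi> x) (v + t)) \<le> B * d ^ n" for x t
        by (rule norm_cube_integral_le[OF bb]) (use B \<open>d > 0\<close> in auto)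
      show "Lp_norm p (\<lambda>x. cube_integral n d (\<Psi> x) (v + t)) \<le> ennreal (d ^ n * M)" if "t \<in> {0..d}" for t
        by (rule Suc.IH) (use that Suc.prems in \<open>auto simp: distrib_right\<close>)
    qed (use \<open>d > 0\<close> \<open>M \<ge> 0\<close> in auto)
    thus ?case unfolding cube_integral_bounded_borel(2)[OF bb] by (simp add: mult_ac)
  qed (use M in auto)
qed

lemma bounded_borel_lebesgue: "bounded_borel w \<Longrightarrow> w \<in> borel_measurable lebesgue"
  by (intro measurable_completion) (auto dest: bounded_borel_measurable)

lemma Lp_norm_cube_integral_le:
  assumes "bounded_borel w" "p \<ge> 1" "a > 0" "Lp_norm p w \<le> ennreal M" "M \<ge> 0"
  shows "Lp_norm p (cube_integral n a w) \<le> ennreal (a ^ n * M)"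
proof -
  obtain B where B: "B \<ge> 0" "\<And>x. cmod (w x) \<le> B" by (rule bounded_borelE[OF assms(1)]) (rule that)
  have [measurable]: "w \<in> borel_measurable borel" using assms(1) by (rule bounded_borel_measurable)
  have "Lp_norm p (\<lambda>x. cube_integral n a (\<lambda>u. w (u + x)) 0) \<le> ennreal (a ^ n * M)"
  proof (rule Lp_norm_cube_integral_family_le[where N = n and B = B])
    show "Lp_norm p (\<lambda>x. w (u + x)) \<le> ennreal M" for u
      using Lp_norm_shift[OF bounded_borel_lebesgue[OF assms(1)], of p u] assms(4) by (simp add: add.commute)
  qed (use assms B in \<open>auto simp: case_prod_beta\<close>)
  thus ?thesis by (simp add: cube_integral_shift)
qed

lemma AE_lborel_affine:
  fixes P :: "real \<Rightarrow> bool"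
  assumes "AE x in lborel. P x" "c \<noteq> 0"
  shows "AE x in lborel. P (t + c * x)"
proof -
  obtain N where N: "N \<in> null_sets lborel" "\<And>x. x \<notin> N \<Longrightarrow> P x"
    using assms(1) unfolding eventually_ae_filter by auto
  have "N \<in> sets borel" using N(1) by auto
  have "AE x in lborel. x \<notin> N" using N(1) by (rule AE_not_in)
  hence "AE x in lborel. t + c * x \<notin> N"
    using AE_borel_affine[of c "\<lambda>x. x \<notin> N" t] \<open>N \<in> sets borel\<close> \<open>c \<noteq> 0\<close> by simp
  thus ?thesis by eventually_elim (rule N(2))
qed

text \<open>One integration erases the difference between functions that agree almost everywhere.\<close>

lemma cube_integral_cong_AE:
  fixes f w :: "real \<Rightarrow> complex"
  assumes "AE x in lborel. f x = w x" and f: "f \<in> borel_measurable lebesgue" and w: "w \<in> borel_measurable lebesgue"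
  shows "cube_integral (Suc n) a f = cube_integral (Suc n) a w"
proof (induction n)
  case 0
  show ?case
  proof (rule ext)
    fix u
    have "AE t in lborel. f (u + 1 * t) = w (u + 1 * t)" by (rule AE_lborel_affine[OF assms(1)]) simp
    hence "AE t in lebesgue. f (u + t) = w (u + t)" by (simp add: AE_completion_iff)
    hence "(LINT t:{0..a}|lebesgue. f (u + t)) = (LINT t:{0..a}|lebesgue. w (u + t))"
      using borel_measurable_lebesgue_affine[OF f, of 1 u] borel_measurable_lebesgue_affine[OF w, of 1 u]
      by (intro set_lebesgue_integral_cong_AE) auto
    thus "cube_integral (Suc 0) a f u = cube_integral (Suc 0) a w u" by simp
  qed
next
  case (Suc n)
  show ?case
  proof (rule ext)
    fix u
    show "cube_integral (Suc (Suc n)) a f u = cube_integral (Suc (Suc n)) a w u"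
      by (subst (1 2) cube_integral.simps(2)) (simp only: Suc)
  qed
qed

text \<open>The majorant is kept: where the Borel version of \<open>f\<close> violates it, which happens on a null set, the
  value is reset to \<open>0\<close>.\<close>

lemma lebesgue_measurable_AE_eq_borel:
  fixes f :: "real \<Rightarrow> complex"
  assumes "f \<in> borel_measurable lebesgue" "\<And>x. cmod (f x) \<le> \<beta> x"
    and [measurable]: "\<beta> \<in> borel_measurable borel" and B: "\<And>x. \<beta> x \<le> B"
  obtains w where "bounded_borel w" "AE x in lborel. f x = w x" "\<And>x. cmod (w x) \<le> \<beta> x"
proof -
  have \<beta>0: "\<beta> x \<ge> 0" for x by (rule order_trans[OF norm_ge_zero assms(2)])
  have "(\<lambda>x. Re (f x)) \<in> borel_measurable lebesgue" "(\<lambda>x. Im (f x)) \<in> borel_measurable lebesgue"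
    using assms(1) by measurable
  then obtain r i where r: "r \<in> borel_measurable borel" "AE x in lborel. Re (f x) = r x"
    and i: "i \<in> borel_measurable borel" "AE x in lborel. Im (f x) = i x"
    using completion_ex_borel_measurable_real[of "\<lambda>x. Re (f x)" lborel]
      completion_ex_borel_measurable_real[of "\<lambda>x. Im (f x)" lborel] by auto
  define w where "w = (\<lambda>x. if cmod (Complex (r x) (i x)) \<le> \<beta> x then Complex (r x) (i x) else 0)"
  have C: "(\<lambda>x. Complex (r x) (i x)) = (\<lambda>x. of_real (r x) + \<i> * of_real (i x))"
    by (rule ext) (simp add: complex_eq_iff)
  have [measurable]: "(\<lambda>x. Complex (r x) (i x)) \<in> borel_measurable borel"
    unfolding C using r(1) i(1) by measurable
  have w: "cmod (w x) \<le> \<beta> x" for x by (simp add: w_def \<beta>0)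
  show ?thesis
  proof (rule that)
    have "w \<in> borel_measurable borel" unfolding w_def by measurable
    thus "bounded_borel w" by (rule bounded_borelI) (rule order_trans[OF w B])
    show "AE x in lborel. f x = w x"
      using r(2) i(2)
    proof eventually_elim
      case (elim x)
      hence "f x = Complex (r x) (i x)" by (simp add: complex_eq_iff)
      thus ?case using assms(2)[of x] by (simp add: w_def)
    qed
  qed (rule w)
qed

section \<open>Derivatives of cube integrals and membership in Sobolev spaces\<close>

text \<open>Lebesgue points in the form of the fundamental theorem of calculus. The base point varies so that no
  primitive on the whole line has to be fixed.\<close>

definition primitive_differentiable_at :: "(real \<Rightarrow> complex) \<Rightarrow> real \<Rightarrow> bool" where
  "primitive_differentiable_at w x \<longleftrightarrow>
     (\<forall>b<x. ((\<lambda>y. integral {b..y} w) has_vector_derivative w x) (at x))"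

lemma primitive_differentiable_at_continuous:
  assumes "continuous_on UNIV w"
  shows "primitive_differentiable_at w x"
  unfolding primitive_differentiable_at_def
proof (intro allI impI)
  fix b :: real assume "b < x"
  have "((\<lambda>y. integral {b..y} w) has_vector_derivative w x) (at x within {b..x+1})"
    using \<open>b < x\<close> by (intro integral_has_vector_derivative continuous_on_subset[OF assms]) auto
  thus "((\<lambda>y. integral {b..y} w) has_vector_derivative w x) (at x)"
    using \<open>b < x\<close> at_within_Icc_at[of b x "x + 1"] by simp
qed

lemma bounded_borel_integrable_on: "bounded_borel w \<Longrightarrow> w integrable_on {a..b}"
  by (intro set_borel_integral_eq_integral(1) bounded_borel_set_integrable)

text \<open>Lebesgue's differentiation theorem for intervals to the right of \<open>x\<close>, applied to \<open>w\<close> for the right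
  derivative and to the reflected function for the left derivative.\<close>

lemma primitive_differentiable_at_AE:
  assumes "bounded_borel w"
  shows "AE x in lborel. primitive_differentiable_at w x"
proof -
  have i: "w integrable_on cbox a b" for a b
    using bounded_borel_integrable_on[OF assms, of a b] by (simp add: cbox_interval)
  have "bounded_borel (\<lambda>x. w (- x))" using bounded_borel_affine[OF assms, of 0 "-1"] by simp
  hence i': "(\<lambda>x. w (- x)) integrable_on cbox a b" for a b
    using bounded_borel_integrable_on[of "\<lambda>x. w (- x)" a b] by (simp add: cbox_interval)
  obtain N where N: "negligible N" "\<And>x e. x \<notin> N \<Longrightarrow> 0 < e \<Longrightarrow>
      \<exists>d>0. \<forall>h. 0 < h \<and> h < d \<longrightarrow> norm (integral (cbox x (x + h *\<^sub>R One)) w /\<^sub>R h ^ DIM(real) - w x) < e"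
    by (rule integrable_ccontinuous_explicit[OF i]) (rule that)
  obtain N' where N': "negligible N'" "\<And>x e. x \<notin> N' \<Longrightarrow> 0 < e \<Longrightarrow>
      \<exists>d>0. \<forall>h. 0 < h \<and> h < d \<longrightarrow> norm (integral (cbox x (x + h *\<^sub>R One)) (\<lambda>x. w (- x)) /\<^sub>R h ^ DIM(real) - w (- x)) < e"
    by (rule integrable_ccontinuous_explicit[OF i']) (rule that)
  have pd: "primitive_differentiable_at w x" if x: "x \<notin> N" "- x \<notin> N'" for x
    unfolding primitive_differentiable_at_def has_vector_derivative_def has_derivative_at_alt
  proof (intro allI impI conjI bounded_linear_scaleR_left)
    fix b e :: real assume "b < x" "e > 0"
    obtain d1 where d1: "d1 > 0" "\<And>h. 0 < h \<Longrightarrow> h < d1 \<Longrightarrow> norm (integral {x..x + h} w /\<^sub>R h - w x) < e"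
      using N(2)[OF x(1) \<open>e > 0\<close>] by (auto simp: cbox_interval)
    obtain d2 where d2: "d2 > 0" "\<And>h. 0 < h \<Longrightarrow> h < d2 \<Longrightarrow> norm (integral {- x..- x + h} (\<lambda>x. w (- x)) /\<^sub>R h - w x) < e"
      using N'(2)[OF x(2) \<open>e > 0\<close>] by (auto simp: cbox_interval)
    have scale: "norm (I - h *\<^sub>R v) \<le> e * h" if "norm (I /\<^sub>R h - v) < e" "h > 0" for I v :: complex and h
    proof -
      have "I - h *\<^sub>R v = h *\<^sub>R (I /\<^sub>R h - v)" using that by (simp add: scaleR_diff_right)
      hence "norm (I - h *\<^sub>R v) = h * norm (I /\<^sub>R h - v)" using that by simp
      also have "\<dots> \<le> h * e" using that by (intro mult_left_mono) auto
      finally show ?thesis by (simp add: mult.commute)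
    qed
    have comb: "integral {b..c} w + integral {c..y} w = integral {b..y} w" if "b \<le> c" "c \<le> y" for c y
      by (rule Henstock_Kurzweil_Integration.integral_combine[OF that bounded_borel_integrable_on[OF assms]])
    show "\<exists>d>0. \<forall>y. norm (y - x) < d \<longrightarrow>
        norm (integral {b..y} w - integral {b..x} w - (y - x) *\<^sub>R w x) \<le> e * norm (y - x)"
    proof (intro exI[of _ "Min {d1, d2, x - b}"] conjI allI impI)
      show "Min {d1, d2, x - b} > 0" using d1 d2 \<open>b < x\<close> by simp
      fix y assume "norm (y - x) < Min {d1, d2, x - b}"
      hence y: "\<bar>y - x\<bar> < d1" "\<bar>y - x\<bar> < d2" "\<bar>y - x\<bar> < x - b" by auto
      show "norm (integral {b..y} w - integral {b..x} w - (y - x) *\<^sub>R w x) \<le> e * norm (y - x)"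
      proof (cases y x rule: linorder_cases)
        case equal thus ?thesis by simp
      next
        case greater
        have "integral {b..y} w - integral {b..x} w = integral {x..x + (y - x)} w"
          using comb[of x y] \<open>b < x\<close> greater by (simp add: algebra_simps)
        thus ?thesis using scale[OF d1(2)[of "y - x"]] greater y by simp
      next
        case less
        have "integral {b..y} w - integral {b..x} w = - integral {y..x} w"
          using comb[of y x] y less by (simp add: algebra_simps abs_less_iff)
        moreover have "integral {- x..- x + (x - y)} (\<lambda>x. w (- x)) = integral {y..x} w"
          using Henstock_Kurzweil_Integration.integral_reflect_real[of x y w] by simp
        ultimately have "integral {b..y} w - integral {b..x} w - (y - x) *\<^sub>R w x
            = - (integral {- x..- x + (x - y)} (\<lambda>x. w (- x)) - (x - y) *\<^sub>R w x)"
          by (simp add: scaleR_diff_left)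
        hence "norm (integral {b..y} w - integral {b..x} w - (y - x) *\<^sub>R w x)
            = norm (integral {- x..- x + (x - y)} (\<lambda>x. w (- x)) - (x - y) *\<^sub>R w x)"
          by (simp only: norm_minus_cancel)
        thus ?thesis using scale[OF d2(2)[of "x - y"]] less y by simp
      qed
    qed
  qed
  have "AE x in lborel. x \<notin> N" "AE x in lborel. x \<notin> N'"
    using AE_not_in[of N lebesgue] AE_not_in[of N' lebesgue] N(1) N'(1)
    by (simp_all add: negligible_iff_null_sets AE_completion_iff)
  hence "AE x in lborel. x \<notin> N" "AE x in lborel. 0 + (-1) * x \<notin> N'"
    using AE_lborel_affine[of "\<lambda>x. x \<notin> N'" "-1" 0] by auto
  thus ?thesis by eventually_elim (rule pd, auto)
qed

lemma set_integral_shift_eq: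
  assumes "bounded_borel w" "b \<le> y" "a \<ge> 0"
  shows "(LINT t:{0..a}|lborel. w (y + t)) = integral {b..y + a} w - integral {b..y} w"
proof -
  have "(LINT t:{0..a}|lborel. w (y + t)) = (LINT t|lborel. indicator {y..y + a} (y + 1 * t) *\<^sub>R w (y + 1 * t))"
    unfolding set_lebesgue_integral_def
    by (intro Bochner_Integration.integral_cong) (auto simp: indicator_def)
  also have "\<dots> = (LINT t:{y..y+a}|lborel. w t)"
    unfolding set_lebesgue_integral_def
    using lborel_integral_real_affine[of 1 "\<lambda>t. indicator {y..y + a} t *\<^sub>R w t" y] by simp
  also have "\<dots> = integral {y..y+a} w"
    by (intro set_borel_integral_eq_integral bounded_borel_set_integrable assms)
  also have "\<dots> = integral {b..y + a} w - integral {b..y} w"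
    using Henstock_Kurzweil_Integration.integral_combine[OF \<open>b \<le> y\<close> _ bounded_borel_integrable_on[OF assms(1)], of "y + a"] \<open>a \<ge> 0\<close>
    by (simp add: algebra_simps)
  finally show ?thesis .
qed

text \<open>The average over a moving window is a difference of two values of a primitive.\<close>

lemma set_integral_shift_has_vector_derivative:
  assumes w: "bounded_borel w" "a \<ge> 0" and "primitive_differentiable_at w x" "primitive_differentiable_at w (x + a)"
  shows "((\<lambda>y. LINT t:{0..a}|lborel. w (y + t)) has_vector_derivative w (x + a) - w x) (at x)"
proof -
  define b where "b = x - 1"
  have d1: "((\<lambda>y. integral {b..y} w) has_vector_derivative w x) (at x)"
    using assms(3) by (simp add: primitive_differentiable_at_def b_def)
  have "((\<lambda>y. integral {b..y} w) has_vector_derivative w (x + a)) (at (x + a))"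
    using assms(4) \<open>a \<ge> 0\<close> by (simp add: primitive_differentiable_at_def b_def)
  moreover have "((\<lambda>y. y + a) has_vector_derivative 1) (at x)"
    by (auto intro!: derivative_eq_intros simp: has_vector_derivative_def)
  ultimately have "(((\<lambda>y. integral {b..y} w) \<circ> (\<lambda>y. y + a)) has_vector_derivative 1 *\<^sub>R w (x + a)) (at x)"
    by (intro vector_diff_chain_at)
  hence "((\<lambda>y. integral {b..y + a} w - integral {b..y} w) has_vector_derivative w (x + a) - w x) (at x)"
    using d1 by (intro has_vector_derivative_diff) (simp_all add: o_def)
  thus ?thesis
  proof (rule has_vector_derivative_transform_within_open[of _ _ _ "{b<..}"])
    show "integral {b..y + a} w - integral {b..y} w = (LINT t:{0..a}|lborel. w (y + t))" if "y \<in> {b<..}" for y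
      using set_integral_shift_eq[OF w(1) _ w(2), of b y] that by simp
  qed (auto simp: b_def)
qed

lemma set_integral_shift_lipschitz:
  assumes w: "bounded_borel w" "a \<ge> 0" and B: "\<And>x. cmod (w x) \<le> B"
  shows "cmod ((LINT t:{0..a}|lborel. w (y + t)) - (LINT t:{0..a}|lborel. w (x + t))) \<le> 2 * B * \<bar>y - x\<bar>"
proof -
  have *: "cmod ((LINT t:{0..a}|lborel. w (y + t)) - (LINT t:{0..a}|lborel. w (x + t))) \<le> 2 * B * (y - x)"
    if "x \<le> y" for x y
  proof -
    have p: "integral {x..z + (y - x)} w - integral {x..z} w = (LINT t:{0..y - x}|lborel. w (z + t))" if "x \<le> z" for z
      using set_integral_shift_eq[OF w(1) that, of "y - x"] \<open>x \<le> y\<close> by simp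
    have le: "cmod (LINT t:{0..y - x}|lborel. w (z + t)) \<le> B * (y - x - 0)" for z
      by (rule set_integral_norm_le_const)
         (use B bounded_borel_measurable[OF bounded_borel_shift[OF w(1), of z]] \<open>x \<le> y\<close> in \<open>auto simp: add.commute\<close>)
    have "(LINT t:{0..a}|lborel. w (y + t)) - (LINT t:{0..a}|lborel. w (x + t))
       = (LINT t:{0..y - x}|lborel. w (x + a + t)) - (LINT t:{0..y - x}|lborel. w (x + t))"
      using p[of "x + a"] p[of x] \<open>a \<ge> 0\<close> \<open>x \<le> y\<close>
        set_integral_shift_eq[OF w(1) \<open>x \<le> y\<close> \<open>a \<ge> 0\<close>] set_integral_shift_eq[OF w(1) order_refl \<open>a \<ge> 0\<close>, of x]
      by (simp add: algebra_simps)
    also have "cmod \<dots> \<le> 2 * B * (y - x)"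
      using norm_triangle_ineq4[of "LINT t:{0..y - x}|lborel. w (x + a + t)" "LINT t:{0..y - x}|lborel. w (x + t)"]
        le[of x] le[of "x + a"] by simp
    finally show ?thesis .
  qed
  show ?thesis
  proof (cases "x \<le> y")
    case True thus ?thesis using *[OF True] by simp
  next
    case False
    thus ?thesis using *[of y x] by (simp add: norm_minus_commute)
  qed
qed

lemma lipschitz_locally_absolutely_continuous:
  assumes "\<And>x y. cmod (g y - g x) \<le> L * \<bar>y - x\<bar>"
  shows "locally_absolutely_continuous g"
  unfolding locally_absolutely_continuous_def absolutely_continuous_on_interval_def
proof (intro allI impI)
  fix a b \<epsilon> :: real assume "\<epsilon> > 0"
  define L' where "L' = max L 1"
  show "\<exists>\<delta>>0. \<forall>(n::nat) u v. (\<forall>i<n. a \<le> u i \<and> u i \<le> v i \<and> v i \<le> b) \<and>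
        disjoint_family_on (\<lambda>i. {u i<..<v i}) {..<n} \<and> (\<Sum>i<n. v i - u i) < \<delta> \<longrightarrow>
        (\<Sum>i<n. cmod (g (v i) - g (u i))) < \<epsilon>"
  proof (intro exI[of _ "\<epsilon> / L'"] conjI allI impI)
    show "\<epsilon> / L' > 0" using \<open>\<epsilon> > 0\<close> by (simp add: L'_def)
    fix n :: nat and u v :: "nat \<Rightarrow> real"
    assume *: "(\<forall>i<n. a \<le> u i \<and> u i \<le> v i \<and> v i \<le> b) \<and>
        disjoint_family_on (\<lambda>i. {u i<..<v i}) {..<n} \<and> (\<Sum>i<n. v i - u i) < \<epsilon> / L'"
    have "(\<Sum>i<n. cmod (g (v i) - g (u i))) \<le> (\<Sum>i<n. L' * (v i - u i))"
    proof (rule sum_mono)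
      fix i assume "i \<in> {..<n}"
      hence "u i \<le> v i" using * by auto
      have "cmod (g (v i) - g (u i)) \<le> L * \<bar>v i - u i\<bar>" by (rule assms)
      also have "\<dots> \<le> L' * (v i - u i)" using \<open>u i \<le> v i\<close> by (auto simp: L'_def intro: mult_right_mono)
      finally show "cmod (g (v i) - g (u i)) \<le> L' * (v i - u i)" .
    qed
    also have "\<dots> = L' * (\<Sum>i<n. v i - u i)" by (simp add: sum_distrib_left)
    also have "\<dots> < L' * (\<epsilon> / L')" using * by (intro mult_strict_left_mono) (auto simp: L'_def)
    also have "\<dots> = \<epsilon>" by (simp add: L'_def)
    finally show "(\<Sum>i<n. cmod (g (v i) - g (u i))) < \<epsilon>" .
  qed
qed

lemma cube_integral_Suc_lipschitz:
  assumes "bounded_borel w" "a \<ge> 0"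
  obtains L where "\<And>x y. cmod (cube_integral (Suc n) a w y - cube_integral (Suc n) a w x) \<le> L * \<bar>y - x\<bar>"
proof -
  have bb: "bounded_borel (cube_integral n a w)" by (rule cube_integral_bounded_borel) fact
  obtain B where B: "B \<ge> 0" "\<And>x. cmod (cube_integral n a w x) \<le> B" by (rule bounded_borelE[OF bb]) (rule that)
  show ?thesis
    by (rule that[of "2 * B"])
      (unfold cube_integral_bounded_borel(2)[OF assms(1)], rule set_integral_shift_lipschitz[OF bb assms(2) B(2)])
qed

lemma cube_integral_Suc_continuous:
  assumes "bounded_borel w" "a \<ge> 0"
  shows "continuous_on UNIV (cube_integral (Suc n) a w)"
proof -
  obtain L where L: "\<And>x y. cmod (cube_integral (Suc n) a w y - cube_integral (Suc n) a w x) \<le> L * \<bar>y - x\<bar>"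
    by (rule cube_integral_Suc_lipschitz[OF assms]) (rule that)
  have "L \<ge> 0" using order_trans[OF norm_ge_zero L[of 1 0]] by simp
  have "L-lipschitz_on UNIV (cube_integral (Suc n) a w)"
    by (rule lipschitz_onI) (use L \<open>L \<ge> 0\<close> in \<open>simp_all add: dist_norm\<close>)
  thus ?thesis by (rule lipschitz_on_continuous_on)
qed

lemma cube_integral_Suc_has_vector_derivative:
  assumes "bounded_borel w" "a \<ge> 0"
    and "primitive_differentiable_at (cube_integral n a w) x" "primitive_differentiable_at (cube_integral n a w) (x + a)"
  shows "(cube_integral (Suc n) a w has_vector_derivative cube_integral n a (fwd_diff 1 a w) x) (at x)"
proof -
  have "cube_integral (Suc n) a w = (\<lambda>y. LINT t:{0..a}|lborel. cube_integral n a w (y + t))"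
    by (rule ext) (rule cube_integral_bounded_borel(2)[OF assms(1)])
  moreover have "cube_integral n a (fwd_diff 1 a w) x = cube_integral n a w (x + a) - cube_integral n a w x"
    by (simp add: cube_integral_fwd_diff[OF assms(1)] fwd_diff_Suc)
  ultimately show ?thesis
    using set_integral_shift_has_vector_derivative[OF cube_integral_bounded_borel(1)[OF assms(1)] assms(2-4)] by simp
qed

text \<open>Steklov averages are finite linear combinations of cube integrals with different steps. The wider
  family \<open>\<Sum> c\<^sub>i J\<^sub>i\<^sup>n \<Delta>\<^sub>i\<^sup>k w\<close>, where \<open>J\<^sub>i\<close> integrates over a window of length \<open>a\<^sub>i\<close> and \<open>\<Delta>\<^sub>i\<close> is the
  difference with step \<open>a\<^sub>i\<close>, is closed under differentiation: each derivative trades one integral for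
  one difference. The last integral is differentiated only almost everywhere.\<close>

locale cube_integral_combination =
  fixes I :: "'i set" and c :: "'i \<Rightarrow> complex" and a :: "'i \<Rightarrow> real" and w :: "real \<Rightarrow> complex"
  assumes fin: "finite I" and w: "bounded_borel w" and a: "\<And>i. i \<in> I \<Longrightarrow> a i > 0"
begin

definition comb :: "nat \<Rightarrow> nat \<Rightarrow> real \<Rightarrow> complex" where
  "comb n k x = (\<Sum>i\<in>I. c i * cube_integral n (a i) (fwd_diff k (a i) w) x)"

lemma comb_bounded_borel: "bounded_borel (comb n k)"
  unfolding comb_def
  by (intro bounded_borel_sum bounded_borel_cmult cube_integral_bounded_borel bounded_borel_fwd_diff w)

lemma comb_has_vector_derivative:
  assumes "\<And>i. i \<in> I \<Longrightarrow> primitive_differentiable_at (cube_integral n (a i) (fwd_diff k (a i) w)) x"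
    "\<And>i. i \<in> I \<Longrightarrow> primitive_differentiable_at (cube_integral n (a i) (fwd_diff k (a i) w)) (x + a i)"
  shows "(comb (Suc n) k has_vector_derivative comb n (Suc k) x) (at x)"
proof -
  have d: "(cube_integral (Suc n) (a i) (fwd_diff k (a i) w) has_vector_derivative
      cube_integral n (a i) (fwd_diff (Suc k) (a i) w) x) (at x)" if "i \<in> I" for i
  proof -
    have "fwd_diff 1 (a i) (fwd_diff k (a i) w) = fwd_diff (Suc k) (a i) w"
      by (rule ext) (simp add: fwd_diff_Suc)
    thus ?thesis
      using cube_integral_Suc_has_vector_derivative[OF bounded_borel_fwd_diff[OF w] less_imp_le[OF a[OF that]] assms(1,2)[OF that]]
      by simp
  qed
  show ?thesis unfolding comb_def[abs_def]
    by (intro has_vector_derivative_sum has_vector_derivative_mult_right d)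
qed

lemma comb_has_vector_derivative_Suc:
  "(comb (Suc (Suc n)) k has_vector_derivative comb (Suc n) (Suc k) x) (at x)"
  by (rule comb_has_vector_derivative;
      rule primitive_differentiable_at_continuous[OF cube_integral_Suc_continuous[OF bounded_borel_fwd_diff[OF w]]])
     (use a in force)+

lemma comb_has_vector_derivative_AE:
  "AE x in lborel. (comb (Suc n) k has_vector_derivative comb n (Suc k) x) (at x)"
proof -
  have "AE x in lborel. \<forall>i\<in>I. primitive_differentiable_at (cube_integral n (a i) (fwd_diff k (a i) w)) x \<and>
      primitive_differentiable_at (cube_integral n (a i) (fwd_diff k (a i) w)) (x + a i)"
  proof (rule AE_finite_allI[OF fin])
    fix i
    have "AE x in lborel. primitive_differentiable_at (cube_integral n (a i) (fwd_diff k (a i) w)) x"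
      by (intro primitive_differentiable_at_AE cube_integral_bounded_borel bounded_borel_fwd_diff w)
    from this AE_lborel_affine[OF this, of 1 "a i"]
    show "AE x in lborel. primitive_differentiable_at (cube_integral n (a i) (fwd_diff k (a i) w)) x \<and>
      primitive_differentiable_at (cube_integral n (a i) (fwd_diff k (a i) w)) (x + a i)"
      by (auto simp: add.commute)
  qed
  thus ?thesis by eventually_elim (rule comb_has_vector_derivative, auto)
qed

lemma nth_deriv_comb:
  assumes "k < r"
  shows "nth_deriv k (comb r 0) = comb (r - k) k"
  using assms
proof (induction k)
  case (Suc k)
  then obtain n where n: "r - k = Suc (Suc n)" "r - Suc k = Suc n"
    by (metis Suc_diff_Suc Suc_lessD)
  have "nth_deriv (Suc k) (comb r 0) x = comb (Suc n) (Suc k) x" for x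
    using Suc vector_derivative_at[OF comb_has_vector_derivative_Suc[of n k x]] n
    by (simp add: nth_deriv_def)
  thus ?case using n by auto
qed (simp add: nth_deriv_def)

lemma nth_deriv_comb_AE:
  assumes "k \<le> r"
  shows "AE x in lborel. nth_deriv k (comb r 0) x = comb (r - k) k x"
proof (cases k)
  case 0 thus ?thesis by (simp add: nth_deriv_def)
next
  case (Suc j)
  obtain n where n: "r - j = Suc n" "r - k = n" using Suc assms by (metis Suc_diff_Suc Suc_le_lessD)
  have "nth_deriv k (comb r 0) = (\<lambda>x. vector_derivative (comb (Suc n) j) (at x))"
    using nth_deriv_comb[of j r] Suc assms n by (simp add: nth_deriv_def)
  thus ?thesis
    using comb_has_vector_derivative_AE[of n j] n Suc
    by (auto elim!: eventually_mono intro: vector_derivative_at)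
qed

lemma comb_Lp_norm_le:
  assumes "p \<ge> 1" and m: "\<And>i. i \<in> I \<Longrightarrow> Lp_norm p (fwd_diff k (a i) w) \<le> ennreal m" and "m \<ge> 0"
  shows "Lp_norm p (comb n k) \<le> ennreal ((\<Sum>i\<in>I. cmod (c i) * a i ^ n) * m)"
proof -
  have bb: "bounded_borel (cube_integral n (a i) (fwd_diff k (a i) w))" for i
    by (intro cube_integral_bounded_borel bounded_borel_fwd_diff w)
  have "Lp_norm p (comb n k) \<le> (\<Sum>i\<in>I. Lp_norm p (\<lambda>x. c i * cube_integral n (a i) (fwd_diff k (a i) w) x))"
    unfolding comb_def
    by (intro Lp_norm_sum_le fin \<open>p \<ge> 1\<close> bounded_borel_lebesgue bounded_borel_cmult bb)
  also have "\<dots> \<le> (\<Sum>i\<in>I. ennreal (cmod (c i) * a i ^ n * m))"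
  proof (rule sum_mono)
    fix i assume i: "i \<in> I"
    have "Lp_norm p (\<lambda>x. c i * cube_integral n (a i) (fwd_diff k (a i) w) x)
        \<le> ennreal (cmod (c i)) * Lp_norm p (cube_integral n (a i) (fwd_diff k (a i) w))"
      using \<open>p \<ge> 1\<close> by (intro Lp_norm_cmult_le bounded_borel_lebesgue bb) auto
    also have "\<dots> \<le> ennreal (cmod (c i)) * ennreal (a i ^ n * m)"
      by (intro mult_left_mono Lp_norm_cube_integral_le bounded_borel_fwd_diff w \<open>p \<ge> 1\<close> a i m \<open>m \<ge> 0\<close>) auto
    also have "\<dots> = ennreal (cmod (c i) * a i ^ n * m)"
      using a[OF i] \<open>m \<ge> 0\<close> by (simp add: ennreal_mult'[symmetric] mult.assoc)
    finally show "Lp_norm p (\<lambda>x. c i * cube_integral n (a i) (fwd_diff k (a i) w) x) \<le> ennreal (cmod (c i) * a i ^ n * m)" .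
  qed
  also have "\<dots> = ennreal (\<Sum>i\<in>I. cmod (c i) * a i ^ n * m)"
    using less_imp_le[OF a] \<open>m \<ge> 0\<close> by (intro sum_ennreal mult_nonneg_nonneg zero_le_power) auto
  finally show ?thesis by (simp add: sum_distrib_right)
qed

lemma comb_lipschitz:
  obtains L where "\<And>x y. cmod (comb (Suc n) k y - comb (Suc n) k x) \<le> L * \<bar>y - x\<bar>"
proof -
  let ?C = "\<lambda>i. cube_integral (Suc n) (a i) (fwd_diff k (a i) w)"
  have "\<exists>L. \<forall>x y. cmod (?C i y - ?C i x) \<le> L * \<bar>y - x\<bar>" if "i \<in> I" for i
    by (rule cube_integral_Suc_lipschitz[OF bounded_borel_fwd_diff[OF w] less_imp_le[OF a[OF that]]])
       (intro exI allI, assumption)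
  then obtain L where L: "\<And>i x y. i \<in> I \<Longrightarrow> cmod (?C i y - ?C i x) \<le> L i * \<bar>y - x\<bar>" by metis
  show ?thesis
  proof (rule that)
    fix x y
    have "comb (Suc n) k y - comb (Suc n) k x = (\<Sum>i\<in>I. c i * (?C i y - ?C i x))"
      unfolding comb_def by (simp only: sum_subtractf[symmetric] right_diff_distrib)
    also have "cmod \<dots> \<le> (\<Sum>i\<in>I. cmod (c i) * (L i * \<bar>y - x\<bar>))"
      by (rule sum_norm_le) (simp only: norm_mult, intro mult_left_mono L, auto)
    finally show "cmod (comb (Suc n) k y - comb (Suc n) k x) \<le> (\<Sum>i\<in>I. cmod (c i) * L i) * \<bar>y - x\<bar>"
      by (simp only: sum_distrib_right mult.assoc)
  qed
qed

text \<open>All derivatives of order less than \<open>s\<close> still carry an integral and are therefore Lipschitz; the one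
  of order \<open>s\<close> agrees almost everywhere with a combination that has finite norm.\<close>

lemma comb_Sobolev:
  assumes "s \<le> r" "p \<ge> 1" and "Lp_norm p w < \<infinity>"
  shows "comb r 0 \<in> Sobolev_space s p"
proof -
  have finite_norm: "Lp_norm p (comb n k) < \<infinity>" for n k
  proof -
    have fd: "Lp_norm p (fwd_diff k h w) \<le> 2 ^ k * Lp_norm p w" for h
      by (rule Lp_norm_fwd_diff_le[OF \<open>p \<ge> 1\<close> bounded_borel_lebesgue[OF w]])
    have "2 ^ k * Lp_norm p w < \<infinity>"
      using assms(3) by (simp add: ennreal_mult_less_top power_less_top_ennreal)
    then obtain m where m: "2 ^ k * Lp_norm p w = ennreal m" "m \<ge> 0"
      by (cases "2 ^ k * Lp_norm p w") auto
    have "Lp_norm p (comb n k) \<le> ennreal ((\<Sum>i\<in>I. cmod (c i) * a i ^ n) * m)"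
      by (rule comb_Lp_norm_le[OF \<open>p \<ge> 1\<close> _ m(2)]) (use fd m in simp)
    also have "\<dots> < \<infinity>" by simp
    finally show ?thesis .
  qed
  have AE: "AE x in lebesgue. comb (r - s) s x = nth_deriv s (comb r 0) x"
    using nth_deriv_comb_AE[OF \<open>s \<le> r\<close>] by (simp add: AE_completion_iff eq_commute)
  have top: "nth_deriv s (comb r 0) \<in> Lp_space p"
    unfolding Lp_space_def mem_Collect_eq
  proof
    show "nth_deriv s (comb r 0) \<in> borel_measurable lebesgue"
      by (rule borel_measurable_AE[OF bounded_borel_lebesgue[OF comb_bounded_borel] AE])
    show "Lp_norm p (nth_deriv s (comb r 0)) < \<infinity>"
      using Lp_norm_cong_AE[OF AE, of p] finite_norm[of "r - s" s] by simp
  qed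
  have diff: "nth_deriv k (comb r 0) differentiable (at x)" if "Suc k < s" for k x
  proof -
    from that \<open>s \<le> r\<close> obtain n where n: "r - k = Suc (Suc n)"
      by (metis Suc_diff_Suc Suc_lessD less_le_trans)
    show ?thesis
      using nth_deriv_comb[of k r] that \<open>s \<le> r\<close> n comb_has_vector_derivative_Suc[of n k x]
      by (auto simp: has_vector_derivative_def intro: differentiableI)
  qed
  have ac: "locally_absolutely_continuous (nth_deriv k (comb r 0))" if "k < s" for k
  proof -
    from that \<open>s \<le> r\<close> obtain n where n: "r - k = Suc n" by (metis Suc_diff_Suc less_le_trans)
    obtain L where "\<And>x y. cmod (comb (Suc n) k y - comb (Suc n) k x) \<le> L * \<bar>y - x\<bar>"
      by (rule comb_lipschitz) (rule that)
    hence "locally_absolutely_continuous (comb (Suc n) k)"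
      by (rule lipschitz_locally_absolutely_continuous)
    thus ?thesis using nth_deriv_comb[of k r] that \<open>s \<le> r\<close> n by simp
  qed
  show ?thesis
    unfolding Sobolev_space_def Lp_space_def[of p]
    using diff ac top finite_norm[of r 0] bounded_borel_lebesgue[OF comb_bounded_borel[of r 0]]
    by (auto simp: Lp_space_def)
qed

lemma nth_deriv_comb_Lp_norm:
  assumes "s \<le> r"
  shows "Lp_norm p (nth_deriv s (comb r 0)) = Lp_norm p (comb (r - s) s)"
  by (rule Lp_norm_cong_AE) (use nth_deriv_comb_AE[OF assms] in \<open>simp add: AE_completion_iff\<close>)

end

section \<open>The spaces \<open>\<Lambda>\<^sup>p\<close> as amalgam spaces\<close>

text \<open>The Wiener amalgam of local \<open>L\<^sup>\<infinity>\<close> and global \<open>\<ell>\<^sup>p\<close>: \<open>b j\<close> majorises the function on the whole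
  interval from \<open>j\<close> to \<open>j + 1\<close>.\<close>

definition lattice_dominated :: "real \<Rightarrow> (int \<Rightarrow> real) \<Rightarrow> (real \<Rightarrow> complex) \<Rightarrow> bool" where
  "lattice_dominated p b f \<longleftrightarrow> (\<forall>j. 0 \<le> b j) \<and> (\<lambda>j. b j powr p) summable_on UNIV \<and> (\<forall>x. cmod (f x) \<le> b \<lfloor>x\<rfloor>)"

lemma infsum_ennreal_finite_iff:
  fixes g :: "'a \<Rightarrow> real"
  assumes "\<And>j. g j \<ge> 0"
  shows "(\<Sum>\<^sub>\<infinity>j\<in>UNIV. ennreal (g j)) < \<infinity> \<longleftrightarrow> g summable_on UNIV"
proof -
  have S: "(\<Sum>\<^sub>\<infinity>j\<in>UNIV. ennreal (g j)) = (SUP F\<in>{F. finite F \<and> F \<subseteq> UNIV}. \<Sum>j\<in>F. ennreal (g j))"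
    by (rule nonneg_infsum_complete) simp
  show ?thesis
  proof
    assume "(\<Sum>\<^sub>\<infinity>j\<in>UNIV. ennreal (g j)) < \<infinity>"
    then obtain r where r: "(\<Sum>\<^sub>\<infinity>j\<in>UNIV. ennreal (g j)) = ennreal r" "r \<ge> 0"
      by (cases "\<Sum>\<^sub>\<infinity>j\<in>UNIV. ennreal (g j)") auto
    have "sum g F \<le> r" if "finite F" for F
    proof -
      have "ennreal (sum g F) = (\<Sum>j\<in>F. ennreal (g j))" using assms by (simp add: sum_ennreal)
      also have "\<dots> \<le> ennreal r" unfolding r(1)[symmetric] S by (rule SUP_upper) (use that in auto)
      finally show ?thesis using r by simp
    qed
    thus "g summable_on UNIV"
      by (intro nonneg_bounded_partial_sums_imp_summable_on[where C = r]) (use assms in \<open>auto intro!: eventually_finite_subsets_at_top_weakI\<close>)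
  next
    assume g: "g summable_on UNIV"
    have "(\<Sum>\<^sub>\<infinity>j\<in>UNIV. ennreal (g j)) \<le> ennreal (infsum g UNIV)"
      unfolding S
    proof (rule SUP_least)
      fix F assume "F \<in> {F. finite F \<and> F \<subseteq> (UNIV :: 'a set)}"
      hence "(\<Sum>j\<in>F. ennreal (g j)) = ennreal (sum g F)" "sum g F \<le> infsum g UNIV"
        using assms by (auto simp: sum_ennreal intro!: finite_sum_le_infsum g)
      thus "(\<Sum>j\<in>F. ennreal (g j)) \<le> ennreal (infsum g UNIV)" by (simp add: ennreal_leI)
    qed
    also have "\<dots> < \<infinity>" by simp
    finally show "(\<Sum>\<^sub>\<infinity>j\<in>UNIV. ennreal (g j)) < \<infinity>" .
  qed
qed

lemma ennreal_root_finite_iff: "ennreal_root p a < \<infinity> \<longleftrightarrow> a < \<infinity>"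
  by (simp add: ennreal_root_def less_top)

lemma admissible_bounds:
  assumes "admissible \<Sigma>"
  obtains d D where "d > 0" "\<And>j. d \<le> \<Sigma> j - \<Sigma> (j - 1)" "\<And>j. \<Sigma> j - \<Sigma> (j - 1) \<le> D"
proof -
  from assms obtain d where d: "0 < ereal d" "ereal d < (INF j. ereal (\<Sigma> j - \<Sigma> (j - 1)))"
    using ereal_dense2[of 0 "INF j. ereal (\<Sigma> j - \<Sigma> (j - 1))"] by (auto simp: admissible_def)
  from assms obtain D where D: "(SUP j. ereal (\<Sigma> j - \<Sigma> (j - 1))) < ereal D"
    using ereal_dense2[of "SUP j. ereal (\<Sigma> j - \<Sigma> (j - 1))" \<infinity>] by (auto simp: admissible_def)
  show ?thesis
  proof (rule that)
    show "d > 0" using d by simp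
    show "d \<le> \<Sigma> j - \<Sigma> (j - 1)" for j
      using order_trans[OF less_imp_le[OF d(2)] INF_lower[of j UNIV]] by simp
    show "\<Sigma> j - \<Sigma> (j - 1) \<le> D" for j
      using order_trans[OF SUP_upper[of j UNIV] less_imp_le[OF D]] by simp
  qed
qed

lemma admissibleI:
  assumes "d > 0" "\<And>j. d \<le> \<Sigma> j - \<Sigma> (j - 1)" "\<And>j. \<Sigma> j - \<Sigma> (j - 1) \<le> D"
  shows "admissible \<Sigma>"
proof -
  have "ereal d \<le> (INF j. ereal (\<Sigma> j - \<Sigma> (j - 1)))" by (rule INF_greatest) (use assms in simp)
  moreover have "(SUP j. ereal (\<Sigma> j - \<Sigma> (j - 1))) \<le> ereal D" by (rule SUP_least) (use assms in simp)
  ultimately show ?thesis using \<open>d > 0\<close> unfolding admissible_def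
    by (metis ereal_infty_less(1) ereal_less(2) less_le_trans le_less_trans less_ereal.simps(4))
qed

lemma sum_powr_le:
  fixes b :: "'i \<Rightarrow> real"
  assumes "finite I" "\<And>i. i \<in> I \<Longrightarrow> b i \<ge> 0" "p \<ge> 1"
  shows "(\<Sum>i\<in>I. b i) powr p \<le> real (card I) powr p * (\<Sum>i\<in>I. b i powr p)"
proof (cases "I = {}")
  case False
  define M where "M = Max (b ` I)"
  have "M \<in> b ` I" unfolding M_def using assms(1) False by (intro Max_in) auto
  then obtain k where k: "k \<in> I" "M = b k" by auto
  have "(\<Sum>i\<in>I. b i) \<le> real (card I) * M"
    using assms(1) by (intro sum_bounded_above) (auto simp: M_def)
  hence "(\<Sum>i\<in>I. b i) powr p \<le> (real (card I) * M) powr p"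
    using assms by (intro powr_mono2 sum_nonneg) auto
  also have "\<dots> = real (card I) powr p * M powr p"
    using k assms by (simp add: powr_mult)
  also have "M powr p \<le> (\<Sum>i\<in>I. b i powr p)"
    unfolding k(2) by (rule member_le_sum) (use k assms in auto)
  finally show ?thesis by (simp add: mult_left_mono)
qed simp

text \<open>If consecutive nodes are at least \<open>d\<close> apart and \<open>N d \<ge> 1\<close>, then within each residue class modulo
  \<open>N\<close> of the index different nodes have different integer parts. The sum over the nodes is therefore at
  most \<open>N\<close> times the sum of the majorant.\<close>

lemma lattice_dominated_Lambda_space:
  assumes f: "f \<in> borel_measurable lebesgue" "bounded (range f)" and dom: "lattice_dominated p b f" and "p \<ge> 1"
  shows "f \<in> Lambda_space p"
proof -
  have b: "\<And>j. 0 \<le> b j" "(\<lambda>j. b j powr p) summable_on UNIV" "\<And>x. cmod (f x) \<le> b \<lfloor>x\<rfloor>"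
    using dom by (auto simp: lattice_dominated_def)
  have "lp_norm p \<Sigma> f < \<infinity>" if adm: "admissible \<Sigma>" for \<Sigma>
  proof -
    obtain d D where dD: "d > 0" "\<And>j. d \<le> \<Sigma> j - \<Sigma> (j - 1)" "\<And>j. \<Sigma> j - \<Sigma> (j - 1) \<le> D"
      by (rule admissible_bounds[OF adm]) (rule that)
    obtain N0 :: nat where N0: "1 / d < real N0" using reals_Archimedean2 by blast
    define N where "N = int N0"
    have "real N0 > 0" using N0 \<open>d > 0\<close> by (meson divide_pos_pos less_trans zero_less_one)
    hence N: "N > 0" "real_of_int N * d \<ge> 1" using N0 \<open>d > 0\<close> by (auto simp: N_def field_simps)
    have grow: "\<Sigma> (j + int k) \<ge> \<Sigma> j + real k * d" for j k
    proof (induction k)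
      case (Suc k)
      have "\<Sigma> (j + int (Suc k)) - \<Sigma> (j + int k) \<ge> d" using dD(2)[of "j + int (Suc k)"] by simp
      thus ?case using Suc by (simp add: distrib_right)
    qed simp
    have far: "\<lfloor>\<Sigma> (N * j + i)\<rfloor> < \<lfloor>\<Sigma> (N * j' + i)\<rfloor>" if "j < j'" for i j j'
    proof -
      have e: "N * j' + i = N * j + i + int (nat (N * (j' - j)))" using that N by (simp add: right_diff_distrib)
      have "N * 1 \<le> N * (j' - j)" using N that by (intro mult_left_mono) auto
      hence "real_of_int N \<le> real (nat (N * (j' - j)))" by simp
      hence "1 \<le> real (nat (N * (j' - j))) * d"
        using N(2) \<open>d > 0\<close> by (meson mult_right_mono less_imp_le order_trans)
      hence "\<Sigma> (N * j' + i) \<ge> \<Sigma> (N * j + i) + 1"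
        using grow[of "N * j + i" "nat (N * (j' - j))"] unfolding e by linarith
      thus ?thesis by linarith
    qed
    have class_sum: "(\<lambda>k. b \<lfloor>\<Sigma> k\<rfloor> powr p) summable_on range (\<lambda>j. N * j + i)" for i
    proof -
      have inj: "inj (\<lambda>j. \<lfloor>\<Sigma> (N * j + i)\<rfloor>)"
        by (rule linorder_injI) (use far in \<open>auto simp: less_le\<close>)
      have "(\<lambda>j. b j powr p) summable_on range (\<lambda>j. \<lfloor>\<Sigma> (N * j + i)\<rfloor>)"
        using b(2) by (rule summable_on_subset) auto
      hence "(\<lambda>j. b \<lfloor>\<Sigma> (N * j + i)\<rfloor> powr p) summable_on UNIV"
        using summable_on_reindex[OF inj, of "\<lambda>j. b j powr p"] by (simp add: o_def)
      moreover have "inj (\<lambda>j. N * j + i)" using N by (auto simp: inj_on_def)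
      ultimately show ?thesis
        using summable_on_reindex[of "\<lambda>j. N * j + i" UNIV "\<lambda>k. b \<lfloor>\<Sigma> k\<rfloor> powr p"] by (simp add: o_def)
    qed
    have "(\<lambda>k. b \<lfloor>\<Sigma> k\<rfloor> powr p) summable_on (\<Union>i\<in>{0..<m}. range (\<lambda>j. N * j + int i))" for m :: nat
      by (induction m) (auto simp: atLeast0_lessThan_Suc intro!: summable_on_union class_sum)
    moreover have "(\<Union>i\<in>{0..<N0}. range (\<lambda>j. N * j + int i)) = UNIV"
    proof (rule set_eqI)
      fix k
      have k: "k = N * (k div N) + int (nat (k mod N))" "nat (k mod N) < N0"
        using N by (auto simp: N_def nat_less_iff)
      have "k \<in> range (\<lambda>j. N * j + int (nat (k mod N)))" using k(1) by (rule range_eqI)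
      thus "k \<in> (\<Union>i\<in>{0..<N0}. range (\<lambda>j. N * j + int i)) \<longleftrightarrow> k \<in> UNIV"
        using k(2) by (intro iffI UNIV_I UN_I[of "nat (k mod N)"]) auto
    qed
    ultimately have s: "(\<lambda>k. b \<lfloor>\<Sigma> k\<rfloor> powr p) summable_on UNIV" by metis
    have "(\<lambda>j. cmod (f (\<Sigma> j)) powr p * (\<Sigma> j - \<Sigma> (j - 1))) summable_on UNIV"
    proof (rule summable_on_comparison_test[OF summable_on_cmult_left[OF s, of D]])
      fix j
      show "cmod (f (\<Sigma> j)) powr p * (\<Sigma> j - \<Sigma> (j - 1)) \<le> b \<lfloor>\<Sigma> j\<rfloor> powr p * D"
        using b(1,3) dD(1) dD(2,3)[of j] \<open>p \<ge> 1\<close> by (intro mult_mono powr_mono2) auto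
      show "0 \<le> cmod (f (\<Sigma> j)) powr p * (\<Sigma> j - \<Sigma> (j - 1))"
        using dD(1) dD(2)[of j] by (intro mult_nonneg_nonneg) auto
    qed
    moreover have "0 \<le> cmod (f (\<Sigma> j)) powr p * (\<Sigma> j - \<Sigma> (j - 1))" for j
      using dD(1) dD(2)[of j] by (intro mult_nonneg_nonneg) auto
    ultimately show ?thesis
      unfolding lp_norm_def ennreal_root_finite_iff by (subst infsum_ennreal_finite_iff) auto
  qed
  thus ?thesis using f by (auto simp: Lambda_space_def bounded_measurable_def)
qed

text \<open>In each interval from \<open>j\<close> to \<open>j + 1\<close> choose a point at which \<open>f\<close> is at least half as large as its
  supremum. Neighbouring points can be arbitrarily close, but the points with even index form an
  admissible sequence, and so do those with odd index.\<close>

lemma Lambda_space_lattice_dominated: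
  assumes f: "f \<in> Lambda_space p" and "p \<ge> 1"
  obtains b where "lattice_dominated p b f"
proof -
  obtain B where B: "\<And>x. cmod (f x) \<le> B"
    using f unfolding Lambda_space_def bounded_measurable_def bounded_iff by blast
  have "\<exists>y\<in>{of_int j..of_int j + 1}. \<forall>x\<in>{of_int j..of_int j + 1}. cmod (f x) \<le> 2 * cmod (f y)" for j :: int
  proof -
    define S where "S = (SUP x\<in>{of_int j..of_int j + 1 :: real}. cmod (f x))"
    have bdd: "bdd_above ((\<lambda>x. cmod (f x)) ` {of_int j..of_int j + 1})" by (rule bdd_aboveI2) (rule B)
    have up: "cmod (f x) \<le> S" if "x \<in> {of_int j..of_int j + 1}" for x
      unfolding S_def using that bdd by (rule cSUP_upper)
    show ?thesis
    proof (cases "S \<le> 0")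
      case True
      hence "cmod (f x) \<le> 2 * cmod (f (of_int j))" if "x \<in> {of_int j..of_int j + 1}" for x
        using up[OF that] norm_ge_zero[of "f (of_int j)"] by linarith
      thus ?thesis by (intro bexI[of _ "of_int j"]) auto
    next
      case False
      hence "S / 2 < S" by simp
      then obtain y where y: "y \<in> {of_int j..of_int j + 1}" "S / 2 < cmod (f y)"
        unfolding S_def using bdd by (subst (asm) less_cSUP_iff) auto
      have "cmod (f x) \<le> 2 * cmod (f y)" if "x \<in> {of_int j..of_int j + 1}" for x
        using up[OF that] y(2) by linarith
      thus ?thesis using y(1) by blast
    qed
  qed
  then obtain y where y: "\<And>j. y j \<in> {of_int j..of_int j + 1}"
    and ysup: "\<And>j x. x \<in> {of_int j..of_int j + 1} \<Longrightarrow> cmod (f x) \<le> 2 * cmod (f (y j))" by metis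
  have s: "(\<lambda>j. cmod (f (y (2 * j + i))) powr p) summable_on UNIV" for i
  proof -
    let ?\<Sigma> = "\<lambda>j. y (2 * j + i)"
    have gap: "1 \<le> ?\<Sigma> j - ?\<Sigma> (j - 1)" "?\<Sigma> j - ?\<Sigma> (j - 1) \<le> 3" for j
      using y[of "2 * j + i"] y[of "2 * (j - 1) + i"] by auto
    have "admissible ?\<Sigma>" by (rule admissibleI[of 1 _ 3]) (use gap in auto)
    hence "lp_norm p ?\<Sigma> f < \<infinity>" using f by (auto simp: Lambda_space_def)
    hence "(\<lambda>j. cmod (f (?\<Sigma> j)) powr p * (?\<Sigma> j - ?\<Sigma> (j - 1))) summable_on UNIV"
      unfolding lp_norm_def ennreal_root_finite_iff
      by (subst (asm) infsum_ennreal_finite_iff) (use order_trans[OF zero_le_one gap(1)] in auto)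
    thus ?thesis
    proof (rule summable_on_comparison_test)
      show "cmod (f (?\<Sigma> j)) powr p \<le> cmod (f (?\<Sigma> j)) powr p * (?\<Sigma> j - ?\<Sigma> (j - 1))" for j
        using mult_left_mono[OF gap(1)[of j], of "cmod (f (?\<Sigma> j)) powr p"] by simp
    qed auto
  qed
  have "(\<lambda>k. cmod (f (y k)) powr p) summable_on range (\<lambda>j. 2 * j + i)" for i :: int
    using summable_on_reindex[of "\<lambda>j. 2 * j + i" UNIV "\<lambda>k. cmod (f (y k)) powr p"] s[of i]
    by (simp add: o_def inj_on_def)
  hence "(\<lambda>k. cmod (f (y k)) powr p) summable_on (range (\<lambda>j. 2 * j + 0) \<union> range (\<lambda>j. 2 * j + 1))"
    by (intro summable_on_union)
  moreover have "range (\<lambda>j. 2 * j + 0) \<union> range (\<lambda>j. 2 * j + 1 :: int) = UNIV"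
  proof (rule set_eqI)
    fix k :: int
    show "k \<in> range (\<lambda>j. 2 * j + 0) \<union> range (\<lambda>j. 2 * j + 1) \<longleftrightarrow> k \<in> UNIV"
      by (cases "even k") (auto elim!: evenE oddE)
  qed
  ultimately have sy: "(\<lambda>k. cmod (f (y k)) powr p) summable_on UNIV" by simp
  show ?thesis
  proof (rule that[of "\<lambda>j. 2 * cmod (f (y j))"], unfold lattice_dominated_def, intro conjI allI)
    show "(\<lambda>j. (2 * cmod (f (y j))) powr p) summable_on UNIV"
      using summable_on_cmult_right[OF sy, of "2 powr p"] by (simp add: powr_mult)
    show "cmod (f x) \<le> 2 * cmod (f (y \<lfloor>x\<rfloor>))" for x
      by (rule ysup) (auto intro: less_imp_le)
  qed auto
qed

lemma lattice_dominated_Lp_norm_finite: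
  assumes "lattice_dominated p b f" "p \<ge> 1"
  shows "Lp_norm p f < \<infinity>"
proof -
  have b: "\<And>j. 0 \<le> b j" "(\<lambda>j. b j powr p) summable_on UNIV" "\<And>x. cmod (f x) \<le> b \<lfloor>x\<rfloor>"
    using assms(1) by (auto simp: lattice_dominated_def)
  define c where "c = (\<lambda>j. b j powr p)"
  define g where "g = (\<lambda>(n::nat) x::real. \<Sum>j\<in>{- int n..<int n}. ennreal (c j) * indicator {of_int j..<of_int j + 1} x)"
  have gmono: "g m x \<le> g n x" if "m \<le> n" for m n x
    unfolding g_def by (rule sum_mono2) (use that in auto)
  have "(\<integral>\<^sup>+ x. ennreal (cmod (f x) powr p) \<partial>lborel) \<le> (\<integral>\<^sup>+ x. (SUP n. g n x) \<partial>lborel)"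
  proof (rule nn_integral_mono)
    fix x :: real
    define n where "n = Suc (nat \<bar>\<lfloor>x\<rfloor>\<bar>)"
    have "ennreal (cmod (f x) powr p) \<le> ennreal (c \<lfloor>x\<rfloor>) * indicator {of_int \<lfloor>x\<rfloor>..<of_int \<lfloor>x\<rfloor> + 1} x"
      using b \<open>p \<ge> 1\<close> by (auto simp: c_def indicator_def intro!: ennreal_leI powr_mono2)
    also have "\<dots> \<le> g n x"
      unfolding g_def by (rule member_le_sum) (auto simp: n_def)
    also have "\<dots> \<le> (SUP n. g n x)" by (rule SUP_upper) simp
    finally show "ennreal (cmod (f x) powr p) \<le> (SUP n. g n x)" .
  qed
  also have "\<dots> = (SUP n. \<integral>\<^sup>+ x. g n x \<partial>lborel)"
  proof (rule nn_integral_monotone_convergence_SUP)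
    show "incseq g" by (auto simp: incseq_def le_fun_def gmono)
    show "g n \<in> borel_measurable lborel" for n unfolding g_def by measurable
  qed
  also have "\<dots> \<le> ennreal (infsum c UNIV)"
  proof (rule SUP_least)
    fix n
    have "(\<integral>\<^sup>+ x. g n x \<partial>lborel) = (\<Sum>j\<in>{- int n..<int n}. ennreal (c j))"
      unfolding g_def by (subst nn_integral_sum) (auto simp: nn_integral_cmult_indicator)
    also have "\<dots> = ennreal (sum c {- int n..<int n})" by (simp add: sum_ennreal c_def)
    also have "\<dots> \<le> ennreal (infsum c UNIV)"
      using b(2) by (intro ennreal_leI finite_sum_le_infsum) (auto simp: c_def)
    finally show "(\<integral>\<^sup>+ x. g n x \<partial>lborel) \<le> ennreal (infsum c UNIV)" .
  qed
  also have "\<dots> < \<infinity>" by simp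
  finally show ?thesis unfolding Lp_norm_lborel ennreal_root_finite_iff .
qed

lemma lattice_dominated_add:
  assumes "lattice_dominated p b f" "lattice_dominated p c g" "p \<ge> 1"
  shows "lattice_dominated p (\<lambda>j. b j + c j) (\<lambda>x. f x - g x)"
proof -
  have b: "\<And>j. 0 \<le> b j" "(\<lambda>j. b j powr p) summable_on UNIV" "\<And>x. cmod (f x) \<le> b \<lfloor>x\<rfloor>"
    using assms(1) by (auto simp: lattice_dominated_def)
  have c: "\<And>j. 0 \<le> c j" "(\<lambda>j. c j powr p) summable_on UNIV" "\<And>x. cmod (g x) \<le> c \<lfloor>x\<rfloor>"
    using assms(2) by (auto simp: lattice_dominated_def)
  have "(\<lambda>j. 2 powr p * (b j powr p + c j powr p)) summable_on UNIV"
    by (intro summable_on_cmult_right summable_on_add b c)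
  hence "(\<lambda>j. (b j + c j) powr p) summable_on UNIV"
  proof (rule summable_on_comparison_test)
    show "(b j + c j) powr p \<le> 2 powr p * (b j powr p + c j powr p)" for j
      using sum_powr_le[of "UNIV :: bool set" "\<lambda>i. if i then b j else c j" p] b(1)[of j] c(1)[of j] \<open>p \<ge> 1\<close>
      by (simp add: UNIV_bool add.commute)
  qed auto
  moreover have "cmod (f x - g x) \<le> b \<lfloor>x\<rfloor> + c \<lfloor>x\<rfloor>" for x
    using norm_triangle_ineq4[of "f x" "g x"] b(3)[of x] c(3)[of x] by linarith
  ultimately show ?thesis using b(1) c(1) by (auto simp: lattice_dominated_def)
qed

text \<open>Operators that depend on the function only through its values on a window of bounded length
  preserve domination: the new majorant is a sum of finitely many translates of the old one.\<close>

lemma lattice_dominated_local: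
  assumes "lattice_dominated p b w" "p \<ge> 1" "C \<ge> 0"
    and "\<And>x B. (\<And>t. 0 \<le> t \<Longrightarrow> t \<le> T \<Longrightarrow> cmod (w (x + t)) \<le> B) \<Longrightarrow> cmod (F x) \<le> C * B"
  shows "\<exists>b'. lattice_dominated p b' F"
proof -
  have b: "\<And>j. 0 \<le> b j" "(\<lambda>j. b j powr p) summable_on UNIV" "\<And>x. cmod (w x) \<le> b \<lfloor>x\<rfloor>"
    using assms(1) by (auto simp: lattice_dominated_def)
  define L where "L = nat \<lceil>T\<rceil> + 1"
  define b' where "b' = (\<lambda>j. C * (\<Sum>k\<le>L. b (j + int k)))"
  have "cmod (F x) \<le> b' \<lfloor>x\<rfloor>" for x
    unfolding b'_def
  proof (rule assms(4))
    fix t assume t: "0 \<le> t" "t \<le> T"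
    define k where "k = nat (\<lfloor>x + t\<rfloor> - \<lfloor>x\<rfloor>)"
    have ge: "\<lfloor>x\<rfloor> \<le> \<lfloor>x + t\<rfloor>" using t by (intro floor_mono) simp
    have "t \<le> of_int \<lceil>T\<rceil>" using t by linarith
    hence "\<lfloor>x + t\<rfloor> \<le> \<lfloor>x\<rfloor> + \<lceil>T\<rceil> + 1" by linarith
    hence k: "\<lfloor>x + t\<rfloor> = \<lfloor>x\<rfloor> + int k" "k \<le> L" using ge by (auto simp: k_def L_def)
    have "cmod (w (x + t)) \<le> b (\<lfloor>x\<rfloor> + int k)" using b(3)[of "x + t"] k by simp
    also have "\<dots> \<le> (\<Sum>k\<le>L. b (\<lfloor>x\<rfloor> + int k))"
      using k(2) b(1) by (intro member_le_sum) auto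
    finally show "cmod (w (x + t)) \<le> (\<Sum>k\<le>L. b (\<lfloor>x\<rfloor> + int k))" .
  qed
  moreover have "b' j \<ge> 0" for j unfolding b'_def using b(1) \<open>C \<ge> 0\<close> by (intro mult_nonneg_nonneg sum_nonneg) auto
  moreover have "(\<lambda>j. b' j powr p) summable_on UNIV"
  proof (rule summable_on_comparison_test)
    have shift: "(\<lambda>j. b (j + int k) powr p) summable_on UNIV" for k
      using summable_on_reindex_bij_betw[of "\<lambda>j. j + int k" UNIV UNIV "\<lambda>j. b j powr p"] b(2)
      by (simp add: bij_plus_right)
    have "(\<lambda>j. \<Sum>k\<in>{..m}. b (j + int k) powr p) summable_on UNIV" for m
    proof (induction m)
      case (Suc m)
      show ?case unfolding sum.atMost_Suc by (intro summable_on_add Suc shift)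
    qed (use b(2) in simp)
    thus "(\<lambda>j. C powr p * (real (Suc L) powr p * (\<Sum>k\<in>{..L}. b (j + int k) powr p))) summable_on UNIV"
      by (intro summable_on_cmult_right)
    show "b' j powr p \<le> C powr p * (real (Suc L) powr p * (\<Sum>k\<in>{..L}. b (j + int k) powr p))" for j
    proof -
      have "b' j powr p = C powr p * (\<Sum>k\<le>L. b (j + int k)) powr p"
        unfolding b'_def using b(1) \<open>C \<ge> 0\<close> by (intro powr_mult)
      also have "\<dots> \<le> C powr p * (real (Suc L) powr p * (\<Sum>k\<in>{..L}. b (j + int k) powr p))"
        using sum_powr_le[of "{..L}" "\<lambda>k. b (j + int k)" p] b(1) \<open>p \<ge> 1\<close> by (intro mult_left_mono) auto
      finally show ?thesis .
    qed
  qed auto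
  ultimately show ?thesis unfolding lattice_dominated_def by blast
qed

section \<open>Steklov averages and moduli of smoothness\<close>

lemma Lambda_space_representative:
  assumes f: "f \<in> Lambda_space p" and "p \<ge> 1"
  obtains w b where "bounded_borel w" "AE x in lborel. f x = w x" "lattice_dominated p b f" "lattice_dominated p b w"
proof -
  have meas: "f \<in> borel_measurable lebesgue" and "bounded (range f)"
    using f by (auto simp: Lambda_space_def bounded_measurable_def)
  then obtain B where B: "\<And>x. cmod (f x) \<le> B" unfolding bounded_iff by blast
  obtain b where b: "lattice_dominated p b f" by (rule Lambda_space_lattice_dominated[OF assms]) (rule that)
  have fb: "cmod (f x) \<le> min B (b \<lfloor>x\<rfloor>)" for x using B[of x] b by (auto simp: lattice_dominated_def)
  have bm: "(\<lambda>x::real. min B (b \<lfloor>x\<rfloor>)) \<in> borel_measurable borel" by measurable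
  obtain w where w: "bounded_borel w" "AE x in lborel. f x = w x" "\<And>x. cmod (w x) \<le> min B (b \<lfloor>x\<rfloor>)"
    by (rule lebesgue_measurable_AE_eq_borel[OF meas fb bm min.cobounded1]) (rule that)
  have "lattice_dominated p b w" using b w(3) by (auto simp: lattice_dominated_def)
  thus ?thesis using that[OF w(1,2) b] by blast
qed

text \<open>The weight of the cube integral with step \<open>m \<delta> / r\<close> in the Steklov average. The last factor is the
  Jacobian of the dilation by \<open>m/r\<close>.\<close>

definition steklov_coeff :: "real \<Rightarrow> nat \<Rightarrow> nat \<Rightarrow> complex" where
  "steklov_coeff \<delta> r m = of_real (inverse ((- \<delta>) ^ r)) *
     ((-1) ^ (r - m + 1) * of_nat (r choose m)) * of_real ((real r / real m) ^ r)"

lemma Steklov_cong_AE: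
  assumes "r \<ge> 1" "AE x in lborel. f x = w x" "f \<in> borel_measurable lebesgue" "w \<in> borel_measurable lebesgue"
  shows "Steklov \<delta> r f = Steklov \<delta> r w"
proof
  fix x
  let ?\<Phi> = "\<lambda>f u. \<Sum>m = 1..r. (- 1) ^ (r - m + 1) * of_nat (r choose m) * f (x + real m / real r * u) :: complex"
  obtain n where n: "r = Suc n" using \<open>r \<ge> 1\<close> by (cases r) auto
  have c: "real m / real r \<noteq> 0" if "m \<in> {1..r}" for m using that by auto
  have "AE u in lborel. \<forall>m\<in>{1..r}. f (x + real m / real r * u) = w (x + real m / real r * u)"
    by (intro AE_finite_allI AE_lborel_affine[OF assms(2)] c) auto
  hence "AE u in lborel. ?\<Phi> f u = ?\<Phi> w u"
    by eventually_elim (intro sum.cong, auto)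
  moreover have "?\<Phi> g \<in> borel_measurable lebesgue" if "g \<in> borel_measurable lebesgue" for g
    by (intro borel_measurable_sum borel_measurable_times borel_measurable_const borel_measurable_lebesgue_affine that c)
  ultimately have "cube_integral (Suc n) \<delta> (?\<Phi> f) = cube_integral (Suc n) \<delta> (?\<Phi> w)"
    using assms(3,4) by (intro cube_integral_cong_AE) auto
  thus "Steklov \<delta> r f x = Steklov \<delta> r w x" by (simp only: Steklov_def n)
qed

lemma cube_integral_combination_Steklov:
  assumes "bounded_borel w" "\<delta> > 0"
  shows "cube_integral_combination {1..r} (\<lambda>m. real m / real r * \<delta>) w"
  by unfold_locales (use assms in auto)

lemma Steklov_eq_comb:
  assumes w: "bounded_borel w" and "\<delta> > 0"
  shows "Steklov \<delta> r w = cube_integral_combination.comb {1..r} (steklov_coeff \<delta> r) (\<lambda>m. real m / real r * \<delta>) w r 0"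
proof
  fix x
  interpret cube_integral_combination "{1..r}" "steklov_coeff \<delta> r" "\<lambda>m. real m / real r * \<delta>" w
    by (rule cube_integral_combination_Steklov[OF assms])
  let ?k = "\<lambda>m. (- 1) ^ (r - m + 1) * of_nat (r choose m) :: complex"
  have "cube_integral r \<delta> (\<lambda>u. \<Sum>m = 1..r. ?k m * w (x + real m / real r * u)) 0 =
     (\<Sum>m = 1..r. cube_integral r \<delta> (\<lambda>u. ?k m * w (x + real m / real r * u)) 0)"
    by (intro cube_integral_sum bounded_borel_cmult bounded_borel_affine w)
  also have "\<dots> = (\<Sum>m = 1..r. ?k m * (of_real ((real r / real m) ^ r) * cube_integral r (real m / real r * \<delta>) w x))"
  proof (rule sum.cong[OF refl])
    fix m assume "m \<in> {1..r}"
    hence "real m / real r > 0" by auto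
    from cube_integral_scale[OF w this, of r \<delta> x 0]
    show "cube_integral r \<delta> (\<lambda>u. ?k m * w (x + real m / real r * u)) 0 =
      ?k m * (of_real ((real r / real m) ^ r) * cube_integral r (real m / real r * \<delta>) w x)"
      unfolding cube_integral_cmult by simp
  qed
  finally show "Steklov \<delta> r w x = comb r 0 x"
    unfolding Steklov_def comb_def steklov_coeff_def
    by (simp only: sum_distrib_left mult.assoc fwd_diff_0)
qed

text \<open>The Steklov average omits the term \<open>m = 0\<close> of the difference of order \<open>r\<close>, and this term is
  \<open>w x\<close> up to sign. The error is thus an average of differences with steps between \<open>0\<close> and \<open>\<delta>\<close>.\<close>

lemma Steklov_diff_eq:
  assumes w: "bounded_borel w" and "\<delta> > 0"
  shows "Steklov \<delta> r w x - w x =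
    - (of_real (inverse ((- \<delta>) ^ r)) * cube_integral r \<delta> (\<lambda>u. fwd_diff r (u / real r) w x) 0)"
proof -
  have e: "(\<Sum>m = 1..r. (- 1) ^ (r - m + 1) * of_nat (r choose m) * w (x + real m / real r * u)) =
      (-1) ^ r * w x - fwd_diff r (u / real r) w x" for u
    unfolding fwd_diff_def
    by (subst sum.atLeast_Suc_atMost) (simp_all add: sum_negf mult_ac)
  have bb: "bounded_borel (\<lambda>u. fwd_diff r (u / real r) w x)"
    unfolding fwd_diff_def
    using bounded_borel_affine[OF w, of x "real k / real r" for k]
    by (intro bounded_borel_sum bounded_borel_cmult) simp
  have "Steklov \<delta> r w x = of_real (inverse ((- \<delta>) ^ r)) * (of_real (\<delta> ^ r) * ((-1) ^ r * w x)
      - cube_integral r \<delta> (\<lambda>u. fwd_diff r (u / real r) w x) 0)"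
    unfolding Steklov_def e cube_integral_diff[OF bounded_borel_const bb]
    using \<open>\<delta> > 0\<close> by (simp only: cube_integral_const less_imp_le)
  also have "\<dots> = w x - of_real (inverse ((- \<delta>) ^ r)) * cube_integral r \<delta> (\<lambda>u. fwd_diff r (u / real r) w x) 0"
  proof -
    have "of_real (inverse ((- \<delta>) ^ r)) * (of_real (\<delta> ^ r) * ((-1) ^ r :: complex)) = of_real (inverse ((- \<delta>) ^ r) * (\<delta> ^ r * (-1) ^ r))"
      by simp
    also have "inverse ((- \<delta>) ^ r) * (\<delta> ^ r * (-1) ^ r) = 1"
      using \<open>\<delta> > 0\<close> by (simp add: power_minus[of \<delta>] mult_ac)
    finally show ?thesis by (simp add: right_diff_distrib flip: mult.assoc)
  qed
  finally show ?thesis by simp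
qed

lemma fwd_diff_step_0: "r \<ge> 1 \<Longrightarrow> fwd_diff r 0 f x = 0"
  by (cases r) (simp_all add: fwd_diff_Suc)

lemma norm_fwd_diff_le:
  assumes "\<And>x. cmod (w x) \<le> B"
  shows "cmod (fwd_diff n h w x) \<le> 2 ^ n * B"
proof (induction n arbitrary: x)
  case (Suc n)
  show ?case
    using norm_triangle_ineq4[of "fwd_diff n h w (x + h)" "fwd_diff n h w x"] Suc[of x] Suc[of "x + h"]
    by (simp add: fwd_diff_Suc)
qed (use assms in simp)

lemma Lp_norm_fwd_diff_le_modulus:
  assumes "0 < h" "h \<le> \<delta>"
  shows "Lp_norm p (fwd_diff s h f) \<le> modulus_smoothness s p f \<delta>"
  unfolding modulus_smoothness_def by (rule SUP_upper) (use assms in auto)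

lemma Lp_norm_Steklov_diff_le:
  assumes w: "bounded_borel w" and "\<delta> > 0" "p \<ge> 1" "r \<ge> 1" "M \<ge> 0"
    and M: "\<And>h. 0 < h \<Longrightarrow> h \<le> \<delta> \<Longrightarrow> Lp_norm p (fwd_diff r h w) \<le> ennreal M"
  shows "Lp_norm p (\<lambda>x. Steklov \<delta> r w x - w x) \<le> ennreal M"
proof -
  let ?\<Psi> = "\<lambda>x u. fwd_diff r (u / real r) w x"
  obtain B where B: "B \<ge> 0" "\<And>x. cmod (w x) \<le> B" by (rule bounded_borelE[OF w]) (rule that)
  have [measurable]: "w \<in> borel_measurable borel" by (rule bounded_borel_measurable[OF w])
  have "Lp_norm p (\<lambda>x. cube_integral r \<delta> (?\<Psi> x) 0) \<le> ennreal (\<delta> ^ r * M)"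
  proof (rule Lp_norm_cube_integral_family_le[where N = r])
    show "(\<lambda>(x, u). ?\<Psi> x u) \<in> borel_measurable (borel \<Otimes>\<^sub>M borel)"
      unfolding fwd_diff_def by measurable
    show "cmod (?\<Psi> x u) \<le> 2 ^ r * B" for x u by (rule norm_fwd_diff_le) (rule B)
    show "Lp_norm p (\<lambda>x. ?\<Psi> x u) \<le> ennreal M" if "0 \<le> u" "u \<le> real r * \<delta>" for u
    proof (cases "u = 0")
      case True
      hence "Lp_norm p (\<lambda>x. ?\<Psi> x u) = Lp_norm p (\<lambda>x. 0)" using \<open>r \<ge> 1\<close> by (simp add: fwd_diff_step_0)
      also have "\<dots> \<le> ennreal M" using \<open>p \<ge> 1\<close> \<open>M \<ge> 0\<close> by (subst Lp_norm_le_iff) auto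
      finally show ?thesis .
    next
      case False
      thus ?thesis using that \<open>r \<ge> 1\<close> M[of "u / real r"] by (simp add: field_simps)
    qed
  qed (use assms in auto)
  hence le: "Lp_norm p (\<lambda>x. cube_integral r \<delta> (?\<Psi> x) 0) \<le> ennreal (\<delta> ^ r * M)" .
  have meas: "(\<lambda>x. cube_integral r \<delta> (?\<Psi> x) 0) \<in> borel_measurable lebesgue"
  proof -
    have "(\<lambda>x. cube_integral r \<delta> (?\<Psi> x) 0) = (\<lambda>x. of_real ((- \<delta>) ^ r) * (w x - Steklov \<delta> r w x))"
    proof
      fix x
      have "w x - Steklov \<delta> r w x = of_real (inverse ((- \<delta>) ^ r)) * cube_integral r \<delta> (?\<Psi> x) 0"
        using Steklov_diff_eq[OF w \<open>\<delta> > 0\<close>, of r x] by (metis minus_diff_eq minus_minus)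
      thus "cube_integral r \<delta> (?\<Psi> x) 0 = of_real ((- \<delta>) ^ r) * (w x - Steklov \<delta> r w x)"
        using \<open>\<delta> > 0\<close> by (simp flip: mult.assoc of_real_mult)
    qed
    moreover have "Steklov \<delta> r w \<in> borel_measurable lebesgue"
      unfolding Steklov_eq_comb[OF w \<open>\<delta> > 0\<close>]
      by (rule bounded_borel_lebesgue[OF cube_integral_combination.comb_bounded_borel[OF cube_integral_combination_Steklov[OF w \<open>\<delta> > 0\<close>]]])
    ultimately show ?thesis using bounded_borel_lebesgue[OF w] by simp
  qed
  have "Lp_norm p (\<lambda>x. Steklov \<delta> r w x - w x) =
      Lp_norm p (\<lambda>x. (- of_real (inverse ((- \<delta>) ^ r))) * cube_integral r \<delta> (?\<Psi> x) 0)"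
    unfolding Steklov_diff_eq[OF w \<open>\<delta> > 0\<close>] by simp
  also have "\<dots> \<le> ennreal (cmod (- of_real (inverse ((- \<delta>) ^ r)))) * Lp_norm p (\<lambda>x. cube_integral r \<delta> (?\<Psi> x) 0)"
    using \<open>p \<ge> 1\<close> by (intro Lp_norm_cmult_le meas) auto
  also have "cmod (- of_real (inverse ((- \<delta>) ^ r))) = inverse (\<delta> ^ r)"
    using \<open>\<delta> > 0\<close> by (simp add: norm_inverse norm_power)
  also have "ennreal (inverse (\<delta> ^ r)) * Lp_norm p (\<lambda>x. cube_integral r \<delta> (?\<Psi> x) 0) \<le> ennreal (inverse (\<delta> ^ r)) * ennreal (\<delta> ^ r * M)"
    by (intro mult_left_mono le) auto
  also have "\<dots> = ennreal M" using \<open>\<delta> > 0\<close> \<open>M \<ge> 0\<close> by (simp add: ennreal_mult'[symmetric])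
  finally show ?thesis .
qed

lemma steklov_coeff_sum_le:
  assumes "\<delta> > 0" "s \<le> r"
  shows "(\<Sum>m\<in>{1..r}. cmod (steklov_coeff \<delta> r m) * (real m / real r * \<delta>) ^ (r - s)) \<le> (2 * real r) ^ r / \<delta> ^ s"
proof -
  have "cmod (steklov_coeff \<delta> r m) * (real m / real r * \<delta>) ^ (r - s) \<le> real (r choose m) * (real r ^ r / \<delta> ^ s)"
    if m: "m \<in> {1..r}" for m
  proof -
    have "(real r / real m) ^ r \<le> real r ^ r"
      using m by (intro power_mono) (auto simp: field_simps)
    hence 1: "cmod (steklov_coeff \<delta> r m) \<le> inverse (\<delta> ^ r) * (real (r choose m) * real r ^ r)"
      using \<open>\<delta> > 0\<close> by (simp add: steklov_coeff_def norm_mult norm_power norm_inverse norm_divide mult_left_mono mult.assoc)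
    have "real m / real r * \<delta> \<le> 1 * \<delta>" using m \<open>\<delta> > 0\<close> by (intro mult_right_mono) auto
    hence 2: "(real m / real r * \<delta>) ^ (r - s) \<le> \<delta> ^ (r - s)" using \<open>\<delta> > 0\<close> by (intro power_mono) auto
    have "cmod (steklov_coeff \<delta> r m) * (real m / real r * \<delta>) ^ (r - s) \<le>
        inverse (\<delta> ^ r) * (real (r choose m) * real r ^ r) * \<delta> ^ (r - s)"
      using \<open>\<delta> > 0\<close> by (intro mult_mono 1 2) auto
    also have "\<dots> = real (r choose m) * (real r ^ r / \<delta> ^ s)"
    proof -
      have "\<delta> ^ r = \<delta> ^ s * \<delta> ^ (r - s)" using \<open>s \<le> r\<close> by (simp flip: power_add)
      thus ?thesis using \<open>\<delta> > 0\<close> by (simp add: field_simps)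
    qed
    finally show ?thesis .
  qed
  hence "(\<Sum>m\<in>{1..r}. cmod (steklov_coeff \<delta> r m) * (real m / real r * \<delta>) ^ (r - s)) \<le>
      (\<Sum>m\<in>{1..r}. real (r choose m) * (real r ^ r / \<delta> ^ s))" by (rule sum_mono)
  also have "\<dots> \<le> (\<Sum>m\<le>r. real (r choose m) * (real r ^ r / \<delta> ^ s))"
    using \<open>\<delta> > 0\<close> by (intro sum_mono2) auto
  also have "\<dots> = real (\<Sum>m\<le>r. r choose m) * (real r ^ r / \<delta> ^ s)"
    unfolding of_nat_sum sum_distrib_right ..
  also have "\<dots> = (2 * real r) ^ r / \<delta> ^ s" by (simp add: choose_row_sum power_mult_distrib)
  finally show ?thesis .
qed

text \<open>A difference with step \<open>n h\<close> telescopes into \<open>n\<close> translated differences with step \<open>h\<close>.\<close>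

lemma Lp_norm_fwd_diff_multiple_step_le:
  assumes "p \<ge> 1" "f \<in> borel_measurable lebesgue"
  shows "Lp_norm p (fwd_diff s (real n * h) f) \<le> of_nat n ^ s * Lp_norm p (fwd_diff s h f)"
  using assms(2)
proof (induction s arbitrary: f)
  case (Suc s)
  let ?g = "\<lambda>x. f (x + real n * h) - f x"
  have tele: "u (x + real n * h) - u x = (\<Sum>i<n. u (x + real i * h + h) - u (x + real i * h))" for u :: "real \<Rightarrow> complex" and x
    by (induction n) (simp_all add: algebra_simps)
  have "fwd_diff s h ?g = (\<lambda>x. \<Sum>i<n. fwd_diff (Suc s) h f (x + real i * h))"
    unfolding fwd_diff_Suc fwd_diff_diff fwd_diff_shift
    by (rule ext) (simp only: fwd_diff_diff fwd_diff_shift tele[of "fwd_diff s h f"])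
  hence "Lp_norm p (fwd_diff s h ?g) \<le> (\<Sum>i<n. Lp_norm p (\<lambda>x. fwd_diff (Suc s) h f (x + real i * h)))"
    using Lp_norm_sum_le[OF \<open>p \<ge> 1\<close>, of "{..<n}" "\<lambda>i x. fwd_diff (Suc s) h f (x + real i * h)"]
      borel_measurable_lebesgue_shift[OF borel_measurable_lebesgue_fwd_diff[OF Suc.prems]]
    by simp
  also have "\<dots> = of_nat n * Lp_norm p (fwd_diff (Suc s) h f)"
    by (simp add: Lp_norm_shift borel_measurable_lebesgue_fwd_diff[OF Suc.prems])
  finally have "of_nat n ^ s * Lp_norm p (fwd_diff s h ?g) \<le> of_nat n ^ s * (of_nat n * Lp_norm p (fwd_diff (Suc s) h f))"
    by (rule mult_left_mono) simp
  moreover have "Lp_norm p (fwd_diff (Suc s) (real n * h) f) \<le> of_nat n ^ s * Lp_norm p (fwd_diff s h ?g)"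
    unfolding fwd_diff_Suc'
    by (intro Suc.IH borel_measurable_diff borel_measurable_lebesgue_shift Suc.prems)
  ultimately show ?case by (simp add: mult_ac)
qed simp

lemma modulus_smoothness_finite:
  assumes "p \<ge> 1" "f \<in> borel_measurable lebesgue" "Lp_norm p f < \<infinity>"
  shows "modulus_smoothness s p f \<delta> < \<infinity>"
proof -
  have "modulus_smoothness s p f \<delta> \<le> 2 ^ s * Lp_norm p f"
    unfolding modulus_smoothness_def by (intro SUP_least Lp_norm_fwd_diff_le assms)
  also have "\<dots> < \<infinity>" using assms(3) by (simp add: ennreal_mult_less_top power_less_top_ennreal)
  finally show ?thesis .
qed

lemma modulus_smoothness_order_le:
  assumes "p \<ge> 1" "f \<in> borel_measurable lebesgue" "s \<le> r"
  shows "modulus_smoothness r p f \<delta> \<le> 2 ^ (r - s) * modulus_smoothness s p f \<delta>"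
  unfolding modulus_smoothness_def[of r]
proof (rule SUP_least)
  fix h assume h: "h \<in> {0<..\<delta>}"
  have "Lp_norm p (fwd_diff r h f) \<le> 2 ^ (r - s) * Lp_norm p (fwd_diff s h f)"
    using Lp_norm_fwd_diff_add_le[OF assms(1,2), of "r - s" s h] \<open>s \<le> r\<close> by simp
  also have "\<dots> \<le> 2 ^ (r - s) * modulus_smoothness s p f \<delta>"
    using h by (intro mult_left_mono Lp_norm_fwd_diff_le_modulus) auto
  finally show "Lp_norm p (fwd_diff r h f) \<le> 2 ^ (r - s) * modulus_smoothness s p f \<delta>" .
qed

section \<open>Comparison of the approximation error with the semi-discrete modulus\<close>

lemma sampling_operator_diff:
  assumes "sampling_operator p \<xi> \<phi> T" "u \<in> Lambda_space p" "v \<in> Lambda_space p"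
    "(\<lambda>x. u x - v x) \<in> Lambda_space p"
  shows "T (\<lambda>x. u x - v x) x = T u x - T v x"
proof -
  have conv: "(\<lambda>n. \<Sum>k=-int n..int n. g (\<xi> k) * \<phi> k x) \<longlonglongrightarrow> T g x" if "g \<in> Lambda_space p" for g
    using assms(1) that by (auto simp: sampling_operator_def)
  have "(\<lambda>n. (\<Sum>k=-int n..int n. u (\<xi> k) * \<phi> k x) - (\<Sum>k=-int n..int n. v (\<xi> k) * \<phi> k x)) \<longlonglongrightarrow> T u x - T v x"
    by (intro tendsto_diff conv assms)
  moreover have "(\<lambda>n. (\<Sum>k=-int n..int n. u (\<xi> k) * \<phi> k x) - (\<Sum>k=-int n..int n. v (\<xi> k) * \<phi> k x)) \<longlonglongrightarrow> T (\<lambda>x. u x - v x) x"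
    using conv[OF assms(4)] by (simp add: sum_subtractf left_diff_distrib)
  ultimately show ?thesis by (rule LIMSEQ_unique[symmetric])
qed

lemma Lambda_space_lebesgue:
  "f \<in> Lambda_space p \<Longrightarrow> f \<in> borel_measurable lebesgue" "f \<in> Lambda_space p \<Longrightarrow> bounded (range f)"
  by (auto simp: Lambda_space_def bounded_measurable_def)

lemma Lambda_space_Lp_norm_finite:
  assumes "f \<in> Lambda_space p" "p \<ge> 1"
  shows "Lp_norm p f < \<infinity>"
  by (rule Lambda_space_lattice_dominated[OF assms]) (rule lattice_dominated_Lp_norm_finite[OF _ assms(2)])

lemma Lambda_space_diff:
  assumes "f \<in> Lambda_space p" "g \<in> Lambda_space p" "p \<ge> 1"
  shows "(\<lambda>x. f x - g x) \<in> Lambda_space p"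
proof -
  obtain b where b: "lattice_dominated p b f" by (rule Lambda_space_lattice_dominated[OF assms(1,3)]) (rule that)
  obtain c where c: "lattice_dominated p c g" by (rule Lambda_space_lattice_dominated[OF assms(2,3)]) (rule that)
  show ?thesis
  proof (rule lattice_dominated_Lambda_space)
    show "(\<lambda>x. f x - g x) \<in> borel_measurable lebesgue"
      by (intro borel_measurable_diff Lambda_space_lebesgue(1)[OF assms(1)] Lambda_space_lebesgue(1)[OF assms(2)])
    show "bounded (range (\<lambda>x. f x - g x))"
      by (intro bounded_minus_comp Lambda_space_lebesgue(2)[OF assms(1)] Lambda_space_lebesgue(2)[OF assms(2)])
    show "lattice_dominated p (\<lambda>j. b j + c j) (\<lambda>x. f x - g x)" by (rule lattice_dominated_add[OF b c assms(3)])
  qed fact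
qed

text \<open>The properties of the Steklov average as an intermediate approximation: its error and
  \<open>\<delta>\<^sup>s\<close> times its derivative of order \<open>s\<close> are both controlled by the modulus of smoothness.\<close>

lemma Steklov_approximation:
  assumes f: "f \<in> Lambda_space p" and "p \<ge> 1" "1 \<le> s" "s \<le> r" "\<delta> > 0"
  shows "Steklov \<delta> r f \<in> Lambda_space p"
    and "Steklov \<delta> r f \<in> Sobolev_space s p"
    and "Lp_norm p (\<lambda>x. Steklov \<delta> r f x - f x) \<le> 2 ^ (r - s) * modulus_smoothness s p f \<delta>"
    and "Lp_norm p (nth_deriv s (Steklov \<delta> r f)) \<le> ennreal ((2 * real r) ^ r / \<delta> ^ s) * modulus_smoothness s p f \<delta>"
proof -
  obtain w b where rep: "bounded_borel w" "AE x in lborel. f x = w x" "lattice_dominated p b f" "lattice_dominated p b w"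
    by (rule Lambda_space_representative[OF f \<open>p \<ge> 1\<close>]) (rule that)
  note fm = Lambda_space_lebesgue(1)[OF f] and wm = bounded_borel_lebesgue[OF rep(1)]
  have r: "r \<ge> 1" using assms by simp
  interpret cube_integral_combination "{1..r}" "steklov_coeff \<delta> r" "\<lambda>m. real m / real r * \<delta>" w
    by (rule cube_integral_combination_Steklov[OF rep(1) \<open>\<delta> > 0\<close>])
  have F: "Steklov \<delta> r f = comb r 0"
    unfolding Steklov_cong_AE[OF r rep(2) fm wm] by (rule Steklov_eq_comb[OF rep(1) \<open>\<delta> > 0\<close>])
  have wfin: "Lp_norm p w < \<infinity>" by (rule lattice_dominated_Lp_norm_finite[OF rep(4) \<open>p \<ge> 1\<close>])
  have fd: "Lp_norm p (fwd_diff k h f) = Lp_norm p (fwd_diff k h w)" for k h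
  proof (rule Lp_norm_cong_AE)
    have "AE x in lborel. \<forall>i\<in>{0..k}. f (real i * h + 1 * x) = w (real i * h + 1 * x)"
      by (intro AE_finite_allI AE_lborel_affine[OF rep(2)]) auto
    hence "AE x in lborel. fwd_diff k h f x = fwd_diff k h w x"
      unfolding fwd_diff_def by eventually_elim (intro sum.cong, auto simp: add.commute)
    thus "AE x in lebesgue. fwd_diff k h f x = fwd_diff k h w x" by (simp add: AE_completion_iff)
  qed
  have ffin: "Lp_norm p f < \<infinity>" by (rule Lambda_space_Lp_norm_finite[OF f \<open>p \<ge> 1\<close>])
  have "modulus_smoothness s p f \<delta> < \<infinity>" by (rule modulus_smoothness_finite[OF \<open>p \<ge> 1\<close> fm ffin])
  then obtain m where m: "modulus_smoothness s p f \<delta> = ennreal m" "m \<ge> 0"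
    by (cases "modulus_smoothness s p f \<delta>") auto
  have ws: "Lp_norm p (fwd_diff s h w) \<le> ennreal m" if "0 < h" "h \<le> \<delta>" for h
    using Lp_norm_fwd_diff_le_modulus[OF that, of p s f] by (simp add: fd m)
  have a_le: "real i / real r * \<delta> \<le> \<delta>" "real i / real r * \<delta> > 0" if "i \<in> {1..r}" for i
    using that \<open>\<delta> > 0\<close> mult_right_mono[of "real i / real r" 1 \<delta>] by auto
  show "Steklov \<delta> r f \<in> Sobolev_space s p"
    unfolding F by (rule comb_Sobolev[OF \<open>s \<le> r\<close> \<open>p \<ge> 1\<close> wfin])
  show "Lp_norm p (nth_deriv s (Steklov \<delta> r f)) \<le> ennreal ((2 * real r) ^ r / \<delta> ^ s) * modulus_smoothness s p f \<delta>"
  proof -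
    have "Lp_norm p (nth_deriv s (Steklov \<delta> r f)) \<le>
        ennreal ((\<Sum>i\<in>{1..r}. cmod (steklov_coeff \<delta> r i) * (real i / real r * \<delta>) ^ (r - s)) * m)"
      unfolding F nth_deriv_comb_Lp_norm[OF \<open>s \<le> r\<close>]
      by (rule comb_Lp_norm_le[OF \<open>p \<ge> 1\<close> _ m(2)]) (intro ws a_le)
    also have "\<dots> \<le> ennreal ((2 * real r) ^ r / \<delta> ^ s * m)"
      by (intro ennreal_leI mult_right_mono steklov_coeff_sum_le assms m)
    also have "\<dots> = ennreal ((2 * real r) ^ r / \<delta> ^ s) * modulus_smoothness s p f \<delta>"
      unfolding m(1) using \<open>\<delta> > 0\<close> by (intro ennreal_mult') simp
    finally show ?thesis .
  qed
  show "Lp_norm p (\<lambda>x. Steklov \<delta> r f x - f x) \<le> 2 ^ (r - s) * modulus_smoothness s p f \<delta>"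
  proof -
    have "Lp_norm p (\<lambda>x. Steklov \<delta> r f x - f x) = Lp_norm p (\<lambda>x. Steklov \<delta> r w x - w x)"
      unfolding Steklov_cong_AE[OF r rep(2) fm wm]
      by (rule Lp_norm_cong_AE) (use rep(2) in \<open>auto simp: AE_completion_iff elim: eventually_mono\<close>)
    also have "\<dots> \<le> ennreal (2 ^ (r - s) * m)"
    proof (rule Lp_norm_Steklov_diff_le[OF rep(1) \<open>\<delta> > 0\<close> \<open>p \<ge> 1\<close> r])
      fix h assume h: "0 < h" "h \<le> \<delta>"
      have "Lp_norm p (fwd_diff r h w) \<le> modulus_smoothness r p f \<delta>"
        using Lp_norm_fwd_diff_le_modulus[OF h, of p r f] by (simp add: fd)
      also have "\<dots> \<le> 2 ^ (r - s) * modulus_smoothness s p f \<delta>"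
        by (rule modulus_smoothness_order_le[OF \<open>p \<ge> 1\<close> fm \<open>s \<le> r\<close>])
      also have "\<dots> = ennreal (2 ^ (r - s) * m)"
        using m by (simp add: ennreal_mult' ennreal_power[symmetric])
      finally show "Lp_norm p (fwd_diff r h w) \<le> ennreal (2 ^ (r - s) * m)" .
    qed (use m in auto)
    also have "\<dots> = 2 ^ (r - s) * modulus_smoothness s p f \<delta>"
      using m by (simp add: ennreal_mult' ennreal_power[symmetric])
    finally show ?thesis .
  qed
  show "Steklov \<delta> r f \<in> Lambda_space p"
  proof -
    have "\<exists>b'. lattice_dominated p b' (comb r 0)"
    proof (rule lattice_dominated_local[OF rep(4) \<open>p \<ge> 1\<close>, where T = "real r * \<delta>"
          and C = "\<Sum>i\<in>{1..r}. cmod (steklov_coeff \<delta> r i) * (real i / real r * \<delta>) ^ r"])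
      show "0 \<le> (\<Sum>i\<in>{1..r}. cmod (steklov_coeff \<delta> r i) * (real i / real r * \<delta>) ^ r)"
        using \<open>\<delta> > 0\<close> by (intro sum_nonneg mult_nonneg_nonneg) auto
      fix x B assume B: "\<And>t. 0 \<le> t \<Longrightarrow> t \<le> real r * \<delta> \<Longrightarrow> cmod (w (x + t)) \<le> B"
      have "cmod (comb r 0 x) \<le> (\<Sum>i\<in>{1..r}. cmod (steklov_coeff \<delta> r i) * (B * (real i / real r * \<delta>) ^ r))"
        unfolding comb_def fwd_diff_0
      proof (rule sum_norm_le)
        fix i assume i: "i \<in> {1..r}"
        have "cmod (cube_integral r (real i / real r * \<delta>) w x) \<le> B * (real i / real r * \<delta>) ^ r"
        proof (rule norm_cube_integral_le[OF rep(1) less_imp_le[OF a_le(2)[OF i]]])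
          fix t assume "0 \<le> t" "t \<le> real r * (real i / real r * \<delta>)"
          moreover have "real r * (real i / real r * \<delta>) \<le> real r * \<delta>"
            by (rule mult_left_mono[OF a_le(1)[OF i]]) simp
          ultimately show "cmod (w (x + t)) \<le> B" by (intro B) auto
        qed
        thus "cmod (steklov_coeff \<delta> r i * cube_integral r (real i / real r * \<delta>) w x) \<le>
            cmod (steklov_coeff \<delta> r i) * (B * (real i / real r * \<delta>) ^ r)"
          unfolding norm_mult by (rule mult_left_mono) simp
      qed
      also have "\<dots> = (\<Sum>i\<in>{1..r}. cmod (steklov_coeff \<delta> r i) * (real i / real r * \<delta>) ^ r) * B"
        unfolding sum_distrib_right by (intro sum.cong) (simp_all only: mult_ac)
      finally show "cmod (comb r 0 x) \<le> (\<Sum>i\<in>{1..r}. cmod (steklov_coeff \<delta> r i) * (real i / real r * \<delta>) ^ r) * B" .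
    qed
    then obtain b' where b': "lattice_dominated p b' (comb r 0)" by blast
    show ?thesis unfolding F
      by (rule lattice_dominated_Lambda_space[OF bounded_borel_lebesgue[OF comb_bounded_borel] _ b' \<open>p \<ge> 1\<close>])
         (use comb_bounded_borel[of r 0] in \<open>simp add: bounded_borel_def\<close>)
  qed
qed

text \<open>A function that is well approximated by functions of type \<open>W\<close> has a small difference of order
  \<open>s + 1\<close> at steps \<open>1 / (n W)\<close>, because for the approximant such a difference gains \<open>n\<^sup>-\<^sup>s\<^sup>-\<^sup>1\<close>. Passing
  from step \<open>1 / W\<close> to \<open>1 / (n W)\<close> costs only \<open>n\<^sup>s\<close> in the modulus of order \<open>s\<close>, and the hypothesis on
  \<open>f\<close> bounds that modulus by the one of order \<open>s + 1\<close>. For large \<open>n\<close> the surplus factor \<open>1/n\<close> beats the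
  constants, and the modulus on the right is absorbed.\<close>

lemma modulus_smoothness_inverse_estimate:
  assumes "p \<ge> 1" and f: "f \<in> borel_measurable lebesgue" "Lp_norm p f < \<infinity>" and "K > 0"
    and K: "\<And>h. h > 0 \<Longrightarrow> modulus_smoothness s p f h \<le> ennreal K * modulus_smoothness (s + 1) p f h"
  obtains C where "C > 0" "\<And>W g. W > 0 \<Longrightarrow> g \<in> Bernstein_space W p \<Longrightarrow>
    modulus_smoothness s p f (1 / W) \<le> ennreal C * Lp_norm p (\<lambda>x. f x - g x)"
proof -
  \<comment> \<open>this makes \<open>n\<^sup>s K (8 exp 1 / n)\<^sup>s\<^sup>+\<^sup>1\<close> at most \<open>1/2\<close>\<close>
  obtain n :: nat where n0: "2 * K * (8 * exp 1) ^ Suc s < real n" using reals_Archimedean2 by blast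
  have "0 < 2 * K * (8 * exp 1) ^ Suc s" using \<open>K > 0\<close> by simp
  hence n: "real n > 0" using n0 by linarith
  define C where "C = real n ^ s * K * 2 ^ (s + 2) + 2 ^ s"
  show ?thesis
  proof (rule that)
    show "C > 0" using n \<open>K > 0\<close> by (simp add: C_def add_pos_pos)
    fix W g assume "W > 0" and g: "g \<in> Bernstein_space W p"
    have gm: "g \<in> borel_measurable lebesgue" "Lp_norm p g < \<infinity>"
      using g by (auto simp: Bernstein_space_def Lp_space_def)
    have fgm: "(\<lambda>x. f x - g x) \<in> borel_measurable lebesgue" using f gm by (intro borel_measurable_diff)
    have "Lp_norm p (\<lambda>x. f x - g x) \<le> Lp_norm p f + Lp_norm p g" by (intro Lp_norm_diff_le assms gm)
    also have "\<dots> < \<infinity>" using f gm by (simp add: less_top)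
    finally obtain e where e: "Lp_norm p (\<lambda>x. f x - g x) = ennreal e" "e \<ge> 0"
      by (cases "Lp_norm p (\<lambda>x. f x - g x)") auto
    have "modulus_smoothness s p f (1 / W) < \<infinity>" by (rule modulus_smoothness_finite) fact+
    then obtain m where m: "modulus_smoothness s p f (1 / W) = ennreal m" "m \<ge> 0"
      by (cases "modulus_smoothness s p f (1 / W)") auto
    define \<eta> where "\<eta> = 1 / (4 * exp 1 * W)"
    have fg: "Lp_norm p (fwd_diff k h (\<lambda>x. f x - g x)) \<le> ennreal (2 ^ k * e)" for k h
      using Lp_norm_fwd_diff_le[OF \<open>p \<ge> 1\<close> fgm, of k h] e by (simp add: ennreal_mult' ennreal_power[symmetric])
    have g_eta: "Lp_norm p (fwd_diff s \<eta> g) \<le> ennreal (m + 2 ^ s * e)"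
    proof -
      have "1 \<le> 4 * exp (1 :: real)" using exp_ge_add_one_self[of "1 :: real"] by linarith
      hence "\<eta> > 0" "\<eta> \<le> 1 / W"
        using \<open>W > 0\<close> by (auto simp: \<eta>_def intro!: divide_left_mono)
      hence f_eta: "Lp_norm p (fwd_diff s \<eta> f) \<le> ennreal m"
        using Lp_norm_fwd_diff_le_modulus[of \<eta> "1 / W" p s f] m by simp
      have "fwd_diff s \<eta> g = (\<lambda>x. fwd_diff s \<eta> f x - fwd_diff s \<eta> (\<lambda>x. f x - g x) x)"
        by (rule ext) (simp add: fwd_diff_diff)
      hence "Lp_norm p (fwd_diff s \<eta> g) \<le> Lp_norm p (fwd_diff s \<eta> f) + Lp_norm p (fwd_diff s \<eta> (\<lambda>x. f x - g x))"
        using Lp_norm_diff_le[OF \<open>p \<ge> 1\<close> borel_measurable_lebesgue_fwd_diff[OF f(1)] borel_measurable_lebesgue_fwd_diff[OF fgm]]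
        by simp
      also have "\<dots> \<le> ennreal m + ennreal (2 ^ s * e)" by (intro add_mono f_eta fg)
      also have "\<dots> = ennreal (m + 2 ^ s * e)" using m e by (simp add: ennreal_plus)
      finally show ?thesis .
    qed
    define Q where "Q = 2 ^ Suc s * e + (8 * exp 1 / real n) ^ Suc s * (m + 2 ^ s * e)"
    have Q0: "Q \<ge> 0" using m e n by (simp add: Q_def)
    have high: "modulus_smoothness (s + 1) p f (1 / (real n * W)) \<le> ennreal Q"
      unfolding modulus_smoothness_def
    proof (rule SUP_least)
      fix h assume h: "h \<in> {0<..1 / (real n * W)}"
      have hW: "h * W \<le> 1 / real n"
        using h mult_right_mono[of h "1 / (real n * W)" W] \<open>W > 0\<close> by simp
      have "fwd_diff (s + 1) h f = (\<lambda>x. fwd_diff (s + 1) h (\<lambda>x. f x - g x) x + fwd_diff (s + 1) h g x)"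
        by (rule ext) (simp add: fwd_diff_diff)
      hence "Lp_norm p (fwd_diff (s + 1) h f) \<le>
          Lp_norm p (fwd_diff (s + 1) h (\<lambda>x. f x - g x)) + Lp_norm p (fwd_diff (s + 1) h g)"
        using Lp_norm_add_le[OF \<open>p \<ge> 1\<close> borel_measurable_lebesgue_fwd_diff[OF fgm] borel_measurable_lebesgue_fwd_diff[OF gm(1)]]
        by simp
      also have "\<dots> \<le> ennreal (2 ^ (s + 1) * e) + ennreal ((8 * exp 1 / real n) ^ Suc s * (m + 2 ^ s * e))"
      proof (intro add_mono fg)
        have "Lp_norm p (fwd_diff (Suc s) h g) \<le> ennreal ((8 * exp 1 * (h * W)) ^ Suc s) * Lp_norm p (fwd_diff s \<eta> g)"
          unfolding \<eta>_def by (rule nikolskii_stechkin_Lp[OF g \<open>W > 0\<close> \<open>p \<ge> 1\<close>]) (use h in auto)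
        also have "\<dots> \<le> ennreal ((8 * exp 1 / real n) ^ Suc s) * ennreal (m + 2 ^ s * e)"
        proof (intro mult_mono g_eta ennreal_leI power_mono)
          show "8 * exp 1 * (h * W) \<le> 8 * exp 1 / real n"
            using mult_left_mono[OF hW, of "8 * exp 1"] by simp
        qed (use h \<open>W > 0\<close> in auto)
        also have "\<dots> = ennreal ((8 * exp 1 / real n) ^ Suc s * (m + 2 ^ s * e))"
          using n by (intro ennreal_mult'[symmetric]) simp
        finally show "Lp_norm p (fwd_diff (s + 1) h g) \<le> ennreal ((8 * exp 1 / real n) ^ Suc s * (m + 2 ^ s * e))"
          by simp
      qed
      also have "\<dots> = ennreal Q" using m e n by (simp add: Q_def ennreal_plus)
      finally show "Lp_norm p (fwd_diff (s + 1) h f) \<le> ennreal Q" .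
    qed
    have low: "modulus_smoothness s p f (1 / (real n * W)) \<le> ennreal (K * Q)"
    proof -
      have "modulus_smoothness s p f (1 / (real n * W)) \<le> ennreal K * modulus_smoothness (s + 1) p f (1 / (real n * W))"
        by (rule K) (use n \<open>W > 0\<close> in simp)
      also have "\<dots> \<le> ennreal K * ennreal Q" by (intro mult_left_mono high) simp
      finally show ?thesis using \<open>K > 0\<close> by (simp add: ennreal_mult')
    qed
    have "ennreal m \<le> ennreal (real n ^ s * (K * Q))"
      unfolding m(1)[symmetric] modulus_smoothness_def[of s p f "1 / W"]
    proof (rule SUP_least)
      fix h assume h: "h \<in> {0<..1 / W}"
      have "Lp_norm p (fwd_diff s h f) = Lp_norm p (fwd_diff s (real n * (h / real n)) f)" using n by simp
      also have "\<dots> \<le> of_nat n ^ s * Lp_norm p (fwd_diff s (h / real n) f)"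
        by (rule Lp_norm_fwd_diff_multiple_step_le) fact+
      also have "Lp_norm p (fwd_diff s (h / real n) f) \<le> modulus_smoothness s p f (1 / (real n * W))"
        using h n \<open>W > 0\<close> by (intro Lp_norm_fwd_diff_le_modulus) (auto simp: field_simps)
      also note low
      also have "of_nat n ^ s * ennreal (K * Q) = ennreal (real n ^ s * (K * Q))"
        by (simp add: ennreal_mult' ennreal_power[symmetric] ennreal_of_nat_eq_real_of_nat)
      finally show "Lp_norm p (fwd_diff s h f) \<le> ennreal (real n ^ s * (K * Q))" by (simp add: mult_left_mono)
    qed
    hence mQ: "m \<le> real n ^ s * (K * Q)" using Q0 \<open>K > 0\<close> by (simp add: ennreal_le_iff)
    have half: "real n ^ s * K * (8 * exp 1 / real n) ^ Suc s \<le> 1 / 2"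
    proof -
      have "real n ^ s * K * (8 * exp 1 / real n) ^ Suc s = K * (8 * exp 1) ^ Suc s / real n"
        using n by (simp add: power_divide field_simps)
      also have "\<dots> \<le> 1 / 2" using n n0 by (simp add: field_simps)
      finally show ?thesis .
    qed
    have "m \<le> real n ^ s * K * 2 ^ Suc s * e + (real n ^ s * K * (8 * exp 1 / real n) ^ Suc s) * (m + 2 ^ s * e)"
      using mQ by (simp add: Q_def algebra_simps)
    also have "\<dots> \<le> real n ^ s * K * 2 ^ Suc s * e + 1 / 2 * (m + 2 ^ s * e)"
      using half m e by (intro add_left_mono mult_right_mono) auto
    finally have "m \<le> C * e" by (simp add: C_def algebra_simps)
    thus "modulus_smoothness s p f (1 / W) \<le> ennreal C * Lp_norm p (\<lambda>x. f x - g x)"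
      using m e \<open>C > 0\<close> by (simp add: ennreal_mult'[symmetric] ennreal_leI)
  qed
qed

theorem theorem3p9:
  fixes r s :: nat and p K1 K2 K3 K :: real
    and f :: "real \<Rightarrow> complex"
    and \<xi> :: "real \<Rightarrow> int \<Rightarrow> real"
    and \<phi> :: "real \<Rightarrow> int \<Rightarrow> real \<Rightarrow> complex"
    and G :: "real \<Rightarrow> (real \<Rightarrow> complex) \<Rightarrow> real \<Rightarrow> complex"
  assumes "1 \<le> s" and "s \<le> r" and "1 \<le> p"
    and "f \<in> Lambda_space p"
    and "\<And>W. W > 0 \<Longrightarrow> sampling_operator p (\<xi> W) (\<phi> W) (G W)"
    and "\<And>W g. W > 0 \<Longrightarrow> g \<in> Lambda_space p \<Longrightarrow> G W g \<in> Lp_space p"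
    and "K1 > 0" and "K2 > 0" and "K3 > 0"
    and "\<And>W g. W > 0 \<Longrightarrow> g \<in> Lambda_space p \<Longrightarrow>
           ennreal K2 * lp_norm p (uniform_nodes W) g \<le> Lp_norm p (G W g)"
    and "\<And>W g. W > 0 \<Longrightarrow> g \<in> Lambda_space p \<Longrightarrow>
           Lp_norm p (G W g) \<le> ennreal K1 * lp_norm p (uniform_nodes W) g"
    and "\<And>W g. W > 0 \<Longrightarrow> g \<in> Sobolev_space s p \<Longrightarrow>
           Lp_norm p (\<lambda>x. g x - G W g x) \<le> ennreal (K3 / W ^ s) * Lp_norm p (nth_deriv s g)"
    and "\<And>W. W > 0 \<Longrightarrow> G W f \<in> Bernstein_space W p"
    and "K > 0"
    and "\<And>h. h > 0 \<Longrightarrow>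
           modulus_smoothness s p f h \<le> ennreal K * modulus_smoothness (s + 1) p f h"
  shows "\<exists>C1>0. \<exists>C2>0. \<forall>W>0.
           ennreal C1 * semidiscrete_modulus r s p f (1 / W) (uniform_nodes W)
             \<le> Lp_norm p (\<lambda>x. f x - G W f x) \<and>
           Lp_norm p (\<lambda>x. f x - G W f x)
             \<le> ennreal C2 * semidiscrete_modulus r s p f (1 / W) (uniform_nodes W)"
proof -
  note s1 = assms(1) and sr = assms(2) and p1 = assms(3) and f = assms(4) and samp = assms(5) and GLp = assms(6)
    and lower = assms(10) and upper = assms(11) and approx = assms(12) and bern = assms(13) and K = assms(15)
  have fm: "f \<in> borel_measurable lebesgue" by (rule Lambda_space_lebesgue[OF f])
  have ffin: "Lp_norm p f < \<infinity>" by (rule Lambda_space_Lp_norm_finite[OF f p1])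
  obtain C where C: "C > 0" "\<And>W g. W > 0 \<Longrightarrow> g \<in> Bernstein_space W p \<Longrightarrow>
      modulus_smoothness s p f (1 / W) \<le> ennreal C * Lp_norm p (\<lambda>x. f x - g x)"
    by (rule modulus_smoothness_inverse_estimate[OF p1 fm ffin \<open>K > 0\<close> K]) (assumption, rule that)
  \<comment> \<open>\<open>D\<close> times the modulus bounds the \<open>L\<^sup>p\<close> errors of the Steklov average and of sampling it, taken together\<close>
  define D where "D = 2 ^ (r - s) + K3 * (2 * real r) ^ r"
  have D: "D > 0" using \<open>K3 > 0\<close> by (simp add: D_def add_pos_nonneg)
  define C1 where "C1 = 1 / ((D * C + 1) / K2 + C)"
  define C2 where "C2 = D + K1"
  have C1: "C1 > 0" using D C \<open>K2 > 0\<close> by (simp add: C1_def add_pos_pos)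
  have C2: "C2 > 0" using D \<open>K1 > 0\<close> by (simp add: C2_def)
  have main: "ennreal C1 * semidiscrete_modulus r s p f (1 / W) (uniform_nodes W)
        \<le> Lp_norm p (\<lambda>x. f x - G W f x) \<and>
      Lp_norm p (\<lambda>x. f x - G W f x)
        \<le> ennreal C2 * semidiscrete_modulus r s p f (1 / W) (uniform_nodes W)" if W: "W > 0" for W
  proof -
    define F where "F = Steklov (1 / W) r f"
    have W': "1 / W > 0" using W by simp
    note st = Steklov_approximation[OF f p1 s1 sr W', folded F_def]
    define d where "d = (\<lambda>x. F x - f x)"
    have dL: "d \<in> Lambda_space p" unfolding d_def by (rule Lambda_space_diff[OF st(1) f p1])
    have Gd: "G W d x = G W F x - G W f x" for x
      unfolding d_def by (rule sampling_operator_diff[OF samp[OF W] st(1) f dL[unfolded d_def]])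
    have Gm: "G W g \<in> borel_measurable lebesgue" if "g \<in> Lambda_space p" for g
      using GLp[OF W that] by (simp add: Lp_space_def)
    have Fm: "F \<in> borel_measurable lebesgue" by (rule Lambda_space_lebesgue[OF st(1)])
    have dm: "d \<in> borel_measurable lebesgue" by (rule Lambda_space_lebesgue[OF dL])
    have FGm: "(\<lambda>x. F x - G W F x) \<in> borel_measurable lebesgue" by (intro borel_measurable_diff Fm Gm st(1))
    have fGm: "(\<lambda>x. f x - G W f x) \<in> borel_measurable lebesgue" by (intro borel_measurable_diff fm Gm f)
    have "Lp_norm p (\<lambda>x. f x - G W f x) \<le> Lp_norm p f + Lp_norm p (G W f)"
      by (rule Lp_norm_diff_le[OF p1 fm Gm[OF f]])
    also have "\<dots> < \<infinity>" using ffin GLp[OF W f] by (simp add: Lp_space_def less_top)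
    finally obtain e where e: "Lp_norm p (\<lambda>x. f x - G W f x) = ennreal e" "e \<ge> 0"
      by (cases "Lp_norm p (\<lambda>x. f x - G W f x)") auto
    have "modulus_smoothness s p f (1 / W) < \<infinity>" by (rule modulus_smoothness_finite[OF p1 fm ffin])
    then obtain m where m: "modulus_smoothness s p f (1 / W) = ennreal m" "m \<ge> 0"
      by (cases "modulus_smoothness s p f (1 / W)") auto
    have d_le: "Lp_norm p d \<le> ennreal (2 ^ (r - s) * m)"
      using st(3) m by (simp add: d_def ennreal_mult' ennreal_power[symmetric])
    have FG_le: "Lp_norm p (\<lambda>x. F x - G W F x) \<le> ennreal (K3 * (2 * real r) ^ r * m)"
    proof -
      have "Lp_norm p (\<lambda>x. F x - G W F x) \<le> ennreal (K3 / W ^ s) * Lp_norm p (nth_deriv s F)"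
        by (rule approx[OF W st(2)])
      also have "\<dots> \<le> ennreal (K3 / W ^ s) * (ennreal ((2 * real r) ^ r / (1 / W) ^ s) * ennreal m)"
        using st(4) m by (intro mult_left_mono) auto
      also have "\<dots> = ennreal (K3 / W ^ s * ((2 * real r) ^ r / (1 / W) ^ s * m))"
        using W \<open>K3 > 0\<close> m by (simp add: ennreal_mult'[symmetric])
      also have "K3 / W ^ s * ((2 * real r) ^ r / (1 / W) ^ s * m) = K3 * (2 * real r) ^ r * m"
        using W by (simp add: power_one_over field_simps)
      finally show ?thesis .
    qed
    have dF: "Lp_norm p (\<lambda>x. d x - (F x - G W F x)) \<le> ennreal (D * m)"
    proof -
      have "Lp_norm p (\<lambda>x. d x - (F x - G W F x)) \<le> Lp_norm p d + Lp_norm p (\<lambda>x. F x - G W F x)"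
        by (rule Lp_norm_diff_le[OF p1 dm FGm])
      also have "\<dots> \<le> ennreal (2 ^ (r - s) * m) + ennreal (K3 * (2 * real r) ^ r * m)"
        by (intro add_mono d_le FG_le)
      also have "\<dots> = ennreal (D * m)"
        using m \<open>K3 > 0\<close> by (simp add: D_def distrib_right ennreal_plus)
      finally show ?thesis .
    qed
    have Gd_le: "Lp_norm p (G W d) \<le> ennreal (D * m + e)"
    proof -
      have "G W d = (\<lambda>x. (d x - (F x - G W F x)) + (f x - G W f x))"
        by (rule ext, simp only: Gd) (simp add: d_def)
      hence "Lp_norm p (G W d) \<le> Lp_norm p (\<lambda>x. d x - (F x - G W F x)) + Lp_norm p (\<lambda>x. f x - G W f x)"
        using Lp_norm_add_le[OF p1 borel_measurable_diff[OF dm FGm] fGm] by simp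
      also have "\<dots> \<le> ennreal (D * m) + ennreal e" using dF e by (intro add_mono) auto
      also have "\<dots> = ennreal (D * m + e)" using m e D by (simp add: ennreal_plus)
      finally show ?thesis .
    qed
    have K2q: "ennreal K2 * lp_norm p (uniform_nodes W) d \<le> ennreal (D * m + e)"
      by (rule order_trans[OF lower[OF W dL] Gd_le])
    then obtain q where q: "lp_norm p (uniform_nodes W) d = ennreal q" "q \<ge> 0"
      using \<open>K2 > 0\<close> by (cases "lp_norm p (uniform_nodes W) d") (auto simp: ennreal_mult_top top_unique)
    have Dme: "D * m + e \<ge> 0" using D m e by simp
    have q_le: "K2 * q \<le> D * m + e"
      using K2q q \<open>K2 > 0\<close> Dme by (simp add: ennreal_mult'[symmetric] ennreal_le_iff)
    have m_le: "m \<le> C * e"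
      using C(2)[OF W bern[OF W]] m e C(1) by (simp add: ennreal_mult'[symmetric] ennreal_le_iff)
    have semi: "semidiscrete_modulus r s p f (1 / W) (uniform_nodes W) = ennreal (q + m)"
      using q m by (simp add: semidiscrete_modulus_def d_def F_def)
    have "q + m \<le> ((D * C + 1) / K2 + C) * e"
    proof -
      have "K2 * q \<le> (D * C + 1) * e"
        using q_le mult_left_mono[OF m_le less_imp_le[OF D]] by (simp add: algebra_simps)
      hence "q \<le> (D * C + 1) / K2 * e" using \<open>K2 > 0\<close> by (simp add: field_simps)
      thus ?thesis using m_le by (simp add: distrib_right)
    qed
    hence "C1 * (q + m) \<le> e"
      using D C \<open>K2 > 0\<close> by (simp add: C1_def divide_le_eq add_pos_pos mult.commute)
    hence one: "ennreal C1 * semidiscrete_modulus r s p f (1 / W) (uniform_nodes W) \<le> Lp_norm p (\<lambda>x. f x - G W f x)"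
      unfolding semi e using C1 by (simp add: ennreal_mult'[symmetric] ennreal_leI)
    have "Lp_norm p (\<lambda>x. f x - G W f x) \<le> ennreal C2 * semidiscrete_modulus r s p f (1 / W) (uniform_nodes W)"
    proof -
      have Gdm: "G W d \<in> borel_measurable lebesgue" by (rule Gm[OF dL])
      have df: "Lp_norm p (\<lambda>x. (F x - G W F x) - d x) \<le> ennreal (D * m)"
        by (subst Lp_norm_diff_commute) (rule dF)
      have "(\<lambda>x. f x - G W f x) = (\<lambda>x. ((F x - G W F x) - d x) + G W d x)"
        by (rule ext, simp only: Gd) (simp add: d_def)
      hence "Lp_norm p (\<lambda>x. f x - G W f x) \<le> Lp_norm p (\<lambda>x. (F x - G W F x) - d x) + Lp_norm p (G W d)"
        using Lp_norm_add_le[OF p1 borel_measurable_diff[OF FGm dm] Gdm] by simp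
      also have "\<dots> \<le> ennreal (D * m) + ennreal K1 * ennreal q"
        using df upper[OF W dL] q by (intro add_mono) auto
      also have "\<dots> = ennreal (D * m + K1 * q)"
        using D m q \<open>K1 > 0\<close> by (simp add: ennreal_mult'[symmetric] ennreal_plus[symmetric] del: ennreal_plus)
      also have "\<dots> \<le> ennreal (C2 * (q + m))"
        using D m q \<open>K1 > 0\<close> by (intro ennreal_leI) (simp add: C2_def algebra_simps)
      also have "\<dots> = ennreal C2 * ennreal (q + m)" using C2 by (intro ennreal_mult') simp
      finally show ?thesis unfolding semi .
    qed
    with one show ?thesis ..
  qed
  show ?thesis using C1 C2 main by blast
qed

end
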